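(* For $i=1,2$ let $\pi_i=\mathrm{Ind}_{I(\phi_{B_i})}^{\mathrm{GL}_2(\mathfrak o_2)}(\tilde\phi_{B_i})$ be a strongly cuspidal representation of $\mathrm{GL}_2(\mathfrak o_2)$ with central character $\omega_{\pi_i}$. Let $\pi=\mathrm{Ind}_P^{\mathrm{GL}_4(\mathfrak o_2)}(\pi_1\otimes\pi_2)$, where $\pi_1\otimes\pi_2$ is regarded as a representation of $P$ via $P\twoheadrightarrow P/N\cong \mathrm{GL}_2(\mathfrak o_2)\times\mathrm{GL}_2(\mathfrak o_2)$, and let $\omega_\pi$ be the character by which the centre of $\mathrm{GL}_4(\mathfrak o_2)$ acts on $\pi$. Assume $\mathrm{tr}(B_1)\neq\mathrm{tr}(B_2)$ and put $B=\mathrm{diag}(\mathrm{tr}(B_1),\mathrm{tr}(B_2))\in M_2(\mathbb F_q)$. Then, as representations of $\mathrm{GL}_2(\mathfrak o_2)$, $$\pi_{N,\psi}\;\cong\;(\pi_1\otimes\pi_2)\;\oplus\;\mathrm{Ind}_{\mathfrak B_2}^{\mathrm{GL}_2(\mathfrak o_2)}(\omega_{\pi_1}\otimes\omega_{\pi_2})\;\oplus\;\mathrm{Ind}_{Z\cdot J_2^1}^{\mathrm{GL}_2(\mathfrak o_2)}(\omega_\pi\phi_B).$$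
   Context: Let $F$ be a finite unramified extension of $\mathbb Q_p$ or of $\mathbb F_p((t))$, with $p$ odd, $\mathfrak o$ its ring of integers, $\varpi$ a uniformizer, $\mathfrak o/(\varpi)\cong\mathbb F_q$, and $\mathfrak o_2=\mathfrak o/(\varpi^2)$. All representations are finite-dimensional and complex. Fix an additive character $\psi_0:\mathfrak o_2\to\mathbb C^\times$ that is nontrivial on $\varpi\mathfrak o_2$; for $x\in\mathbb F_q$ write $\psi_0(x):=\psi_0(\varpi\tilde x)$ for any lift $\tilde x\in\mathfrak o_2$ of $x$. $P\subset\mathrm{GL}_4(\mathfrak o_2)$ is the subgroup of invertible $2\times2$-block upper triangular matrices $\begin{pmatrix}g_1&X\\0&g_2\end{pmatrix}$ ($g_i\in\mathrm{GL}_2(\mathfrak o_2)$, $X\in M_2(\mathfrak o_2)$), $N\cong M_2(\mathfrak o_2)$ is its subgroup $g_1=g_2=I_2$, and $\psi:N\to\mathbb C^\times$ is $\psi(X)=\psi_0(\mathrm{tr}\,X)$. The degenerate Whittaker space of a representation $(\pi,V)$ of $\mathrm{GL}_4(\mathfrak o_2)$ is $\pi_{N,\psi}=\{v\in V:\pi(n)v=\psi(n)v\ \forall n\in N\}$, a representation of $\mathrm{GL}_2(\mathfrak o_2)$ via $g\mapsto\mathrm{diag}(g,g)$. $J_2^1=I_2+\varpi M_2(\mathfrak o_2)$. For $B\in M_2(\mathbb F_q)$, $\phi_B:J_2^1\to\mathbb C^\times$ is $\phi_B(I_2+\varpi X)=\psi_0(\mathrm{tr}(B\bar X))$, with $\bar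 X$ the reduction of $X$ mod $\varpi$; $I(\phi_B)=\{g\in\mathrm{GL}_2(\mathfrak o_2):\phi_B(g^{-1}xg)=\phi_B(x)\ \forall x\in J_2^1\}$. If $B$ is regular (its characteristic and minimal polynomials coincide), $\phi_B$ extends to one-dimensional characters $\tilde\phi_B$ of $I(\phi_B)$, and $\mathrm{Ind}_{I(\phi_B)}^{\mathrm{GL}_2(\mathfrak o_2)}\tilde\phi_B$ is irreducible; it is called strongly cuspidal when the characteristic polynomial of $B$ is irreducible over $\mathbb F_q$. $\mathfrak B_2$ is the group of upper triangular matrices in $\mathrm{GL}_2(\mathfrak o_2)$ and $(\chi_1\otimes\chi_2)\begin{pmatrix}x&y\\0&z\end{pmatrix}=\chi_1(x)\chi_2(z)$. $Z\cong\mathfrak o_2^\times$ is the centre of $\mathrm{GL}_2(\mathfrak o_2)$; central characters are viewed as characters of $\mathfrak o_2^\times$, and $\omega_\pi\phi_B$ is the character $zj\mapsto\omega_\pi(z)\phi_B(j)$ of $Z\cdot J_2^1$ (here $\omega_\pi=\omega_{\pi_1}\omega_{\pi_2}$, and it agrees with $\phi_B$ on $Z\cap J_2^1$). $\pi_1\otimes\pi_2$ on the right-hand side is the (inner) tensor product as a representation of $\mathrm{GL}_2(\mathfrak o_2)$. *)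

theory Defs
  imports
    "HOL-Computational_Algebra.Formal_Laurent_Series"
    "HOL-Computational_Algebra.Fraction_Field"
    "Berlekamp_Zassenhaus.Finite_Field"
    "Jordan_Normal_Form.Char_Poly"
begin

section \<open>Local fields\<close>

subsection \<open>The fields \<open>\<rat>\<^sub>p\<close>\<close>

text \<open>As for \<^typ>\<open>'p mod_ring\<close>, the prime \<open>p\<close> is the cardinality of the index type. The ring
  \<open>\<int>\<^sub>p\<close> is the inverse limit of the rings \<open>\<int>/p\<^sup>n\<close>, with canonical representatives.\<close>

typedef (overloaded) ('p::prime_card) padic_int =
  "{a :: nat \<Rightarrow> int. \<forall>n. a n \<in> {0..<int CARD('p) ^ n} \<and> a (Suc n) mod int CARD('p) ^ n = a n}"
  by (rule exI[of _ "\<lambda>_. 0"]) (simp add: zero_less_card_finite)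

setup_lifting type_definition_padic_int

lemma padic_p_prime: "prime (int CARD('p::prime_card))"
  using prime_card[where ?'a = 'p] by simp

lemma padic_p_gt_1: "int CARD('p::prime_card) > 1"
  using padic_p_prime[where ?'p = 'p] by (rule prime_gt_1_int)

lemma padic_mod_Suc: "(x mod (p::int) ^ Suc n) mod p ^ n = x mod p ^ n"
  by (simp add: mod_mod_cancel)

lemma padic_repr:
  fixes f :: "nat \<Rightarrow> int"
  assumes "\<And>n. f (Suc n) mod int CARD('p::prime_card) ^ n = f n mod int CARD('p) ^ n"
  shows "f n mod int CARD('p) ^ n \<in> {0..<int CARD('p) ^ n}
    \<and> (f (Suc n) mod int CARD('p) ^ Suc n) mod int CARD('p) ^ n = f n mod int CARD('p) ^ n"
proof -
  have "0 < int CARD('p) ^ n"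
    using padic_p_gt_1[where ?'p = 'p] by simp
  thus ?thesis
    using assms[of n] by (simp only: padic_mod_Suc) simp
qed

instantiation padic_int :: (prime_card) comm_ring_1
begin

lift_definition zero_padic_int :: "'a padic_int" is "\<lambda>_. 0"
  by (simp add: zero_less_card_finite)

lift_definition one_padic_int :: "'a padic_int" is "\<lambda>n. 1 mod int CARD('a) ^ n"
  by (intro allI padic_repr) simp

lift_definition plus_padic_int :: "'a padic_int \<Rightarrow> 'a padic_int \<Rightarrow> 'a padic_int"
  is "\<lambda>a b n. (a n + b n) mod int CARD('a) ^ n"
  by (intro allI padic_repr) (metis mod_add_eq mod_mod_trivial)

lift_definition minus_padic_int :: "'a padic_int \<Rightarrow> 'a padic_int \<Rightarrow> 'a padic_int"
  is "\<lambda>a b n. (a n - b n) mod int CARD('a) ^ n"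
  by (intro allI padic_repr) (metis mod_diff_eq mod_mod_trivial)

lift_definition uminus_padic_int :: "'a padic_int \<Rightarrow> 'a padic_int"
  is "\<lambda>a n. (- a n) mod int CARD('a) ^ n"
  by (intro allI padic_repr) (metis mod_minus_eq mod_mod_trivial)

lift_definition times_padic_int :: "'a padic_int \<Rightarrow> 'a padic_int \<Rightarrow> 'a padic_int"
  is "\<lambda>a b n. (a n * b n) mod int CARD('a) ^ n"
  by (intro allI padic_repr) (metis mod_mult_eq mod_mod_trivial)

instance
proof
  fix a b c :: "'a padic_int"
  show "a * b * c = a * (b * c)" by transfer (simp add: mod_simps mult.assoc)
  show "a * b = b * a" by transfer (simp add: mult.commute)
  show "1 * a = a" by transfer (force simp: mod_simps)
  show "a + b + c = a + (b + c)" by transfer (simp add: mod_simps add.assoc)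
  show "a + b = b + a" by transfer (simp add: add.commute)
  show "0 + a = a" by transfer force
  show "- a + a = 0" by transfer (simp add: mod_simps)
  show "a - b = a + - b" by transfer (simp add: mod_simps)
  show "(a + b) * c = a * c + b * c" by transfer (simp add: mod_simps distrib_right)
  have "1 mod int CARD('a) ^ 1 = 1"
    unfolding power_one_right using padic_p_gt_1[where ?'p = 'a] by (intro mod_pos_pos_trivial zero_le_one)
  hence "1 mod int CARD('a) ^ 1 \<noteq> 0" by linarith
  thus "(0::'a padic_int) \<noteq> 1" by transfer metis
qed

end

lemma padic_mod_le:
  assumes "\<forall>n. a n \<in> {0..<(p::int) ^ n} \<and> a (Suc n) mod p ^ n = a n"
  shows "a (m + k) mod p ^ m = a m"
proof (induction k)
  case 0
  show ?case using assms by simp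
next
  case (Suc k)
  have "a (m + Suc k) mod p ^ m = (a (Suc (m + k)) mod p ^ (m + k)) mod p ^ m"
    by (simp add: mod_mod_cancel le_imp_power_dvd)
  thus ?case using assms Suc by simp
qed

instance padic_int :: (prime_card) idom
proof
  fix a b :: "'a padic_int"
  assume "a \<noteq> 0" "b \<noteq> 0"
  thus "a * b \<noteq> 0"
  proof transfer
    fix a b :: "nat \<Rightarrow> int"
    let ?p = "int CARD('a)"
    assume a: "\<forall>n. a n \<in> {0..<?p ^ n} \<and> a (Suc n) mod ?p ^ n = a n"
      and b: "\<forall>n. b n \<in> {0..<?p ^ n} \<and> b (Suc n) mod ?p ^ n = b n"
      and "a \<noteq> (\<lambda>_. 0)" "b \<noteq> (\<lambda>_. 0)"
    then obtain m n where mn: "a m \<noteq> 0" "b n \<noteq> 0" by blast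
    have na: "\<not> ?p ^ m dvd a (m + n)"
      using padic_mod_le[OF a, of m n] mn by (simp add: dvd_eq_mod_eq_0)
    have nb: "\<not> ?p ^ n dvd b (m + n)"
      using padic_mod_le[OF b, of n m] mn by (simp add: dvd_eq_mod_eq_0 add.commute)
    have "\<not> ?p ^ (m + n) dvd a (m + n) * b (m + n)"
    proof
      assume d: "?p ^ (m + n) dvd a (m + n) * b (m + n)"
      have p: "prime_elem ?p"
        using padic_p_prime[where ?'p = 'a] by (rule prime_imp_prime_elem)
      have z: "a (m + n) \<noteq> 0" "b (m + n) \<noteq> 0" using na nb by (auto intro: notI)
      have u: "\<not> is_unit ?p" using p unfolding prime_elem_def by blast
      have "multiplicity ?p (a (m + n)) < m" "multiplicity ?p (b (m + n)) < n"
        using na nb z u by (auto intro: multiplicity_lessI)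
      moreover have "m + n \<le> multiplicity ?p (a (m + n) * b (m + n))"
        using d z u by (intro multiplicity_geI) auto
      ultimately show False
        using z by (simp add: prime_elem_multiplicity_mult_distrib[OF p])
    qed
    thus "(\<lambda>n. (a n * b n) mod ?p ^ n) \<noteq> (\<lambda>_. 0)"
      by (metis dvd_eq_mod_eq_0)
  qed
qed

type_synonym 'p padic = "'p padic_int fract"

definition padic_integers :: "'p::prime_card padic set" where
  "padic_integers = range (\<lambda>a. Fract a 1)"

subsection \<open>Finite unramified extensions\<close>

text \<open>Normalized discrete valuations; the value at \<open>0\<close> (conventionally \<open>\<infinity>\<close>) is irrelevant.\<close>

definition normalized_valuation :: "('f::field \<Rightarrow> int) \<Rightarrow> bool" where
  "normalized_valuation v \<longleftrightarrow>
     (\<forall>x y. x \<noteq> 0 \<longrightarrow> y \<noteq> 0 \<longrightarrow> v (x * y) = v x + v y) \<and>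
     (\<forall>x y. x \<noteq> 0 \<longrightarrow> y \<noteq> 0 \<longrightarrow> x + y \<noteq> 0 \<longrightarrow> min (v x) (v y) \<le> v (x + y)) \<and>
     (\<exists>x. x \<noteq> 0 \<and> v x = 1)"

definition valuation_ring :: "('f::field \<Rightarrow> int) \<Rightarrow> 'f set" where
  "valuation_ring v = {x. x = 0 \<or> 0 \<le> v x}"

definition uniformizer :: "('f::field \<Rightarrow> int) \<Rightarrow> 'f \<Rightarrow> bool" where
  "uniformizer v w \<longleftrightarrow> w \<noteq> 0 \<and> v w = 1"

text \<open>\<open>\<iota>\<close> embeds the complete discretely valued field \<open>'b\<close>, with valuation ring \<open>\<O>\<close>, into \<open>'f\<close>; the
  extension has finite degree; the valuation \<open>v\<close> of \<open>'f\<close> lies over that of \<open>'b\<close> (so that \<open>v\<close> is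
  the unique one doing so); and the ramification index is 1. The residue extension is
  automatically separable in the cases below, where the residue field of \<open>'b\<close> is finite.\<close>

definition finite_unramified_extension ::
    "('b::field \<Rightarrow> 'f::field) \<Rightarrow> 'b set \<Rightarrow> ('f \<Rightarrow> int) \<Rightarrow> bool" where
  "finite_unramified_extension \<iota> \<O> v \<longleftrightarrow>
     \<iota> 1 = 1 \<and> (\<forall>x y. \<iota> (x + y) = \<iota> x + \<iota> y) \<and> (\<forall>x y. \<iota> (x * y) = \<iota> x * \<iota> y) \<and>
     (\<exists>S. finite S \<and> (\<forall>x. \<exists>c. x = (\<Sum>s\<in>S. \<iota> (c s) * s))) \<and>
     normalized_valuation v \<and>
     (\<forall>a. a \<in> \<O> \<longleftrightarrow> \<iota> a \<in> valuation_ring v) \<and>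
     (\<exists>a. uniformizer v (\<iota> a))"

definition unramified_local_field ::
    "'p::prime_card itself \<Rightarrow> ('f::field \<Rightarrow> int) \<Rightarrow> bool" where
  "unramified_local_field _ v \<longleftrightarrow>
     (\<exists>\<iota> :: 'p padic \<Rightarrow> 'f. finite_unramified_extension \<iota> padic_integers v) \<or>
     (\<exists>\<iota> :: 'p mod_ring fls \<Rightarrow> 'f. finite_unramified_extension \<iota> (range fps_to_fls) v)"

text \<open>\<open>f\<close> exhibits the type \<open>'r\<close> as the quotient of the subring \<open>\<O>\<close> by its principal ideal \<open>(a)\<close>.\<close>

definition quotient_by ::
    "'f::comm_ring_1 set \<Rightarrow> 'f \<Rightarrow> ('f \<Rightarrow> 'r::comm_ring_1) \<Rightarrow> bool" where
  "quotient_by \<O> a f \<longleftrightarrow>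
     f 1 = 1 \<and> (\<forall>x\<in>\<O>. \<forall>y\<in>\<O>. f (x + y) = f x + f y) \<and> (\<forall>x\<in>\<O>. \<forall>y\<in>\<O>. f (x * y) = f x * f y) \<and>
     f ` \<O> = UNIV \<and> (\<forall>x\<in>\<O>. f x = 0 \<longleftrightarrow> (\<exists>y\<in>\<O>. x = a * y))"

section \<open>Representations\<close>

text \<open>Finite-dimensional complex vector spaces are realised as spaces of functions \<open>'i \<Rightarrow> complex\<close>,
  with pointwise operations. The action matters only for elements of the group at hand and
  vectors of the space.\<close>

record ('g, 'i) rep =
  rep_space :: "('i \<Rightarrow> complex) set"
  rep_act :: "'g \<Rightarrow> ('i \<Rightarrow> complex) \<Rightarrow> ('i \<Rightarrow> complex)"

definition rep_iso :: "('g, 'm) monoid_scheme \<Rightarrow> ('g, 'i) rep \<Rightarrow> ('g, 'j) rep \<Rightarrow> bool" where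
  "rep_iso G V W \<longleftrightarrow> (\<exists>T. bij_betw T (rep_space V) (rep_space W) \<and>
     (\<forall>f\<in>rep_space V. \<forall>h\<in>rep_space V. T (\<lambda>i. f i + h i) = (\<lambda>j. T f j + T h j)) \<and>
     (\<forall>c. \<forall>f\<in>rep_space V. T (\<lambda>i. c * f i) = (\<lambda>j. c * T f j)) \<and>
     (\<forall>g\<in>carrier G. \<forall>f\<in>rep_space V. T (rep_act V g f) = rep_act W g (T f)))"

definition linear_character :: "('g, 'm) monoid_scheme \<Rightarrow> 'g set \<Rightarrow> ('g \<Rightarrow> complex) \<Rightarrow> bool" where
  "linear_character G H \<chi> \<longleftrightarrow> (\<forall>x\<in>H. \<chi> x \<noteq> 0) \<and> (\<forall>x\<in>H. \<forall>y\<in>H. \<chi> (x \<otimes>\<^bsub>G\<^esub> y) = \<chi> x * \<chi> y)"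

definition character_rep :: "('g \<Rightarrow> complex) \<Rightarrow> ('g, unit) rep" where
  "character_rep \<chi> = \<lparr>rep_space = UNIV, rep_act = (\<lambda>g f i. \<chi> g * f i)\<rparr>"

text \<open>The space of functions \<open>f\<close> from \<open>G\<close> to the space of \<open>V\<close> (uncurried, and extended by \<open>0\<close>
  outside \<open>G\<close>) such that \<open>f (h x) = h \<cdot> f x\<close> for \<open>h \<in> H\<close>, under right translation.\<close>

definition Ind :: "('g, 'm) monoid_scheme \<Rightarrow> 'g set \<Rightarrow> ('g, 'i) rep \<Rightarrow> ('g, 'g \<times> 'i) rep" where
  "Ind G H V = \<lparr>
     rep_space = {f. (\<forall>x\<in>carrier G. (\<lambda>i. f (x, i)) \<in> rep_space V) \<and>
                     (\<forall>h\<in>H. \<forall>x\<in>carrier G.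
                        (\<lambda>i. f (h \<otimes>\<^bsub>G\<^esub> x, i)) = rep_act V h (\<lambda>i. f (x, i))) \<and>
                     (\<forall>x i. x \<notin> carrier G \<longrightarrow> f (x, i) = 0)},
     rep_act = (\<lambda>g f (x, i). if x \<in> carrier G then f (x \<otimes>\<^bsub>G\<^esub> g, i) else 0)\<rparr>"

definition direct_sum :: "('g, 'i) rep \<Rightarrow> ('g, 'j) rep \<Rightarrow> ('g, 'i + 'j) rep" (infixr "\<oplus>\<^sub>R" 65) where
  "V \<oplus>\<^sub>R W = \<lparr>
     rep_space = {f. f \<circ> Inl \<in> rep_space V \<and> f \<circ> Inr \<in> rep_space W},
     rep_act = (\<lambda>g f. case_sum (rep_act V g (f \<circ> Inl)) (rep_act W g (f \<circ> Inr)))\<rparr>"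

text \<open>For \<open>V \<subseteq> ('i \<Rightarrow> complex)\<close> and \<open>W \<subseteq> ('j \<Rightarrow> complex)\<close>, the tensor product is the span of the
  functions \<open>(i, j) \<mapsto> f i * h j\<close>. The operator \<open>A \<otimes> B\<close> applies \<open>A\<close> in the first and \<open>B\<close> in the
  second variable, so that it sends \<open>f \<otimes> h\<close> to \<open>A f \<otimes> B h\<close>.\<close>

definition outer_tensor :: "('g, 'i) rep \<Rightarrow> ('h, 'j) rep \<Rightarrow> ('g \<times> 'h, 'i \<times> 'j) rep" where
  "outer_tensor V W = \<lparr>
     rep_space = {(\<lambda>(i, j). \<Sum>k<n. f k i * h k j) | (n::nat) f h.
                    \<forall>k<n. f k \<in> rep_space V \<and> h k \<in> rep_space W},
     rep_act = (\<lambda>(a, b) F (i, j).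
                  rep_act W b (\<lambda>j'. rep_act V a (\<lambda>i'. F (i', j')) i) j)\<rparr>"

definition rep_pullback :: "('h \<Rightarrow> 'g) \<Rightarrow> ('g, 'i) rep \<Rightarrow> ('h, 'i) rep" where
  "rep_pullback \<phi> V = \<lparr>rep_space = rep_space V, rep_act = (\<lambda>h. rep_act V (\<phi> h))\<rparr>"

definition inner_tensor :: "('g, 'i) rep \<Rightarrow> ('g, 'j) rep \<Rightarrow> ('g, 'i \<times> 'j) rep" (infixr "\<otimes>\<^sub>R" 70) where
  "V \<otimes>\<^sub>R W = rep_pullback (\<lambda>g. (g, g)) (outer_tensor V W)"

section \<open>The groups\<close>

definition GL :: "nat \<Rightarrow> 'r::comm_ring_1 mat monoid" where
  "GL n = units_of (ring_mat TYPE('r) n ())"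

definition mat_trace :: "'r::comm_monoid_add mat \<Rightarrow> 'r" where
  "mat_trace A = (\<Sum>i<dim_row A. A $$ (i, i))"

text \<open>The scalar by which the central element \<open>z I\<^sub>n\<close> acts, for \<open>z\<close> a unit.\<close>

definition central_character ::
    "nat \<Rightarrow> ('r::comm_ring_1 mat, 'i) rep \<Rightarrow> 'r \<Rightarrow> complex" where
  "central_character n V z =
     (THE c. \<forall>f\<in>rep_space V. rep_act V (z \<cdot>\<^sub>m 1\<^sub>m n) f = (\<lambda>i. c * f i))"

definition block_parabolic :: "'r::comm_ring_1 mat set" where
  "block_parabolic = {four_block_mat g1 X (0\<^sub>m 2 2) g2 | g1 X g2.
     g1 \<in> carrier (GL 2) \<and> X \<in> carrier_mat 2 2 \<and> g2 \<in> carrier (GL 2)}"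

definition levi_projection :: "'r mat \<Rightarrow> 'r mat \<times> 'r mat" where
  "levi_projection p = (case split_block p 2 2 of (g1, _, _, g2) \<Rightarrow> (g1, g2))"

definition unipotent :: "'r::comm_ring_1 mat \<Rightarrow> 'r mat" where
  "unipotent X = four_block_mat (1\<^sub>m 2) X (0\<^sub>m 2 2) (1\<^sub>m 2)"

definition degenerate_Whittaker ::
    "('r::comm_ring_1 \<Rightarrow> complex) \<Rightarrow> ('r mat, 'i) rep \<Rightarrow> ('r mat, 'i) rep" where
  "degenerate_Whittaker \<psi>\<^sub>0 V = \<lparr>
     rep_space = {f \<in> rep_space V. \<forall>X\<in>carrier_mat 2 2.
                    rep_act V (unipotent X) f = (\<lambda>i. \<psi>\<^sub>0 (mat_trace X) * f i)},
     rep_act = (\<lambda>g. rep_act V (four_block_mat g (0\<^sub>m 2 2) (0\<^sub>m 2 2) g))\<rparr>"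

definition borel2 :: "'r::comm_ring_1 mat set" where
  "borel2 = {g \<in> carrier (GL 2). upper_triangular g}"

definition borel_character :: "('r \<Rightarrow> complex) \<Rightarrow> ('r \<Rightarrow> complex) \<Rightarrow> 'r mat \<Rightarrow> complex" where
  "borel_character \<chi>1 \<chi>2 b = \<chi>1 (b $$ (0, 0)) * \<chi>2 (b $$ (1, 1))"

text \<open>Below, \<open>w\<close> is the image in \<open>\<oo>\<^sub>2 = 'r\<close> of the uniformizer and \<open>red\<close> is the reduction map from
  \<open>\<oo>\<^sub>2\<close> to the residue field \<open>'k\<close>.\<close>

definition additive_character :: "'r::comm_ring_1 \<Rightarrow> ('r \<Rightarrow> complex) \<Rightarrow> bool" where
  "additive_character w \<psi>\<^sub>0 \<longleftrightarrow>
     (\<forall>x. \<psi>\<^sub>0 x \<noteq> 0) \<and> (\<forall>x y. \<psi>\<^sub>0 (x + y) = \<psi>\<^sub>0 x * \<psi>\<^sub>0 y) \<and> (\<exists>x. \<psi>\<^sub>0 (w * x) \<noteq> 1)"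

text \<open>\<open>\<psi>\<^sub>0 (x) = \<psi>\<^sub>0 (w x')\<close> for any lift \<open>x'\<close> of \<open>x\<close>; the choice does not matter since \<open>w\<^sup>2 = 0\<close>.\<close>

definition residue_character ::
    "'r::comm_ring_1 \<Rightarrow> ('r \<Rightarrow> 'k) \<Rightarrow> ('r \<Rightarrow> complex) \<Rightarrow> 'k \<Rightarrow> complex" where
  "residue_character w red \<psi>\<^sub>0 x = \<psi>\<^sub>0 (w * (SOME x'. red x' = x))"

definition congruence_subgroup :: "'r::comm_ring_1 \<Rightarrow> 'r mat set" where
  "congruence_subgroup w = {1\<^sub>m 2 + w \<cdot>\<^sub>m X | X. X \<in> carrier_mat 2 2}"

text \<open>\<open>\<phi>\<^sub>B (I\<^sub>2 + w X) = \<psi>\<^sub>0 (tr (B X'))\<close>, where \<open>X'\<close> is the reduction of \<open>X\<close>; the matrix \<open>X\<close> is only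
  determined up to a matrix of reduction \<open>0\<close>, which does not affect the value.\<close>

definition phi ::
    "'r::comm_ring_1 \<Rightarrow> ('r \<Rightarrow> 'k::comm_ring_1) \<Rightarrow> ('r \<Rightarrow> complex) \<Rightarrow> 'k mat \<Rightarrow> 'r mat \<Rightarrow> complex" where
  "phi w red \<psi>\<^sub>0 B j = residue_character w red \<psi>\<^sub>0
     (mat_trace (B * map_mat red (SOME X. X \<in> carrier_mat 2 2 \<and> j = 1\<^sub>m 2 + w \<cdot>\<^sub>m X)))"

definition inertia_group ::
    "'r::comm_ring_1 \<Rightarrow> ('r \<Rightarrow> 'k::comm_ring_1) \<Rightarrow> ('r \<Rightarrow> complex) \<Rightarrow> 'k mat \<Rightarrow> 'r mat set" where
  "inertia_group w red \<psi>\<^sub>0 B = {g \<in> carrier (GL 2). \<forall>x\<in>congruence_subgroup w.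
     phi w red \<psi>\<^sub>0 B (inv\<^bsub>GL 2\<^esub> g \<otimes>\<^bsub>GL 2\<^esub> x \<otimes>\<^bsub>GL 2\<^esub> g) = phi w red \<psi>\<^sub>0 B x}"

text \<open>Data defining a strongly cuspidal representation: \<open>B\<close> has irreducible characteristic
  polynomial (hence is regular), and \<open>\<phi>'\<close> is a character of the inertia group extending \<open>\<phi>\<^sub>B\<close>.\<close>

definition strongly_cuspidal_datum ::
    "'r::comm_ring_1 \<Rightarrow> ('r \<Rightarrow> 'k::field) \<Rightarrow> ('r \<Rightarrow> complex) \<Rightarrow> 'k mat \<Rightarrow> ('r mat \<Rightarrow> complex) \<Rightarrow> bool" where
  "strongly_cuspidal_datum w red \<psi>\<^sub>0 B \<phi>' \<longleftrightarrow>
     B \<in> carrier_mat 2 2 \<and> irreducible (char_poly B) \<and>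
     linear_character (GL 2) (inertia_group w red \<psi>\<^sub>0 B) \<phi>' \<and>
     (\<forall>j\<in>congruence_subgroup w. \<phi>' j = phi w red \<psi>\<^sub>0 B j)"

definition cuspidal_rep ::
    "'r::comm_ring_1 \<Rightarrow> ('r \<Rightarrow> 'k::field) \<Rightarrow> ('r \<Rightarrow> complex) \<Rightarrow> 'k mat \<Rightarrow> ('r mat \<Rightarrow> complex) \<Rightarrow>
     ('r mat, 'r mat \<times> unit) rep" where
  "cuspidal_rep w red \<psi>\<^sub>0 B \<phi>' = Ind (GL 2) (inertia_group w red \<psi>\<^sub>0 B) (character_rep \<phi>')"

definition center_congruence :: "'r::comm_ring_1 \<Rightarrow> 'r mat set" where
  "center_congruence w = {z \<cdot>\<^sub>m j | z j. z dvd 1 \<and> j \<in> congruence_subgroup w}"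

text \<open>The character \<open>z j \<mapsto> \<omega> z * \<phi> j\<close> of \<open>Z \<cdot> J\<close>; it is well defined when \<open>\<omega>\<close> and \<open>\<phi>\<close> are
  characters that agree on \<open>Z \<inter> J\<close>.\<close>

definition center_congruence_character ::
    "'r::comm_ring_1 \<Rightarrow> ('r \<Rightarrow> complex) \<Rightarrow> ('r mat \<Rightarrow> complex) \<Rightarrow> 'r mat \<Rightarrow> complex" where
  "center_congruence_character w \<omega> \<phi> h =
     (THE c. \<exists>z j. z dvd 1 \<and> j \<in> congruence_subgroup w \<and> h = z \<cdot>\<^sub>m j \<and> c = \<omega> z * \<phi> j)"

end

theory Submission
  imports Defs
begin

text \<open>
  The proof is Mackey theory made explicit. Write \<open>R\<close> for the ring \<open>\<oo>\<^sub>2\<close> and \<open>w\<close> for the image of the uniformizer.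
  Each \<open>\<pi>\<^sub>i\<close> is induced from a character of an inertia group, so \<open>\<pi>\<close> is induced from a character
  of the subgroup of \<open>P\<close> with diagonal blocks in the two inertia groups. A vector of the Whittaker space thus
  becomes a scalar function \<open>F\<close> on \<open>GL\<^sub>4(R)\<close> that transforms by this character from the left and by
  \<open>\<psi>\<close> under \<open>N\<close> from the right, with \<open>GL\<^sub>2(R)\<close> acting from the right through \<open>diag(g, g)\<close>
  (\<open>whittaker_iso\<close>).

  Such an \<open>F\<close> is studied according to the lower left block \<open>C\<close> of its argument. If \<open>C\<close> is invertible, the argument
  is moved to an antidiagonal block matrix, and the values there form a vector of \<open>\<pi>\<^sub>1 \<otimes> \<pi>\<^sub>2\<close>. If \<open>C\<close> vanishes
  modulo \<open>w\<close>, then the elements of \<open>N\<close> with entries in \<open>(w)\<close> act trivially from the left but not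
  through \<open>\<psi>\<close>, and \<open>F\<close> vanishes. If \<open>C\<close> has rank one modulo \<open>w\<close>, its elementary divisors are
  \<open>1, 0\<close> or \<open>1, w\<close>. In each of these two cases the lower left entries of the conjugates of \<open>B\<^sub>i\<close> are nonzero,
  and comparing the characters of the stabilisers leaves exactly one orbit of the diagonal
  \<open>GL\<^sub>2(R)\<close> on which \<open>F\<close> may be nonzero. The stabiliser is the group of upper triangular matrices in the first
  case, and in the second its subgroup of matrices with congruent diagonal entries; the
  character is \<open>\<omega>\<^sub>1 \<otimes> \<omega>\<^sub>2\<close> both times. That \<open>F\<close> is determined by
  its restriction to the three orbits is \<open>W_vanish\<close>, and that the restrictions are arbitrary is \<open>W_extend\<close>.

  The calculations become short after a common normalisation of \<open>B\<^sub>1\<close> and \<open>B\<^sub>2\<close>. An irreducible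
  characteristic polynomial makes the lower left entries nonzero, and since the traces \<open>t\<^sub>1 \<noteq> t\<^sub>2\<close>
  differ there is a unique \<open>s\<close> such that the matrices are conjugate to \<open>[s, q; 1, t\<^sub>1 - s]\<close> and
  \<open>[t\<^sub>2 - s, q; 1, s]\<close> with the same \<open>q\<close>.

  The third orbit does not yet give the third summand, which is induced from \<open>Z J\<close>. Both
  groups are polarisations inside \<open>Z J U\<close>, with \<open>U\<close> the upper unipotent matrices, and a finite Fourier transform
  intertwines the two induced representations (\<open>Bor_cong_iso_ZJ\<close>). The difference of the traces is the frequency of the
  kernel, which is therefore nondegenerate.

  Finally, all spaces must be finite, which rests on the finiteness of the residue field; this is deduced from the
  finite degree of the extension (\<open>unramified_residue_finite\<close>).
\<close>

section \<open>Matrices of size two over a ring, and blocks of them\<close>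

text \<open>The polymorphic type is applied twice: \<open>'r m2 m2\<close> is the ring of \<open>4 \<times> 4\<close> matrices cut into
  \<open>2 \<times> 2\<close> blocks. This is why the ring operations below are set up over noncommutative entries.\<close>

datatype 'a m2 = M2 (e11: 'a) (e12: 'a) (e21: 'a) (e22: 'a)

instantiation m2 :: (ring_1) ring_1
begin
definition "0 = M2 0 0 0 0"
definition "1 = M2 1 0 0 1"
fun plus_m2 where "M2 a b c d + M2 a' b' c' d' = M2 (a + a') (b + b') (c + c') (d + d')"
fun minus_m2 where "M2 a b c d - M2 a' b' c' d' = M2 (a - a') (b - b') (c - c') (d - d')"
fun uminus_m2 where "- M2 a b c d = M2 (- a) (- b) (- c) (- d)"
fun times_m2 where "M2 a b c d * M2 a' b' c' d' =
  M2 (a * a' + b * c') (a * b' + b * d') (c * a' + d * c') (c * b' + d * d')"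
instance
proof
  fix x y z :: "'a m2"
  show "x * y * z = x * (y * z)" by (cases x; cases y; cases z) (simp add: algebra_simps)
  show "x + y + z = x + (y + z)" by (cases x; cases y; cases z) (simp add: algebra_simps)
  show "x + y = y + x" by (cases x; cases y) (simp add: algebra_simps)
  show "0 + x = x" "- x + x = 0" "1 * x = x" "x * 1 = x"
    by (cases x; simp add: zero_m2_def one_m2_def)+
  show "x - y = x + - y" by (cases x; cases y) simp
  show "(x + y) * z = x * z + y * z" "z * (x + y) = z * x + z * y"
    by (cases x; cases y; cases z; simp add: algebra_simps)+
  show "(0::'a m2) \<noteq> 1" by (simp add: zero_m2_def one_m2_def)
qed
end

lemma one_block: "(1 :: 'a::ring_1 m2 m2) = M2 1 0 0 1"
  by (rule one_m2_def)

lemmas m2_simps = zero_m2_def one_m2_def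

definition invertible :: "'a::ring_1 \<Rightarrow> bool" where
  "invertible x \<longleftrightarrow> (\<exists>y. x * y = 1 \<and> y * x = 1)"

text \<open>Inverses in an arbitrary unital ring, so that one notion serves scalars, \<open>2 \<times> 2\<close> and
  \<open>4 \<times> 4\<close> matrices.\<close>

definition recip :: "'a::ring_1 \<Rightarrow> 'a" where
  "recip x = (SOME y. x * y = 1 \<and> y * x = 1)"

lemma recip:
  assumes "invertible x"
  shows "x * recip x = 1" "recip x * x = 1"
  using someI_ex[OF assms[unfolded invertible_def]] by (auto simp: recip_def)

lemma recip_cancel:
  assumes "invertible x"
  shows "x * (recip x * y) = y" "recip x * (x * y) = y"
  using recip[OF assms] by (simp_all flip: mult.assoc)

lemma invertibleI: "x * y = 1 \<Longrightarrow> y * x = 1 \<Longrightarrow> invertible x"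
  by (auto simp: invertible_def)

lemma invertible_one [simp]: "invertible 1"
  by (rule invertibleI[of _ 1]) simp_all

lemma recip_unique: "x * y = 1 \<Longrightarrow> y * x = 1 \<Longrightarrow> recip x = y"
  by (metis invertibleI mult.assoc mult.right_neutral mult_1 recip(1))

lemma recip_one [simp]: "recip 1 = 1"
  by (rule recip_unique) simp_all

lemma invertible_recip [simp]: "invertible x \<Longrightarrow> invertible (recip x)"
  by (meson invertibleI recip)

lemma recip_recip [simp]: "invertible x \<Longrightarrow> recip (recip x) = x"
  by (simp add: recip recip_unique)

lemma
  assumes "invertible x" "invertible y"
  shows invertible_mult [simp]: "invertible (x * y)"
    and recip_mult: "recip (x * y) = recip y * recip x"
proof -
  have "(x * y) * (recip y * recip x) = 1" "(recip y * recip x) * (x * y) = 1"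
    using recip_cancel[OF assms(1)] recip_cancel[OF assms(2)] recip[OF assms(1)] recip[OF assms(2)]
    by (simp_all add: mult.assoc)
  thus "invertible (x * y)" "recip (x * y) = recip y * recip x"
    by (auto intro: invertibleI recip_unique)
qed

lemma invertible_mult_left [simp]: "invertible x \<Longrightarrow> invertible (x * y) \<longleftrightarrow> invertible y"
  by (metis invertible_mult invertible_recip recip_cancel(2))

lemma invertible_mult_right [simp]: "invertible y \<Longrightarrow> invertible (x * y) \<longleftrightarrow> invertible x"
  by (metis invertible_mult invertible_recip mult.assoc mult.right_neutral recip(1))

lemma invertible_dvd: "invertible (x::'a::comm_ring_1) \<longleftrightarrow> x dvd 1"
  by (auto simp: invertible_def dvd_def mult.commute)

fun det2 :: "'a::comm_ring_1 m2 \<Rightarrow> 'a" where "det2 (M2 a b c d) = a * d - b * c"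
fun tr2 :: "'a::comm_ring_1 m2 \<Rightarrow> 'a" where "tr2 (M2 a b c d) = a + d"
fun adj2 :: "'a::comm_ring_1 m2 \<Rightarrow> 'a m2" where "adj2 (M2 a b c d) = M2 d (- b) (- c) a"

abbreviation sc :: "'a::ring_1 \<Rightarrow> 'a m2" where "sc a \<equiv> M2 a 0 0 a"

lemma det2_mult [simp]: "det2 (x * y) = det2 x * det2 y"
  by (cases x; cases y) (simp add: algebra_simps)

lemma det2_one [simp]: "det2 1 = 1" by (simp add: m2_simps)

lemma tr2_comm: "tr2 (x * y) = tr2 (y * x)"
  by (cases x; cases y) (simp add: algebra_simps)

lemma tr2_add: "tr2 (x + y) = tr2 x + tr2 y"
  by (cases x; cases y) (simp add: algebra_simps)

lemma tr2_diff: "tr2 (x - y) = tr2 x - tr2 y"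
  by (cases x; cases y) (simp add: algebra_simps)

lemma tr2_sc: "tr2 (sc a * x) = a * tr2 x"
  by (cases x) (simp add: algebra_simps)

lemma sc_comm: "sc a * x = x * sc (a::'a::comm_ring_1)"
  by (cases x) (simp add: algebra_simps)

lemma invertible_det2: "invertible (x :: 'a::comm_ring_1 m2) \<longleftrightarrow> invertible (det2 x)"
proof
  assume "invertible x"
  then obtain y where "x * y = 1" unfolding invertible_def by blast
  hence "det2 x * det2 y = 1" by (metis det2_mult det2_one)
  thus "invertible (det2 x)" by (metis dvd_triv_left invertible_dvd)
next
  assume "invertible (det2 x)"
  note r = recip(1)[OF this]
  obtain a b c d where x: "x = M2 a b c d" by (cases x)
  let ?r = "recip (det2 x)"
  have 1: "(a * d - b * c) * ?r = 1" using r x by simp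
  have "x * (sc ?r * adj2 x) = 1" "(sc ?r * adj2 x) * x = 1"
    using 1 by (auto simp: x m2_simps algebra_simps)
  thus "invertible x" by (rule invertibleI)
qed

text \<open>A one-sided inverse suffices because the determinant detects units.\<close>

lemma m2_right_inverse:
  assumes "x * y = (1 :: 'a::comm_ring_1 m2)"
  shows "invertible x" "y = recip x"
proof -
  have "det2 x * det2 y = 1" using assms by (metis det2_mult det2_one)
  thus i: "invertible x" unfolding invertible_det2 by (metis dvd_triv_left invertible_dvd)
  show "y = recip x" using recip_cancel(2)[OF i, of y] assms by simp
qed

section \<open>Comparison with matrices as carriers\<close>

definition mat2 :: "'a m2 \<Rightarrow> 'a mat" where
  "mat2 x = mat 2 2 (\<lambda>(i, j). if i = 0 then (if j = 0 then e11 x else e12 x)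
                               else (if j = 0 then e21 x else e22 x))"

definition of_mat2 :: "'a mat \<Rightarrow> 'a m2" where
  "of_mat2 A = M2 (A $$ (0, 0)) (A $$ (0, 1)) (A $$ (1, 0)) (A $$ (1, 1))"

lemma less_2: "i < 2 \<longleftrightarrow> i = 0 \<or> i = (1::nat)" by auto

lemma mat2_carrier [simp]: "mat2 x \<in> carrier_mat 2 2" by (simp add: mat2_def)
lemma mat2_dim [simp]: "dim_row (mat2 x) = 2" "dim_col (mat2 x) = 2" by (simp_all add: mat2_def)

lemma mat2_index [simp]:
  "mat2 x $$ (0, 0) = e11 x" "mat2 x $$ (0, Suc 0) = e12 x"
  "mat2 x $$ (Suc 0, 0) = e21 x" "mat2 x $$ (Suc 0, Suc 0) = e22 x"
  by (simp_all add: mat2_def)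

lemma of_mat2_mat2 [simp]: "of_mat2 (mat2 x) = x"
  by (cases x) (simp add: of_mat2_def)

lemma eq_mat2I:
  assumes "A \<in> carrier_mat 2 2" "B \<in> carrier_mat 2 2"
    and "A $$ (0, 0) = B $$ (0, 0)" "A $$ (0, 1) = B $$ (0, 1)"
    and "A $$ (1, 0) = B $$ (1, 0)" "A $$ (1, 1) = B $$ (1, 1)"
  shows "A = B"
  using assms by (intro eq_matI) (auto simp: less_2)

lemma mat2_of_mat2 [simp]: "A \<in> carrier_mat 2 2 \<Longrightarrow> mat2 (of_mat2 A) = A"
  by (rule eq_mat2I) (simp_all add: of_mat2_def)

lemma mat2_inj [simp]: "mat2 x = mat2 y \<longleftrightarrow> x = y"
  by (metis of_mat2_mat2)

lemma carrier_mat2E: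
  assumes "A \<in> carrier_mat 2 2" obtains x where "A = mat2 x"
  using assms mat2_of_mat2 by metis

lemma mat2_mult [simp]: "mat2 x * mat2 y = mat2 (x * y :: 'a::comm_ring_1 m2)"
  by (cases x; cases y; rule eq_mat2I)
     (auto simp: scalar_prod_def numeral_2_eq_2)

lemma mat2_add [simp]: "mat2 x + mat2 y = mat2 (x + y :: 'a::comm_ring_1 m2)"
  by (cases x; cases y; rule eq_mat2I) auto

lemma mat2_one [simp]: "mat2 (1 :: 'a::comm_ring_1 m2) = 1\<^sub>m 2"
  by (rule eq_mat2I) (auto simp: m2_simps)

lemma mat2_zero [simp]: "mat2 (0 :: 'a::comm_ring_1 m2) = 0\<^sub>m 2 2"
  by (rule eq_mat2I) (auto simp: m2_simps)

lemma mat2_smult [simp]: "a \<cdot>\<^sub>m mat2 x = mat2 (sc a * x :: 'a::comm_ring_1 m2)"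
  by (cases x; rule eq_mat2I) auto

lemma mat_trace_mat2 [simp]: "mat_trace (mat2 x) = tr2 (x :: 'a::comm_ring_1 m2)"
  by (cases x) (simp add: mat_trace_def numeral_2_eq_2)

definition mat4 :: "'a m2 m2 \<Rightarrow> 'a::comm_ring_1 mat" where
  "mat4 x = four_block_mat (mat2 (e11 x)) (mat2 (e12 x)) (mat2 (e21 x)) (mat2 (e22 x))"

lemma mat4_carrier [simp]: "mat4 x \<in> carrier_mat 4 4"
  using four_block_carrier_mat[of "mat2 (e11 x)" 2 2 "mat2 (e22 x)" 2 2 "mat2 (e12 x)" "mat2 (e21 x)"]
  by (simp add: mat4_def)

lemma mat4_mult [simp]: "mat4 x * mat4 y = mat4 (x * y)"
  by (cases x; cases y)
     (simp add: mat4_def mult_four_block_mat[of _ 2 2 _ 2 _ 2 _ _ 2 _ 2])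

lemma mat4_one [simp]: "mat4 1 = 1\<^sub>m 4"
  using four_block_one_mat[of 2 2] by (simp add: mat4_def one_m2_def[where 'a = "'a m2"])

lemma split_block_mat4 [simp]:
  "split_block (mat4 x) 2 2 = (mat2 (e11 x), mat2 (e12 x), mat2 (e21 x), mat2 (e22 x))"
  by (auto simp: split_block_def mat4_def Let_def less_2 numeral_2_eq_2 intro!: eq_matI)

lemma mat4_inj [simp]: "mat4 x = mat4 y \<longleftrightarrow> x = y"
proof
  assume "mat4 x = mat4 y"
  hence "split_block (mat4 x) 2 2 = split_block (mat4 y) 2 2" by simp
  thus "x = y" by (simp add: m2.expand)
qed simp

lemma carrier_mat4E:
  assumes "A \<in> carrier_mat 4 4" obtains x where "A = mat4 x"
proof -
  obtain A1 A2 A3 A4 where s: "split_block A 2 2 = (A1, A2, A3, A4)"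
    by (metis prod_cases4)
  have *: "A1 \<in> carrier_mat 2 2" "A2 \<in> carrier_mat 2 2" "A3 \<in> carrier_mat 2 2" "A4 \<in> carrier_mat 2 2"
    "A = four_block_mat A1 A2 A3 A4"
    using split_block[OF s, of 2 2] assms by auto
  have "A = mat4 (M2 (of_mat2 A1) (of_mat2 A2) (of_mat2 A3) (of_mat2 A4))"
    using * by (simp add: mat4_def)
  thus thesis by (rule that)
qed

lemma Units_ring_mat: "Units (ring_mat TYPE('a::comm_ring_1) n ()) =
  {A \<in> carrier_mat n n. \<exists>B\<in>carrier_mat n n. B * A = 1\<^sub>m n \<and> A * B = 1\<^sub>m n}"
  by (auto simp: Units_def ring_mat_def)

lemma GL_mult [simp]: "x \<otimes>\<^bsub>GL n\<^esub> y = x * y"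
  by (simp add: GL_def units_of_mult ring_mat_def)

lemma GL_one: "\<one>\<^bsub>GL n\<^esub> = 1\<^sub>m n"
  by (simp add: GL_def units_of_one ring_mat_def)

lemma group_GL: "group (GL n :: 'a::comm_ring_1 mat monoid)"
proof -
  interpret ring "ring_mat TYPE('a) n ()" by (rule ring_mat)
  show ?thesis unfolding GL_def by (rule units_group)
qed

lemma GL2_carrier: "carrier (GL 2) = mat2 ` Collect (invertible :: 'a::comm_ring_1 m2 \<Rightarrow> bool)"
proof -
  have "A \<in> carrier (GL 2) \<longleftrightarrow> A \<in> mat2 ` Collect invertible" for A :: "'a mat"
  proof
    assume "A \<in> carrier (GL 2)"
    then obtain B where *: "A \<in> carrier_mat 2 2" "B \<in> carrier_mat 2 2" "B * A = 1\<^sub>m 2" "A * B = 1\<^sub>m 2"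
      by (auto simp: GL_def units_of_carrier Units_ring_mat)
    obtain x y where xy: "A = mat2 x" "B = mat2 y" using * by (metis carrier_mat2E)
    have "invertible x" using *(3,4) unfolding xy
      by (metis invertibleI mat2_inj mat2_mult mat2_one)
    thus "A \<in> mat2 ` Collect invertible" using xy by simp
  next
    assume "A \<in> mat2 ` Collect invertible"
    then obtain x y where "A = mat2 x" "x * y = 1" "y * x = 1" by (auto simp: invertible_def)
    thus "A \<in> carrier (GL 2)" unfolding GL_def units_of_carrier Units_ring_mat
      by (auto intro!: bexI[of _ "mat2 y"])
  qed
  thus ?thesis by blast
qed

lemma GL4_carrier: "carrier (GL 4) = mat4 ` Collect (invertible :: 'a::comm_ring_1 m2 m2 \<Rightarrow> bool)"
proof -
  have "A \<in> carrier (GL 4) \<longleftrightarrow> A \<in> mat4 ` Collect invertible" for A :: "'a mat"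
  proof
    assume "A \<in> carrier (GL 4)"
    then obtain B where *: "A \<in> carrier_mat 4 4" "B \<in> carrier_mat 4 4" "B * A = 1\<^sub>m 4" "A * B = 1\<^sub>m 4"
      by (auto simp: GL_def units_of_carrier Units_ring_mat)
    obtain x y where xy: "A = mat4 x" "B = mat4 y" using * by (metis carrier_mat4E)
    have "invertible x" using *(3,4) unfolding xy
      by (metis invertibleI mat4_inj mat4_mult mat4_one)
    thus "A \<in> mat4 ` Collect invertible" using xy by simp
  next
    assume "A \<in> mat4 ` Collect invertible"
    then obtain x y where "A = mat4 x" "x * y = 1" "y * x = 1" by (auto simp: invertible_def)
    thus "A \<in> carrier (GL 4)" unfolding GL_def units_of_carrier Units_ring_mat
      by (auto intro!: bexI[of _ "mat4 y"])
  qed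
  thus ?thesis by blast
qed

lemma GL2_mem [simp]: "mat2 x \<in> carrier (GL 2) \<longleftrightarrow> invertible (x::'a::comm_ring_1 m2)"
  by (auto simp: GL2_carrier)

lemma GL4_mem [simp]: "mat4 x \<in> carrier (GL 4) \<longleftrightarrow> invertible (x::'a::comm_ring_1 m2 m2)"
  by (auto simp: GL4_carrier)

lemma GL2_inv [simp]: "invertible x \<Longrightarrow> inv\<^bsub>GL 2\<^esub> (mat2 x) = mat2 (recip (x::'a::comm_ring_1 m2))"
  by (rule group.inv_equality[OF group_GL]) (simp_all add: recip GL_one)

lemma invertible_mult_iff:
  "invertible (a * b :: 'a::comm_ring_1) \<longleftrightarrow> invertible a \<and> invertible b"
  by (auto dest: dvd_mult_left dvd_mult_right simp: invertible_dvd)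

lemma recip_triangular:
  assumes "invertible a" "invertible (b :: 'a::ring_1)"
  shows "invertible (M2 a x 0 b)" "recip (M2 a x 0 b) = M2 (recip a) (- (recip a * x * recip b)) 0 (recip b)"
proof -
  let ?y = "M2 (recip a) (- (recip a * x * recip b)) 0 (recip b)"
  have "M2 a x 0 b * ?y = 1" "?y * M2 a x 0 b = 1"
    using assms by (simp_all add: m2_simps recip recip_cancel mult.assoc)
  thus "invertible (M2 a x 0 b)" "recip (M2 a x 0 b) = ?y"
    by (rule invertibleI recip_unique; assumption)+
qed

section \<open>Square-zero local rings and characters of inertia groups\<close>

text \<open>The properties of \<open>\<oo>\<^sub>2\<close> that matter: a finite local ring whose maximal ideal \<open>(w)\<close> has square zero
  and equals the annihilator of \<open>w\<close>, with an additive character that is nontrivial on \<open>(w)\<close>.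
  Congruences modulo \<open>w\<close> are expressed by \<open>w * x = w * y\<close>, which keeps the residue field out of
  all computations.\<close>

locale dual_ring =
  fixes w :: "'r::comm_ring_1" and \<psi> :: "'r \<Rightarrow> complex"
  assumes finite_ring: "finite (UNIV :: 'r set)"
    and ww: "w * w = 0"
    and unit_or_dvd: "invertible x \<or> w dvd x"
    and ann_w: "w * x = 0 \<Longrightarrow> w dvd x"
    and psi_nz: "\<psi> x \<noteq> 0"
    and psi_add: "\<psi> (x + y) = \<psi> x * \<psi> y"
    and psi_nontriv: "\<exists>x. \<psi> (w * x) \<noteq> 1"
begin

lemma psi_0 [simp]: "\<psi> 0 = 1"
  by (metis add_0 mult_cancel_right1 psi_add psi_nz)

lemma psi_minus: "\<psi> (- x) = inverse (\<psi> x)"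
  by (metis inverse_unique psi_0 psi_add right_minus)

lemma w_nz: "w \<noteq> 0"
  using psi_nontriv by auto

lemma ww' [simp]: "w * w = 0" "w * (w * x) = 0"
  using ww by (simp_all flip: mult.assoc)

lemma dvd_iff: "w dvd x \<longleftrightarrow> w * x = 0"
  using ann_w by auto

lemma not_invertible_iff: "\<not> invertible x \<longleftrightarrow> w * x = 0"
proof
  assume "w * x = 0"
  hence "invertible x \<Longrightarrow> w = 0"
    by (metis mult.commute mult.right_neutral mult_zero_right recip_cancel(2))
  thus "\<not> invertible x" using w_nz by blast
qed (use unit_or_dvd dvd_iff in blast)

lemma psi_w_nondegenerate:
  assumes "\<And>t. \<psi> (w * (m * t)) = 1"
  shows "w * m = 0"
proof (rule ccontr)
  assume "w * m \<noteq> 0"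
  hence "invertible m" using not_invertible_iff by blast
  hence "\<psi> (w * x) = 1" for x using assms[of "recip m * x"] by (simp add: recip_cancel)
  thus False using psi_nontriv by blast
qed

lemma psi_nondegenerate:
  assumes "\<And>t. \<psi> (m * t) = 1"
  shows "m = 0"
proof -
  have "\<psi> (w * (m * t)) = 1" for t using assms[of "w * t"] by (simp add: algebra_simps)
  hence "w * m = 0" by (rule psi_w_nondegenerate)
  then obtain k where k: "m = w * k" using ann_w by (auto simp: dvd_def)
  have "\<psi> (w * (k * t)) = 1" for t using assms[of t] by (simp add: k algebra_simps)
  thus ?thesis using psi_w_nondegenerate k by blast
qed

text \<open>The inertia group of \<open>\<phi>\<^sub>B\<close> when \<open>N\<close> is a lift of \<open>B\<close>: the units whose reduction commutes with \<open>B\<close>.\<close>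

definition cent :: "'r m2 \<Rightarrow> 'r m2 set" where
  "cent N = {h. invertible h \<and> sc w * (h * N) = sc w * (N * h)}"

lemma sc_w_cancel:
  assumes "invertible x" "sc w * (x * y) = sc w * (x * z)"
  shows "sc w * y = sc w * (z :: 'r m2)"
proof -
  have "recip x * (x * (sc w * y)) = recip x * (x * (sc w * z))"
    using assms(2) by (simp add: sc_comm mult.assoc)
  thus ?thesis using assms(1) by (simp only: recip_cancel)
qed

lemma cent_invertible: "h \<in> cent N \<Longrightarrow> invertible h"
  by (simp add: cent_def)

lemma cent_mult: "g \<in> cent N \<Longrightarrow> h \<in> cent N \<Longrightarrow> g * h \<in> cent N"
proof -
  assume g: "g \<in> cent N" and h: "h \<in> cent N"
  have "sc w * (g * h * N) = g * (sc w * (h * N))" by (simp add: sc_comm mult.assoc)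
  also have "\<dots> = (sc w * (g * N)) * h" using h by (simp add: cent_def) (simp add: sc_comm mult.assoc)
  also have "\<dots> = sc w * (N * (g * h))" using g by (simp add: cent_def) (simp add: mult.assoc)
  finally show ?thesis using g h by (simp add: cent_def)
qed

lemma cent_recip: 
  assumes "h \<in> cent N" shows "recip h \<in> cent N"
proof -
  have i: "invertible h" and c: "sc w * (h * N) = sc w * (N * h)" using assms by (auto simp: cent_def)
  have "sc w * (h * (recip h * N)) = (sc w * (N * h)) * recip h"
    using i by (simp add: recip_cancel recip mult.assoc)
  also have "\<dots> = sc w * (h * (N * recip h))" by (simp flip: c) (simp add: mult.assoc)
  finally have "sc w * (h * (recip h * N)) = sc w * (h * (N * recip h))" .
  thus ?thesis using i by (auto simp: cent_def dest: sc_w_cancel)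
qed

lemma one_cent: "1 \<in> cent N" by (simp add: cent_def)

lemma sc_invertible: "invertible a \<Longrightarrow> invertible (sc (a::'r))"
  by (simp add: invertible_det2)

lemma one_plus_invertible: "invertible (1 + sc w * (Y :: 'r m2))"
  by (rule invertibleI[of _ "1 - sc w * Y"]) (cases Y; simp add: m2_simps algebra_simps)+

end

text \<open>A character of the inertia group that extends \<open>\<phi>\<^sub>B\<close>, where \<open>N\<close> lifts \<open>B\<close>.\<close>

locale cusp = dual_ring w \<psi> for w :: "'r::comm_ring_1" and \<psi> +
  fixes N :: "'r m2" and \<phi> :: "'r m2 \<Rightarrow> complex"
  assumes phi_mult: "g \<in> cent N \<Longrightarrow> h \<in> cent N \<Longrightarrow> \<phi> (g * h) = \<phi> g * \<phi> h"
    and phi_J: "\<phi> (1 + sc w * Y) = \<psi> (w * tr2 (N * Y))"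
begin

lemma phi_one: "\<phi> 1 = 1"
  using phi_J[of 0] by (simp add: m2_simps split: m2.split) (cases N; simp)

lemma J_cent: "1 + sc w * Y \<in> cent N"
proof -
  have "sc w * ((1 + sc w * Y) * N) = sc w * (N * (1 + sc w * Y))"
    by (cases Y; cases N) (simp add: m2_simps algebra_simps)
  thus ?thesis using one_plus_invertible by (simp add: cent_def)
qed

lemma sc_cent: "invertible a \<Longrightarrow> sc a \<in> cent N"
  using sc_invertible by (cases N) (simp add: cent_def algebra_simps)

text \<open>An element congruent to a scalar \<open>a\<close> lies in the inertia group whatever \<open>N\<close> is, and the character
  is known on it, since it is \<open>a\<close> times an element of the congruence subgroup. The stabilisers
  of the two orbits of rank one consist of such elements, which is why the extensions of the \<open>\<phi>\<^sub>B\<close> enter the last two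
  summands only through the central characters.\<close>

lemma phi_near:
  assumes "invertible a"
  shows "sc a + sc w * Y \<in> cent N" "\<phi> (sc a + sc w * Y) = \<phi> (sc a) * \<psi> (w * (recip a * tr2 (N * Y)))"
proof -
  have *: "sc a + sc w * Y = sc a * (1 + sc w * (sc (recip a) * Y))"
    using recip_cancel(1)[OF assms, of "w * _"]
    by (cases Y) (simp add: m2_simps algebra_simps)
  show "sc a + sc w * Y \<in> cent N" unfolding * using sc_cent assms J_cent by (intro cent_mult)
  show "\<phi> (sc a + sc w * Y) = \<phi> (sc a) * \<psi> (w * (recip a * tr2 (N * Y)))"
    unfolding * using sc_cent assms J_cent
    by (simp add: phi_mult phi_J flip: tr2_sc) (metis sc_comm mult.assoc)
qed

end

section \<open>Double cosets and their stabilisers\<close>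

text \<open>The two subgroups that act on the right: \<open>dg x = diag(x, x)\<close>, and the unipotent radical \<open>uni X\<close>.\<close>

abbreviation dg :: "'r::comm_ring_1 m2 \<Rightarrow> 'r m2 m2" where "dg x \<equiv> M2 x 0 0 x"
abbreviation uni :: "'r::comm_ring_1 m2 \<Rightarrow> 'r m2 m2" where "uni X \<equiv> M2 1 X 0 1"

text \<open>Up to the left action of \<open>P\<close> a matrix is determined by its two bottom rows \<open>(C D)\<close>. Here they are
  \<open>(0 1 | 0 0)\<close> and \<open>(\<delta> 0 | d 1)\<close>, the normal form for \<open>C\<close> of rank one modulo \<open>w\<close>; the
  values \<open>\<delta> = 0\<close> and \<open>\<delta> = w\<close> give the two families of double cosets of this kind.\<close>

definition rank1_rep :: "'r::comm_ring_1 \<Rightarrow> 'r \<Rightarrow> 'r m2 m2" where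
  "rank1_rep \<delta> d = M2 (M2 1 0 0 0) (M2 0 0 1 0) (M2 0 1 \<delta> 0) (M2 0 0 d 1)"

lemma rank1_rep_invertible: "invertible (rank1_rep \<delta> d)"
  by (rule invertibleI[of _ "M2 (M2 1 0 0 0) (M2 0 0 1 0) (M2 0 1 (-\<delta>) (-d)) (M2 0 0 0 1)"])
     (simp_all add: rank1_rep_def m2_simps)

lemma triangular_invertible:
  "invertible (M2 a Z 0 b) \<longleftrightarrow> invertible a \<and> invertible (b :: 'r::comm_ring_1 m2)"
proof
  assume "invertible (M2 a Z 0 b)"
  then obtain y where y: "M2 a Z 0 b * y = 1" "y * M2 a Z 0 b = 1" by (auto simp: invertible_def)
  obtain p q r u where "y = M2 p q r u" by (cases y)
  hence "p * a = 1" "b * u = 1" using y by (auto simp: one_block)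
  thus "invertible a \<and> invertible b"
    by (metis invertible_recip m2_right_inverse)
next
  assume *: "invertible a \<and> invertible b"
  thus "invertible (M2 a Z 0 b)" by (simp add: recip_triangular)
qed

lemma dg_invertible [simp]: "invertible (dg x) \<longleftrightarrow> invertible x"
  by (simp add: triangular_invertible)

lemma nn_invertible [simp]: "invertible (uni X)"
  by (simp add: triangular_invertible)

lemma dg_one: "dg 1 = 1" by (simp add: m2_simps)

lemma nn_dg: "invertible x \<Longrightarrow> uni X * dg x = dg x * uni (recip x * X * x)"
  by (simp add: recip_cancel mult.assoc)

lemma tr2_conj: "invertible x \<Longrightarrow> tr2 (recip x * X * x) = tr2 X"
  using tr2_comm[of "recip x * X" x] by (simp add: recip_cancel)

text \<open>The matrices \<open>B\<^sub>1\<close> and \<open>B\<^sub>2\<close> are put in the special form with equal entry \<open>s\<close> in the positions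
  \<open>(1,1)\<close> and \<open>(2,2)\<close> respectively, equal entry \<open>q\<close>, and lower left entry one. This is possible by
  conjugation when their lower left entries are units and the traces \<open>t1\<close> and \<open>t2\<close> differ modulo \<open>w\<close>, and it makes the characters of
  the stabilisers in the lemma \<open>stabiliser\<close> depend on diagonal entries only.\<close>

locale mackey =
  dual_ring w \<psi> +
  c1: cusp w \<psi> "M2 s q 1 (t1 - s)" \<phi>1 +
  c2: cusp w \<psi> "M2 (t2 - s) q 1 s" \<phi>2
  for w :: "'r::comm_ring_1" and \<psi> s q t1 t2 \<phi>1 \<phi>2
begin

abbreviation "I1 \<equiv> cent (M2 s q 1 (t1 - s))"
abbreviation "I2 \<equiv> cent (M2 (t2 - s) q 1 s)"

text \<open>The degenerate Whittaker space as a space of scalar functions on \<open>GL\<^sub>4\<close>: an induced representation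
  from \<open>P\<close> of tensor products of representations that are themselves induced from characters is
  induced from a character of the subgroup of \<open>P\<close> with diagonal blocks in the inertia groups.\<close>

definition W :: "('r m2 m2 \<Rightarrow> complex) set" where
  "W = {F. (\<forall>g. \<not> invertible g \<longrightarrow> F g = 0) \<and>
     (\<forall>h1\<in>I1. \<forall>h2\<in>I2. \<forall>Z g. F (M2 h1 Z 0 h2 * g) = \<phi>1 h1 * \<phi>2 h2 * F g) \<and>
     (\<forall>X g. F (g * uni X) = \<psi> (tr2 X) * F g)}"

lemma nilpotent_scalar: "\<delta> \<in> {0, w} \<Longrightarrow> \<exists>k. \<delta> = w * k"
  by (metis insertE mult.right_neutral mult_zero_right singletonD)

text \<open>Let \<open>j\<close> be the representative. The elements \<open>[g, Y; 0, g]\<close> that \<open>j\<close> conjugates into the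
  inducing subgroup form the stabiliser of its double coset. Comparing rows determines \<open>h1\<close> and \<open>h2\<close>
  in terms of \<open>g\<close> and \<open>Y\<close>; membership in the inertia groups then forces \<open>g\<close> to be upper triangular, and
  for \<open>\<delta> = w\<close> with congruent diagonal entries. Because of the normal form of the \<open>B\<^sub>i\<close>, the two contributions
  of \<open>s * y12 + q * g12\<close> to the character cancel.\<close>

lemma stabiliser:
  assumes \<delta>: "\<delta> \<in> {0, w}" and h: "h1 \<in> I1" "h2 \<in> I2" and g: "invertible g"
    and eq: "M2 h1 Z 0 h2 * rank1_rep \<delta> 0 = rank1_rep \<delta> 0 * M2 g Y 0 g"
  shows "e21 g = 0" "\<delta> * e11 g = \<delta> * e22 g"
    "\<phi>1 h1 * \<phi>2 h2 = \<phi>1 (sc (e11 g)) * \<phi>2 (sc (e22 g)) * \<psi> (tr2 (recip g * Y))"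
proof -
  obtain k where k: "\<delta> = w * k" using nilpotent_scalar[OF \<delta>] by blast
  have \<delta>\<delta>: "\<delta> * \<delta> = 0" "w * \<delta> = 0" "\<delta> * (\<delta> * x) = 0" "w * (\<delta> * x) = 0" "\<delta> * (w * x) = 0" for x
    by (simp_all add: k algebra_simps)
  obtain g11 g12 g21 g22 where gg: "g = M2 g11 g12 g21 g22" by (cases g)
  obtain y11 y12 y21 y22 where Y: "Y = M2 y11 y12 y21 y22" by (cases Y)
  obtain a b c d where hh1: "h1 = M2 a b c d" by (cases h1)
  obtain a' b' c' d' where hh2: "h2 = M2 a' b' c' d'" by (cases h2)
  obtain z11 z12 z21 z22 where Z: "Z = M2 z11 z12 z21 z22" by (cases Z)
  have E: "a + z12 * \<delta> = g11 \<and> b = y11 \<and> z12 = y12 \<and> c + z22 * \<delta> = 0 \<and> d = g11 \<and> z22 = g12 \<and>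
      b' * \<delta> = g21 \<and> a' = g22 \<and> y21 = 0 \<and> b' = y22 \<and>
      d' * \<delta> = \<delta> * g11 \<and> c' = \<delta> * g12 \<and> \<delta> * y11 + g21 = 0 \<and> d' = \<delta> * y12 + g22"
    using eq by (simp add: rank1_rep_def gg Y hh1 hh2 Z m2_simps) (elim conjE, simp)
  have h1: "h1 = M2 (g11 - \<delta> * y12) y11 (- \<delta> * g12) g11"
    using E by (elim conjE) (simp add: hh1 eq_diff_eq eq_neg_iff_add_eq_0 mult.commute)
  have h2: "h2 = M2 g22 y22 (\<delta> * g12) (g22 + \<delta> * y12)"
    using E by (elim conjE) (simp add: hh2 add.commute)
  have r: "y21 = 0" "g21 = \<delta> * y22" "(g22 + \<delta> * y12) * \<delta> = \<delta> * g11"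
    using E by (elim conjE, simp add: mult.commute add.commute)+
  have "w * y11 = 0" using h(1) unfolding h1 cent_def k
    by (simp add: algebra_simps)
  then obtain y where y: "y11 = w * y" using ann_w by (auto simp: dvd_def)
  have "w * y22 = 0" using h(2) unfolding h2 cent_def k
    by (simp add: algebra_simps)
  then obtain \<eta> where \<eta>: "y22 = w * \<eta>" using ann_w by (auto simp: dvd_def)
  have g21: "g21 = 0" using r \<eta> by (simp add: \<delta>\<delta>)
  thus "e21 g = 0" by (simp add: gg)
  have gd: "\<delta> * g11 = \<delta> * g22" using r(3) by (simp add: algebra_simps \<delta>\<delta>)
  thus "\<delta> * e11 g = \<delta> * e22 g" by (simp add: gg)
  have "invertible (g11 * g22)" using g by (simp add: gg g21 invertible_det2)
  hence iu: "invertible g11" "invertible g22"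
    by (simp_all add: invertible_mult_iff)
  have r12: "\<delta> * recip g11 = \<delta> * recip g22"
    using gd iu by (metis mult.assoc mult.commute recip_cancel(2))
  have "recip g = M2 (recip g11) (- recip g11 * g12 * recip g22) 0 (recip g22)"
    unfolding gg g21 using iu by (simp add: recip_triangular mult.assoc)
  hence T: "tr2 (recip g * Y) = recip g11 * y11 + recip g22 * y22"
    by (simp add: Y r)
  have 1: "h1 = sc g11 + sc w * M2 (- k * y12) y (- k * g12) 0"
    by (simp add: h1 k y algebra_simps)
  have 2: "h2 = sc g22 + sc w * M2 0 \<eta> (k * g12) (k * y12)"
    by (simp add: h2 k \<eta> algebra_simps)
  have P1: "\<phi>1 h1 = \<phi>1 (sc g11) * \<psi> (recip g11 * y11 - \<delta> * recip g11 * (s * y12 + q * g12))"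
    unfolding 1 c1.phi_near(2)[OF iu(1)] by (simp add: k y algebra_simps)
  have P2: "\<phi>2 h2 = \<phi>2 (sc g22) * \<psi> (recip g22 * y22 + \<delta> * recip g22 * (s * y12 + q * g12))"
    unfolding 2 c2.phi_near(2)[OF iu(2)] by (simp add: k \<eta> algebra_simps)
  show "\<phi>1 h1 * \<phi>2 h2 = \<phi>1 (sc (e11 g)) * \<phi>2 (sc (e22 g)) * \<psi> (tr2 (recip g * Y))"
    unfolding P1 P2 T r12 by (simp add: gg flip: psi_add)
qed

text \<open>The converse: every such upper triangular \<open>g\<close> does occur, with \<open>Y = 0\<close>.\<close>

lemma rank1_rep_equivariance:
  assumes \<delta>: "\<delta> \<in> {0, w}" and g: "invertible g" "e21 g = 0" "\<delta> * e11 g = \<delta> * e22 g"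
  obtains h1 h2 Z where "h1 \<in> I1" "h2 \<in> I2" "M2 h1 Z 0 h2 * rank1_rep \<delta> 0 = rank1_rep \<delta> 0 * dg g"
    "\<phi>1 h1 * \<phi>2 h2 = \<phi>1 (sc (e11 g)) * \<phi>2 (sc (e22 g))"
proof -
  obtain k where k: "\<delta> = w * k" using nilpotent_scalar[OF \<delta>] by blast
  obtain a b d where gg: "g = M2 a b 0 d" using g(2) by (cases g) auto
  have "invertible (a * d)" using g(1) by (simp add: gg invertible_det2)
  hence iu: "invertible a" "invertible d"
    by (simp_all add: invertible_mult_iff)
  let ?h1 = "sc a + sc w * M2 0 0 (- k * b) 0"
  let ?h2 = "sc d + sc w * M2 0 0 (k * b) 0"
  have eq: "M2 ?h1 (sc b) 0 ?h2 * rank1_rep \<delta> 0 = rank1_rep \<delta> 0 * dg g"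
    using g(3) by (simp add: rank1_rep_def gg m2_simps k algebra_simps)
  have m: "?h1 \<in> I1" "?h2 \<in> I2" by (rule c1.phi_near(1)[OF iu(1)] c2.phi_near(1)[OF iu(2)])+
  have "\<phi>1 ?h1 * \<phi>2 ?h2 = \<phi>1 (sc (e11 g)) * \<phi>2 (sc (e22 g))"
    using stabiliser(3)[OF \<delta> m g(1) eq] by (cases "recip g") (simp add: m2_simps)
  thus thesis using that m eq by blast
qed


lemma e21_sandwich:
  "e21 (M2 h1 Z 0 h2 * u * M2 g Y 0 g') = h2 * e21 u * (g :: 'r m2)"
  by (cases u) (simp add: mult.assoc)

text \<open>The stabiliser computation restated for two points \<open>x\<close>, \<open>x'\<close> of the orbit of a representative
  under the diagonal \<open>GL\<^sub>2\<close>: it is applied to \<open>diag(x', x') uni(-X) diag(x, x)\<^sup>-\<^sup>1\<close>, which has the form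
  \<open>[g, Y; 0, g]\<close> with \<open>g = x' x\<^sup>-\<^sup>1\<close>.\<close>

lemma extension_compatible_Borel:
  assumes \<delta>: "\<delta> \<in> {0, w}" and h: "h1 \<in> I1" "h2 \<in> I2" and x: "invertible x" "invertible x'"
    and eq: "M2 h1 Z 0 h2 * (rank1_rep \<delta> 0 * dg x) * uni X = rank1_rep \<delta> 0 * dg x'"
  obtains g where "invertible g" "x' = g * x" "e21 g = 0" "\<delta> * e11 g = \<delta> * e22 g"
    "\<phi>1 h1 * \<phi>2 h2 * \<psi> (tr2 X) = \<phi>1 (sc (e11 g)) * \<phi>2 (sc (e22 g))"
proof -
  define g where "g = x' * recip x"
  define Y where "Y = - (x' * X * recip x)"
  have gi: "invertible g" using x by (simp add: g_def)
  have xg: "x' = g * x" using x by (simp add: g_def mult.assoc recip)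
  have 1: "dg x' * uni (- X) * dg (recip x) = M2 g Y 0 g"
    by (simp add: g_def Y_def mult.assoc)
  have 2: "uni X * uni (- X) = 1" by (simp add: one_block)
  have 3: "dg x * dg (recip x) = 1" using x by (simp add: recip one_block)
  have "rank1_rep \<delta> 0 * M2 g Y 0 g = (M2 h1 Z 0 h2 * (rank1_rep \<delta> 0 * dg x) * uni X) * (uni (- X) * dg (recip x))"
    unfolding eq by (simp only: 1[symmetric] mult.assoc)
  also have "\<dots> = M2 h1 Z 0 h2 * rank1_rep \<delta> 0 * (dg x * ((uni X * uni (- X)) * dg (recip x)))"
    by (simp only: mult.assoc)
  also have "\<dots> = M2 h1 Z 0 h2 * rank1_rep \<delta> 0" by (simp only: 2 3 mult_1 mult_1_right)
  finally have e: "M2 h1 Z 0 h2 * rank1_rep \<delta> 0 = rank1_rep \<delta> 0 * M2 g Y 0 g" by simp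
  have "recip g * Y = - (recip (recip x) * X * recip x)"
    using x by (simp add: g_def Y_def recip_mult recip_cancel mult.assoc)
  hence "tr2 (recip g * Y) = - tr2 (recip (recip x) * X * recip x)"
    by (cases "recip (recip x) * X * recip x") simp
  also have "\<dots> = - tr2 X" using tr2_conj[of "recip x" X] x by simp
  finally have t: "tr2 (recip g * Y) = - tr2 X" .
  note st = stabiliser[OF \<delta> h gi e]
  show thesis
    by (rule that[OF gi xg st(1,2)]) (simp add: st(3) t psi_minus psi_nz)
qed

end

text \<open>The existence half of Mackey theory for characters: a function prescribed on a set of points
  \<open>j ` X\<close> extends to an equivariant function on the whole group, by zero off the double cosets of the points,
  as soon as the prescribed values agree whenever two points lie in one double coset.\<close>

lemma extend_equivariant:
  fixes j :: "'x \<Rightarrow> 'g::ring_1" and \<chi> \<theta> :: "'g \<Rightarrow> complex" and h :: "'x \<Rightarrow> complex"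
  assumes P: "\<And>p. p \<in> P \<Longrightarrow> invertible p \<and> recip p \<in> P" "1 \<in> P"
      "\<And>p p'. p \<in> P \<Longrightarrow> p' \<in> P \<Longrightarrow> p * p' \<in> P \<and> \<chi> (p * p') = \<chi> p * \<chi> p'" "\<chi> 1 = 1"
    and N: "\<And>n. n \<in> N \<Longrightarrow> invertible n \<and> recip n \<in> N" "1 \<in> N"
      "\<And>n n'. n \<in> N \<Longrightarrow> n' \<in> N \<Longrightarrow> n * n' \<in> N \<and> \<theta> (n * n') = \<theta> n * \<theta> n'" "\<theta> 1 = 1"
    and j: "\<And>\<xi>. \<xi> \<in> X \<Longrightarrow> invertible (j \<xi>)"
    and compat: "\<And>p n \<xi> \<xi>'. \<xi> \<in> X \<Longrightarrow> \<xi>' \<in> X \<Longrightarrow> p \<in> P \<Longrightarrow> n \<in> N \<Longrightarrow>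
      p * j \<xi> * n = j \<xi>' \<Longrightarrow> h \<xi>' = \<chi> p * \<theta> n * h \<xi>"
  obtains F where "\<And>g. \<not> invertible g \<Longrightarrow> F g = 0" "\<And>p g. p \<in> P \<Longrightarrow> F (p * g) = \<chi> p * F g"
    "\<And>n g. n \<in> N \<Longrightarrow> F (g * n) = \<theta> n * F g" "\<And>\<xi>. \<xi> \<in> X \<Longrightarrow> F (j \<xi>) = h \<xi>"
proof -
  define R where "R g c \<longleftrightarrow> (\<exists>p\<in>P. \<exists>\<xi>\<in>X. \<exists>n\<in>N. g = p * j \<xi> * n \<and> c = \<chi> p * \<theta> n * h \<xi>)" for g c
  define F where "F g = (if \<exists>c. R g c then THE c. R g c else 0)" for g
  have inv_chi: "\<chi> (recip p) * \<chi> p = 1" if "p \<in> P" for p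
    using P(1)[OF that] P(3)[of "recip p" p] P(4) that recip(2) by metis
  have inv_theta: "\<theta> n * \<theta> (recip n) = 1" if "n \<in> N" for n
    using N(1)[OF that] N(3)[of n "recip n"] N(4) that recip(1) by metis
  have uniq: "c = c'" if r: "R g c" "R g c'" for g c c'
  proof -
    obtain p \<xi> n where 1: "p \<in> P" "\<xi> \<in> X" "n \<in> N" "g = p * j \<xi> * n" "c = \<chi> p * \<theta> n * h \<xi>"
      using r(1) unfolding R_def by blast
    obtain p' \<xi>' n' where 2: "p' \<in> P" "\<xi>' \<in> X" "n' \<in> N" "g = p' * j \<xi>' * n'" "c' = \<chi> p' * \<theta> n' * h \<xi>'"
      using r(2) unfolding R_def by blast
    have "(recip p' * p) * j \<xi> * (n * recip n') = recip p' * (p * j \<xi> * n) * recip n'"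
      by (simp add: mult.assoc)
    also have "\<dots> = recip p' * (p' * j \<xi>' * n') * recip n'" using 1(4) 2(4) by simp
    also have "\<dots> = j \<xi>'" using P(1)[OF 2(1)] N(1)[OF 2(3)] by (simp add: mult.assoc recip recip_cancel)
    finally have "h \<xi>' = \<chi> (recip p' * p) * \<theta> (n * recip n') * h \<xi>"
      using 1 2 P N by (intro compat) auto
    also have "\<dots> = \<chi> (recip p') * \<theta> (recip n') * c"
      using 1 2 P N by simp
    finally have "c' = (\<chi> (recip p') * \<chi> p') * (\<theta> n' * \<theta> (recip n')) * c" using 2(5) by simp
    thus ?thesis using inv_chi[OF 2(1)] inv_theta[OF 2(3)] by simp
  qed
  have F_eq: "F g = c" if "R g c" for g c
    using that uniq unfolding F_def by (auto intro: the_equality)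
  have F_0: "F g = 0" if "\<nexists>c. R g c" for g using that by (simp add: F_def)
  have R_left: "R (p * g) (\<chi> p * c)" if r: "R g c" "p \<in> P" for p g c
  proof -
    obtain p' \<xi> n where 1: "p' \<in> P" "\<xi> \<in> X" "n \<in> N" "g = p' * j \<xi> * n" "c = \<chi> p' * \<theta> n * h \<xi>"
      using r(1) unfolding R_def by blast
    thus ?thesis unfolding R_def using P(3)[OF r(2) 1(1)]
      by (intro bexI[of _ "p * p'"] bexI[of _ \<xi>] bexI[of _ n]) (simp_all add: mult.assoc)
  qed
  have R_right: "R (g * n) (\<theta> n * c)" if r: "R g c" "n \<in> N" for n g c
  proof -
    obtain p' \<xi> n' where 1: "p' \<in> P" "\<xi> \<in> X" "n' \<in> N" "g = p' * j \<xi> * n'" "c = \<chi> p' * \<theta> n' * h \<xi>"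
      using r(1) unfolding R_def by blast
    thus ?thesis unfolding R_def using N(3)[OF 1(3) r(2)]
      by (intro bexI[of _ p'] bexI[of _ \<xi>] bexI[of _ "n' * n"]) (simp_all add: mult.assoc)
  qed
  show thesis
  proof (rule that)
    fix g :: 'g assume "\<not> invertible g"
    hence "\<nexists>c. R g c" unfolding R_def using P(1) N(1) j by auto
    thus "F g = 0" by (rule F_0)
  next
    fix p g :: 'g assume p: "p \<in> P"
    show "F (p * g) = \<chi> p * F g"
    proof (cases "\<exists>c. R g c")
      case True
      thus ?thesis using F_eq R_left p by metis
    next
      case False
      have "\<nexists>c. R (p * g) c" using False R_left[of "p * g" _ "recip p"] P(1)[OF p] recip_cancel(2) by metis
      thus ?thesis using F_0 False by simp
    qed
  next
    fix n g :: 'g assume n: "n \<in> N"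
    show "F (g * n) = \<theta> n * F g"
    proof (cases "\<exists>c. R g c")
      case True
      thus ?thesis using F_eq R_right n by metis
    next
      case False
      have "g * n * recip n = g" using N(1)[OF n] by (simp add: mult.assoc recip)
      hence "\<nexists>c. R (g * n) c" using False R_right[of "g * n" _ "recip n"] N(1)[OF n] by metis
      thus ?thesis using F_0 False by simp
    qed
  next
    fix \<xi> assume "\<xi> \<in> X"
    hence "R (j \<xi>) (h \<xi>)" unfolding R_def using P(2,4) N(2,4)
      by (intro bexI[of _ 1] bexI[of _ \<xi>]) simp_all
    thus "F (j \<xi>) = h \<xi>" by (rule F_eq)
  qed
qed

section \<open>Extending functions from the orbit representatives\<close>

lemma det2_rank1_rep: "det2 (e21 (rank1_rep \<delta> 0 * dg x)) = - (\<delta> * det2 x)"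
  by (cases x) (simp add: rank1_rep_def m2_simps algebra_simps)

context mackey
begin

definition parab :: "'r m2 m2 set" where
  "parab = {M2 h1 Z 0 h2 | h1 Z h2. h1 \<in> I1 \<and> h2 \<in> I2}"

lemma parab_mult: 
  assumes "p \<in> parab" "p' \<in> parab"
  shows "p * p' \<in> parab" "\<phi>1 (e11 (p * p')) * \<phi>2 (e22 (p * p')) = \<phi>1 (e11 p) * \<phi>2 (e22 p) * (\<phi>1 (e11 p') * \<phi>2 (e22 p'))"
  using assms by (auto simp: parab_def cent_mult c1.phi_mult c2.phi_mult)

lemma parab_recip: "p \<in> parab \<Longrightarrow> invertible p \<and> recip p \<in> parab"
  unfolding parab_def by (auto simp: recip_triangular cent_invertible cent_recip)

lemma parab_one: "1 \<in> parab"
  unfolding parab_def using one_cent by (auto simp: one_block)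

text \<open>Any functions with the right equivariance on the three kinds of points come from a Whittaker function.
  Points of different kinds never lie in one double coset: up to units, the determinant
  of the lower left block is an invariant of the double coset, and it is a unit, zero and \<open>w\<close> respectively.\<close>

lemma W_extend:
  fixes H :: "'r m2 \<Rightarrow> 'r m2 \<Rightarrow> complex" and hB hK :: "'r m2 \<Rightarrow> complex"
  assumes H: "\<And>h1 h2 x y. h1 \<in> I1 \<Longrightarrow> h2 \<in> I2 \<Longrightarrow> invertible x \<Longrightarrow> invertible y \<Longrightarrow>
      H (h1 * x) (h2 * y) = \<phi>1 h1 * \<phi>2 h2 * H x y"
    and hB: "\<And>g x. invertible g \<Longrightarrow> invertible x \<Longrightarrow> e21 g = 0 \<Longrightarrow>
      hB (g * x) = \<phi>1 (sc (e11 g)) * \<phi>2 (sc (e22 g)) * hB x"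
    and hK: "\<And>g x. invertible g \<Longrightarrow> invertible x \<Longrightarrow> e21 g = 0 \<Longrightarrow> w * e11 g = w * e22 g \<Longrightarrow>
      hK (g * x) = \<phi>1 (sc (e11 g)) * \<phi>2 (sc (e22 g)) * hK x"
  obtains F where "F \<in> W" "\<And>x y. invertible x \<Longrightarrow> invertible y \<Longrightarrow> F (M2 0 x y 0) = H x y"
    "\<And>x. invertible x \<Longrightarrow> F (rank1_rep 0 0 * dg x) = hB x"
    "\<And>x. invertible x \<Longrightarrow> F (rank1_rep w 0 * dg x) = hK x"
proof -
  define N where "N = range (uni :: 'r m2 \<Rightarrow> 'r m2 m2)"
  define X :: "(('r m2 \<times> 'r m2) + 'r m2 + 'r m2) set" where
    "X = {Inl (x, y) | x y. invertible x \<and> invertible y} \<union> {Inr (Inl x) | x. invertible x}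
       \<union> {Inr (Inr x) | x. invertible x}"
  define j :: "('r m2 \<times> 'r m2) + 'r m2 + 'r m2 \<Rightarrow> 'r m2 m2" where
    "j = case_sum (\<lambda>(x, y). M2 0 x y 0) (case_sum (\<lambda>x. rank1_rep 0 0 * dg x) (\<lambda>x. rank1_rep w 0 * dg x))"
  define h where "h = case_sum (\<lambda>(x, y). H x y) (case_sum hB hK)"
  have anti: "invertible (M2 0 x y 0)" if "invertible x" "invertible y" for x y :: "'r m2"
    by (rule invertibleI[of _ "M2 0 (recip y) (recip x) 0"])
       (use that in \<open>simp_all add: recip one_block\<close>)
  have key: "h \<xi>' = \<phi>1 (e11 p) * \<phi>2 (e22 p) * \<psi> (tr2 (e12 n)) * h \<xi>"
    if \<xi>: "\<xi> \<in> X" "\<xi>' \<in> X" and p: "p \<in> parab" and n: "n \<in> N" and eq: "p * j \<xi> * n = j \<xi>'" for p n \<xi> \<xi>'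
  proof -
    obtain h1 Z h2 where p': "p = M2 h1 Z 0 h2" and h12: "h1 \<in> I1" "h2 \<in> I2"
      using p unfolding parab_def by blast
    obtain X where n': "n = uni X" using n by (auto simp: N_def)
    note hi = cent_invertible[OF h12(1)] cent_invertible[OF h12(2)]
    \<comment> \<open>the invariant that separates the three kinds\<close>
    have d: "det2 (e21 (j \<xi>')) = det2 h2 * det2 (e21 (j \<xi>))"
      using e21_sandwich[of h1 Z h2 "j \<xi>" 1 X 1] eq unfolding p' n' by (metis det2_mult mult.right_neutral)
    have d2: "invertible (det2 h2)" using hi by (simp add: invertible_det2)
    have dw: "\<not> invertible (w * x)" for x by (simp add: not_invertible_iff)
    have dz: "\<not> invertible (0::'r)" by (simp add: not_invertible_iff)
    from \<xi> consider 
        (T) x y x' y' where "\<xi> = Inl (x, y)" "\<xi>' = Inl (x', y')" "invertible x" "invertible y" "invertible x'" "invertible y'"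
      | (B) x x' where "\<xi> = Inr (Inl x)" "\<xi>' = Inr (Inl x')" "invertible x" "invertible x'"
      | (K) x x' where "\<xi> = Inr (Inr x)" "\<xi>' = Inr (Inr x')" "invertible x" "invertible x'"
      | (TB) x y x' where "\<xi> = Inl (x, y)" "\<xi>' = Inr (Inl x')" "invertible x" "invertible y" "invertible x'"
      | (BT) x y x' where "\<xi>' = Inl (x, y)" "\<xi> = Inr (Inl x')" "invertible x" "invertible y" "invertible x'"
      | (TK) x y x' where "\<xi> = Inl (x, y)" "\<xi>' = Inr (Inr x')" "invertible x" "invertible y" "invertible x'"
      | (KT) x y x' where "\<xi>' = Inl (x, y)" "\<xi> = Inr (Inr x')" "invertible x" "invertible y" "invertible x'"
      | (BK) x x' where "\<xi> = Inr (Inl x)" "\<xi>' = Inr (Inr x')" "invertible x" "invertible x'"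
      | (KB) x x' where "\<xi>' = Inr (Inl x)" "\<xi> = Inr (Inr x')" "invertible x" "invertible x'"
      unfolding X_def by (elim UnE CollectE exE conjE) blast+
    thus ?thesis
    proof cases
      case T
      have "p * j \<xi> * n = M2 (Z * y) (Z * y * X + h1 * x) (h2 * y) (h2 * y * X)"
        by (simp add: p' n' T j_def)
      moreover have "j \<xi>' = M2 0 x' y' 0" by (simp add: T j_def)
      ultimately have e: "M2 (Z * y) (Z * y * X + h1 * x) (h2 * y) (h2 * y * X) = M2 0 x' y' 0"
        using eq by (simp only:)
      have Zy: "Z * y = 0" and hX: "(h2 * y) * X = 0" using arg_cong[OF e, of e11] arg_cong[OF e, of e22] by simp_all
      have "Z = Z * y * recip y" using T by (simp add: mult.assoc recip)
      hence "Z = 0" using Zy by simp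
      have "X = recip (h2 * y) * ((h2 * y) * X)" using T hi by (simp only: recip_cancel invertible_mult)
      hence "X = 0" using hX by simp
      have "x' = h1 * x" "y' = h2 * y" using arg_cong[OF e, of e12] arg_cong[OF e, of e21] \<open>Z = 0\<close> by simp_all
      thus ?thesis using H[OF h12 T(3,4)] \<open>X = 0\<close> by (simp add: T h_def p' n' m2_simps)
    next
      case B
      have e: "M2 h1 Z 0 h2 * (rank1_rep 0 0 * dg x) * uni X = rank1_rep 0 0 * dg x'"
        using eq unfolding p' n' by (simp only: B j_def sum.case)
      show ?thesis
        by (rule extension_compatible_Borel[OF _ h12 B(3,4) e])
           (use hB B in \<open>auto simp: h_def p' n'\<close>)
    next
      case K
      have e: "M2 h1 Z 0 h2 * (rank1_rep w 0 * dg x) * uni X = rank1_rep w 0 * dg x'"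
        using eq unfolding p' n' by (simp only: K j_def sum.case)
      show ?thesis
        by (rule extension_compatible_Borel[OF _ h12 K(3,4) e])
           (use hK K in \<open>auto simp: h_def p' n'\<close>)
    next
      case TB
      hence "det2 h2 * det2 y = 0" using d by (simp add: j_def det2_rank1_rep)
      thus ?thesis using TB d2 dz by (metis invertible_det2 invertible_mult_iff)
    next
      case BT
      hence "det2 y = 0" using d by (simp add: j_def det2_rank1_rep)
      thus ?thesis using BT dz by (metis invertible_det2)
    next
      case TK
      hence "det2 h2 * det2 y = w * - det2 x'" using d by (simp add: j_def det2_rank1_rep)
      thus ?thesis using TK d2 dw by (metis invertible_det2 invertible_mult_iff)
    next
      case KT
      hence "det2 y = w * - (det2 h2 * det2 x')" using d by (simp add: j_def det2_rank1_rep mult.left_commute)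
      thus ?thesis using KT dw by (metis invertible_det2)
    next
      case BK
      hence "w * det2 x' = 0" using d by (simp add: j_def det2_rank1_rep)
      thus ?thesis using BK by (metis invertible_det2 not_invertible_iff)
    next
      case KB
      hence "w * (det2 h2 * det2 x') = 0" using d by (simp add: j_def det2_rank1_rep mult.left_commute)
      thus ?thesis using KB d2 by (metis invertible_det2 not_invertible_iff invertible_mult_iff)
    qed
  qed
  obtain F where F: "\<And>g. \<not> invertible g \<Longrightarrow> F g = 0"
    "\<And>p g. p \<in> parab \<Longrightarrow> F (p * g) = \<phi>1 (e11 p) * \<phi>2 (e22 p) * F g"
    "\<And>n g. n \<in> N \<Longrightarrow> F (g * n) = \<psi> (tr2 (e12 n)) * F g" "\<And>\<xi>. \<xi> \<in> X \<Longrightarrow> F (j \<xi>) = h \<xi>"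
  proof (rule extend_equivariant[of parab "\<lambda>p. \<phi>1 (e11 p) * \<phi>2 (e22 p)" N "\<lambda>n. \<psi> (tr2 (e12 n))" X j h])
    show "invertible p \<and> recip p \<in> parab" if "p \<in> parab" for p by (rule parab_recip[OF that])
    show "1 \<in> parab" by (rule parab_one)
    show "p * p' \<in> parab \<and> \<phi>1 (e11 (p * p')) * \<phi>2 (e22 (p * p')) = \<phi>1 (e11 p) * \<phi>2 (e22 p) * (\<phi>1 (e11 p') * \<phi>2 (e22 p'))"
      if "p \<in> parab" "p' \<in> parab" for p p' using parab_mult that by blast
    show "\<phi>1 (e11 1) * \<phi>2 (e22 1) = 1" by (simp add: one_block c1.phi_one c2.phi_one)
    show "invertible n \<and> recip n \<in> N" if "n \<in> N" for n
      using that by (auto simp: N_def recip_triangular)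
    show "1 \<in> N" by (auto simp: N_def one_block)
    show "n * n' \<in> N \<and> \<psi> (tr2 (e12 (n * n'))) = \<psi> (tr2 (e12 n)) * \<psi> (tr2 (e12 n'))"
      if "n \<in> N" "n' \<in> N" for n n'
      using that by (auto simp: N_def tr2_add psi_add)
    show "\<psi> (tr2 (e12 1)) = 1" by (simp add: m2_simps)
    show "invertible (j \<xi>)" if "\<xi> \<in> X" for \<xi>
      using that anti by (auto simp: X_def j_def rank1_rep_invertible)
    show "h \<xi>' = \<phi>1 (e11 p) * \<phi>2 (e22 p) * \<psi> (tr2 (e12 n)) * h \<xi>"
      if "\<xi> \<in> X" "\<xi>' \<in> X" "p \<in> parab" "n \<in> N" "p * j \<xi> * n = j \<xi>'" for p n \<xi> \<xi>'
      using key that by blast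
  qed blast
  show thesis
  proof (rule that)
    have "F (M2 h1 Z 0 h2 * g) = \<phi>1 h1 * \<phi>2 h2 * F g" if "h1 \<in> I1" "h2 \<in> I2" for h1 h2 Z g
      using F(2)[of "M2 h1 Z 0 h2" g] that by (auto simp: parab_def)
    moreover have "F (g * uni X) = \<psi> (tr2 X) * F g" for g X
      using F(3)[of "uni X" g] by (auto simp: N_def)
    ultimately show "F \<in> W" using F(1) by (simp add: W_def)
    show "F (M2 0 x y 0) = H x y" if "invertible x" "invertible y" for x y
      using F(4)[of "Inl (x, y)"] that by (simp add: j_def h_def X_def)
    show "F (rank1_rep 0 0 * dg x) = hB x" if "invertible x" for x
      using F(4)[of "Inr (Inl x)"] that by (simp add: j_def h_def X_def)
    show "F (rank1_rep w 0 * dg x) = hK x" if "invertible x" for x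
      using F(4)[of "Inr (Inr x)"] that by (simp add: j_def h_def X_def)
  qed
qed

end

section \<open>Every Whittaker function is determined on the three orbits\<close>

text \<open>The coset \<open>P g\<close> only remembers the bottom rows of \<open>g\<close>.\<close>

lemma equal_bottom_rows:
  fixes g g' :: "'r::comm_ring_1 m2 m2"
  assumes "invertible g" "invertible g'" "e21 g = e21 g'" "e22 g = e22 g'"
  obtains A Z where "invertible A" "g = M2 A Z 0 1 * g'"
proof -
  obtain a b c d where u: "g * recip g' = M2 a b c d" by (cases "g * recip g'")
  obtain p q r s where i: "recip g' = M2 p q r s" by (cases "recip g'")
  obtain A B C D where g: "g = M2 A B C D" by (cases g)
  obtain A' B' where g': "g' = M2 A' B' C D" using assms(3,4) unfolding g by (cases g') auto
  have "g' * recip g' = 1" using assms(2) by (rule recip)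
  hence "C * p + D * r = 0" "C * q + D * s = 1"
    unfolding i unfolding g' by (simp_all add: one_block)
  moreover have "C * p + D * r = c" "C * q + D * s = d"
    using u unfolding i unfolding g by simp_all
  ultimately have "c = 0" "d = 1" by simp_all
  hence u': "g * recip g' = M2 a b 0 1" using u by simp
  have "g = M2 a b 0 1 * g'" using assms(2) by (simp flip: u' add: mult.assoc recip)
  moreover have "invertible (M2 a b 0 1)" using assms by (simp flip: u')
  ultimately show thesis using that by (simp add: triangular_invertible)
qed

context dual_ring
begin

text \<open>Elementary divisors for a matrix of rank one modulo \<open>w\<close>. If the upper right entry is a
  unit, clearing its row and column leaves one more entry \<open>\<delta>\<close>; a permutation of rows and columns brings
  a unit to that place. As the matrix is singular, \<open>\<delta>\<close> lies in \<open>(w)\<close>, and a unit factor can be absorbed.\<close>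

lemma rank_one_form:
  fixes C :: "'r m2"
  assumes C: "\<not> invertible C" and nz: "sc w * C \<noteq> 0"
  obtains h a \<delta> where "invertible h" "invertible a" "\<delta> \<in> {0, w}" "C = h * M2 0 1 \<delta> 0 * a"
proof -
  have norm: "\<exists>h a \<delta>. invertible h \<and> invertible a \<and> C = h * M2 0 1 \<delta> 0 * a"
    if "invertible (e12 C)" for C :: "'r m2"
  proof -
    obtain a b c d where C: "C = M2 a b c d" by (cases C)
    have b: "invertible b" using that C by simp
    have r: "b * (x * recip b) = x" for x using recip_cancel(1)[OF b, of x] by (simp add: mult.commute)
    have "C = M2 1 0 (d * recip b) 1 * M2 0 1 (c - d * recip b * a) 0 * M2 1 0 a b"
      using recip[OF b] by (simp add: C r[of d] algebra_simps)
    moreover have "invertible (M2 1 0 (d * recip b) 1)" "invertible (M2 1 0 a b)"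
      using b by (simp_all add: invertible_det2)
    ultimately show ?thesis by blast
  qed
  let ?S = "M2 0 1 1 0 :: 'r m2"
  have S: "?S * ?S = 1" by (simp add: m2_simps)
  hence Si: "invertible ?S" using invertibleI by blast
  obtain a b c d where Cc: "C = M2 a b c d" by (cases C)
  have "\<exists>h a \<delta>. invertible h \<and> invertible a \<and> C = h * M2 0 1 \<delta> 0 * a"
  proof -
    have "invertible a \<or> invertible b \<or> invertible c \<or> invertible d"
      by (rule ccontr) (use nz Cc in \<open>simp add: m2_simps not_invertible_iff\<close>)
    then obtain T T' where T: "T \<in> {1, ?S}" "T' \<in> {1, ?S}" "invertible (e12 (T * C * T'))"
    proof (elim disjE)
      assume "invertible a" thus thesis using that[of 1 ?S] by (simp add: Cc)
    next
      assume "invertible b" thus thesis using that[of 1 1] by (simp add: Cc)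
    next
      assume "invertible c" thus thesis using that[of ?S ?S] by (simp add: Cc)
    next
      assume "invertible d" thus thesis using that[of ?S 1] by (simp add: Cc)
    qed
    obtain h k \<delta> where 1: "invertible h" "invertible k" "T * C * T' = h * M2 0 1 \<delta> 0 * k"
      using norm[OF T(3)] by blast
    have TT: "T * T = 1" "T' * T' = 1" "invertible T" "invertible T'" using T S Si by auto
    have "C = (T * T) * C * (T' * T')" by (simp only: TT mult_1 mult_1_right)
    also have "\<dots> = T * (T * C * T') * T'" by (simp only: mult.assoc)
    also have "\<dots> = T * (h * M2 0 1 \<delta> 0 * k) * T'" by (simp only: 1)
    also have "\<dots> = (T * h) * M2 0 1 \<delta> 0 * (k * T')" by (simp only: mult.assoc)
    finally show ?thesis using 1 TT by (metis invertible_mult)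
  qed
  then obtain h k \<delta> where 1: "invertible h" "invertible k" "C = h * M2 0 1 \<delta> 0 * k" by blast
  have "\<not> invertible (M2 0 1 \<delta> 0)" using C 1 by auto
  hence "\<not> invertible \<delta>" by (simp add: invertible_det2 not_invertible_iff)
  then obtain \<epsilon> where \<epsilon>: "\<delta> = w * \<epsilon>" using unit_or_dvd by (auto simp: dvd_def)
  show thesis
  proof (cases "invertible \<epsilon>")
    case True
    have "C = h * M2 0 1 w 0 * (M2 \<epsilon> 0 0 1 * k)"
      by (simp add: 1 \<epsilon> flip: mult.assoc) (simp add: mult.assoc)
    moreover have "invertible (M2 \<epsilon> 0 0 1 * k)" using True 1 by (simp add: invertible_det2)
    ultimately show thesis using that 1(1) by blast
  next
    case False
    hence "\<delta> = 0" using not_invertible_iff \<epsilon> by simp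
    thus thesis using that 1 by blast
  qed
qed

lemma centralises_transport:
  fixes N l K v u :: "'r m2"
  assumes Nl: "N * l = l * K" and vu: "v * u = 1" "u * v = 1" and u: "sc w * (u * K) = sc w * (N * u)"
  shows "sc w * ((l * v) * N) = sc w * (N * (l * v))"
proof -
  have "sc w * (N * (l * v)) = sc w * ((N * l) * v)" by (simp only: mult.assoc)
  also have "\<dots> = l * ((v * u) * (K * v)) * sc w" by (simp only: Nl vu mult_1 sc_comm mult.assoc)
  also have "\<dots> = (l * v) * (sc w * (u * K)) * v" by (simp only: sc_comm mult.assoc)
  also have "\<dots> = (l * v) * N * (u * v) * sc w" by (simp only: u) (simp only: sc_comm mult.assoc)
  finally show ?thesis by (simp only: vu mult_1_right sc_comm)
qed

text \<open>Two matrices with the same trace and determinant, both with lower left entry one modulo \<open>w\<close>, are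
  conjugate modulo \<open>w\<close> by a single unipotent matrix. Hence a matrix \<open>l\<close> conjugating \<open>N\<close> to
  such a matrix differs from a unipotent one by an element of the inertia group. This is the algebra behind the uniqueness
  of Whittaker models for the cuspidal representation.\<close>

lemma unipotent_conjugation:
  fixes a b d :: 'r
  defines "N \<equiv> M2 a b 1 d"
  assumes l: "invertible l" and K: "recip l * N * l = M2 p r \<beta> \<sigma>" and \<beta>: "w * \<beta> = w"
  shows "l * M2 1 (p - a) 0 1 \<in> cent N" "w * (\<sigma> - d) = w * (a - p)"
proof -
  let ?K = "M2 p r \<beta> \<sigma>" and ?u = "M2 1 (a - p) 0 1"
  have "tr2 ?K = tr2 N" unfolding K[symmetric] by (rule tr2_conj[OF l])
  hence tr: "\<sigma> = a + d - p" by (simp add: N_def algebra_simps)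
  have "det2 ?K = det2 (recip l) * det2 l * det2 N"
    unfolding K[symmetric] by simp
  also have "det2 (recip l) * det2 l = det2 (recip l * l)" by simp
  also have "\<dots> = 1" using l by (simp add: recip m2_simps)
  finally have det: "p * \<sigma> - r * \<beta> = a * d - b" by (simp add: N_def)
  show "w * (\<sigma> - d) = w * (a - p)" by (simp add: tr)
  have w\<beta>: "w * (x * \<beta>) = w * x" for x
  proof -
    have "w * (x * \<beta>) = (w * \<beta>) * x" by (simp only: mult_ac)
    thus ?thesis using \<beta> by simp
  qed
  have "w * (r * \<beta>) = w * (p * \<sigma> - (a * d - b))" using det by (simp add: algebra_simps)
  hence wr: "w * r = w * (p * \<sigma> - (a * d - b))" by (simp only: w\<beta>)
  have "sc w * (?u * ?K) = sc w * (N * ?u)"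
    by (simp add: N_def distrib_left w\<beta> \<beta> wr) (simp add: tr algebra_simps)
  hence u: "sc w * (?u * ?K) = sc w * (N * ?u)" .
  have lK: "N * l = l * ?K" using l by (simp flip: K add: mult.assoc recip_cancel)
  have uu: "M2 1 (p - a) 0 1 * ?u = 1" "?u * M2 1 (p - a) 0 1 = 1" by (simp_all add: m2_simps)
  let ?v = "M2 1 (p - a) 0 1"
  have "sc w * ((l * ?v) * N) = sc w * (N * (l * ?v))"
    by (rule centralises_transport[OF lK uu u])
  moreover have "invertible (l * ?v)" using l uu invertibleI by (metis invertible_mult)
  ultimately show "l * ?v \<in> cent N" by (simp add: cent_def)
qed

end

lemma tr2_zero: "tr2 0 = (0::'r::comm_ring_1)" by (simp add: zero_m2_def)

context mackey
begin

text \<open>Vanishing is tested on the whole orbit under the diagonal \<open>GL\<^sub>2\<close>, so that this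
  property may be moved along double cosets of the inducing subgroup and of all elements \<open>[g, Y; 0, g]\<close>.\<close>

definition null :: "('r m2 m2 \<Rightarrow> complex) \<Rightarrow> 'r m2 m2 \<Rightarrow> bool" where
  "null F g \<longleftrightarrow> (\<forall>x. invertible x \<longrightarrow> F (g * dg x) = 0)"

lemma W_left: "F \<in> W \<Longrightarrow> h1 \<in> I1 \<Longrightarrow> h2 \<in> I2 \<Longrightarrow> F (M2 h1 Z 0 h2 * g) = \<phi>1 h1 * \<phi>2 h2 * F g"
  by (simp add: W_def)

lemma W_right: "F \<in> W \<Longrightarrow> F (g * uni X) = \<psi> (tr2 X) * F g"
  by (simp add: W_def)

lemma null_left: "F \<in> W \<Longrightarrow> h1 \<in> I1 \<Longrightarrow> h2 \<in> I2 \<Longrightarrow> null F g \<Longrightarrow> null F (M2 h1 Z 0 h2 * g)"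
  unfolding null_def by (simp add: mult.assoc W_left del: times_m2.simps)

lemma null_nn: "F \<in> W \<Longrightarrow> null F g \<Longrightarrow> null F (uni Z * g)"
  by (rule null_left) (simp_all add: one_cent)

lemma null_right: 
  assumes "F \<in> W" "null F g" shows "null F (g * uni X)"
  unfolding null_def
proof (intro allI impI)
  fix x :: "'r m2" assume x: "invertible x"
  have "F (g * uni X * dg x) = F (g * dg x * uni (recip x * X * x))"
    by (simp only: mult.assoc nn_dg[OF x])
  thus "F (g * uni X * dg x) = 0" using assms x by (simp only: W_right null_def mult_zero_right)
qed

lemma null_dg: "null F g \<Longrightarrow> invertible y \<Longrightarrow> null F (g * dg y)"
  unfolding null_def by (simp add: mult.assoc)

text \<open>If an element of the stabiliser of \<open>g\<close> acts by different characters from the left and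
  from the right, all Whittaker functions vanish at \<open>g\<close>.\<close>

lemma null_kill:
  assumes F: "F \<in> W" and h: "h1 \<in> I1" "h2 \<in> I2" and eq: "M2 h1 Z 0 h2 * g = g * uni X"
    and ne: "\<phi>1 h1 * \<phi>2 h2 \<noteq> \<psi> (tr2 X)"
  shows "null F g"
  unfolding null_def
proof (intro allI impI)
  fix x :: "'r m2" assume x: "invertible x"
  have "M2 h1 Z 0 h2 * (g * dg x) = g * (uni X * dg x)" by (simp only: eq flip: mult.assoc)
  also have "\<dots> = (g * dg x) * uni (recip x * X * x)" by (simp only: nn_dg[OF x] mult.assoc)
  finally have "\<phi>1 h1 * \<phi>2 h2 * F (g * dg x) = \<psi> (tr2 (recip x * X * x)) * F (g * dg x)"
    using W_left[OF F h] W_right[OF F] by metis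
  thus "F (g * dg x) = 0" using ne by (simp add: tr2_conj[OF x])
qed

text \<open>The same obstruction with congruence-subgroup blocks, at a point translated by an arbitrary Levi element:
  conjugating by the \<open>l\<close>s replaces each \<open>B\<^sub>i\<close> by a conjugate.\<close>

lemma null_kill_J:
  assumes F: "F \<in> W" and l: "invertible l1" "invertible l2"
    and eq: "M2 (1 + sc w * Y1) Z (0::'r m2) (1 + sc w * Y2) * g = g * uni X"
    and ne: "\<psi> (w * tr2 (recip l1 * M2 s q 1 (t1 - s) * l1 * Y1) + w * tr2 (recip l2 * M2 (t2 - s) q 1 s * l2 * Y2)) \<noteq> \<psi> (tr2 X)"
  shows "null F (M2 l1 Z0 0 l2 * g)"
proof -
  define j1 where "j1 = 1 + sc w * (l1 * Y1 * recip l1)"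
  define j2 where "j2 = 1 + sc w * (l2 * Y2 * recip l2)"
  have j: "j1 * l1 = l1 * (1 + sc w * Y1)" "j2 * l2 = l2 * (1 + sc w * Y2)"
    using l unfolding j1_def j2_def
    by (simp_all only: distrib_left distrib_right mult_1 mult_1_right mult.assoc recip)
       (simp_all only: sc_comm mult.assoc)
  define Z' where "Z' = (l1 * Z + Z0 * (1 + sc w * Y2) - j1 * Z0) * recip l2"
  have Z': "Z' * l2 = l1 * Z + Z0 * (1 + sc w * Y2) - j1 * Z0"
    using l by (simp only: Z'_def mult.assoc recip mult_1_right)
  have e1: "M2 j1 Z' 0 j2 * M2 l1 Z0 0 l2 = M2 l1 Z0 0 l2 * M2 (1 + sc w * Y1) Z 0 (1 + sc w * Y2)"
    by (simp only: times_m2.simps j Z') simp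
  have e: "M2 j1 Z' 0 j2 * (M2 l1 Z0 0 l2 * g) = M2 l1 Z0 0 l2 * g * uni X"
    by (simp only: mult.assoc[symmetric] e1) (simp only: mult.assoc eq)
  have "tr2 (N * (l * Y * recip l)) = tr2 (recip l * N * l * Y)" for N l Y :: "'r m2"
    using tr2_comm[of "N * l * Y" "recip l"] by (simp add: mult.assoc)
  hence "\<phi>1 j1 * \<phi>2 j2 = \<psi> (w * tr2 (recip l1 * M2 s q 1 (t1 - s) * l1 * Y1) + w * tr2 (recip l2 * M2 (t2 - s) q 1 s * l2 * Y2))"
    unfolding j1_def j2_def c1.phi_J c2.phi_J by (simp add: psi_add)
  thus ?thesis using ne
    by (intro null_kill[OF F _ _ e]) (simp_all add: j1_def j2_def c1.J_cent c2.J_cent)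
qed

text \<open>The stabiliser of \<open>rank1_rep \<delta> d\<close> contains a three-parameter family with blocks in the congruence subgroup. By
  the previous lemma a Whittaker function vanishes at the translate unless the conjugates
  of the \<open>B\<^sub>i\<close> have lower left entry one, together with a linear relation between their diagonal entries
  and \<open>d\<close>. In the remaining case \<open>l1\<close> and \<open>l2\<close> are unipotent up to the inertia groups, and the
  unipotent matrices can be moved to the right of the representative, which also removes \<open>d\<close>.\<close>

lemma null_rank1_rep:
  assumes F: "F \<in> W" and l: "invertible l1" "invertible l2" and d: "d = \<delta> * e" and \<delta>: "\<delta> \<in> {0, w}"
    and jj: "null F (rank1_rep \<delta> 0)"
  shows "null F (M2 l1 Z0 0 l2 * rank1_rep \<delta> d)"
proof (rule ccontr)
  assume not: "\<not> null F (M2 l1 Z0 0 l2 * rank1_rep \<delta> d)"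
  obtain k where k: "\<delta> = w * k" using nilpotent_scalar[OF \<delta>] by blast
  define N1 where "N1 = M2 s q 1 (t1 - s)"
  define N2 where "N2 = M2 (t2 - s) q 1 s"
  obtain p1 r1 \<beta>1 \<sigma>1 where K1: "recip l1 * N1 * l1 = M2 p1 r1 \<beta>1 \<sigma>1" by (cases "recip l1 * N1 * l1")
  obtain p2 r2 \<beta>2 \<sigma>2 where K2: "recip l2 * N2 * l2 = M2 p2 r2 \<beta>2 \<sigma>2" by (cases "recip l2 * N2 * l2")
  have test: "\<psi> (w * (\<beta>1 * y + \<beta>2 * \<eta> + k * \<zeta> * (\<sigma>2 - p1 - \<beta>1 * e))) = \<psi> (w * (y + \<eta>))" for y \<zeta> \<eta>
  proof (rule ccontr)
    assume ne: "\<psi> (w * (\<beta>1 * y + \<beta>2 * \<eta> + k * \<zeta> * (\<sigma>2 - p1 - \<beta>1 * e))) \<noteq> \<psi> (w * (y + \<eta>))"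
    \<comment> \<open>the stabilising family with parameters \<open>y\<close>, \<open>\<eta>\<close>, \<open>\<zeta>\<close>, found by comparing rows as in \<open>stabiliser\<close>\<close>
    let ?Y1 = "M2 (- (k * \<zeta>)) (y - k * e * \<zeta>) 0 0" and ?Y2 = "M2 0 \<eta> 0 (k * \<zeta>)"
    let ?X = "M2 (w * y) \<zeta> 0 (w * \<eta>)"
    have eq: "M2 (1 + sc w * ?Y1) (M2 0 \<zeta> 0 0) 0 (1 + sc w * ?Y2) * rank1_rep \<delta> d = rank1_rep \<delta> d * uni ?X"
      by (simp add: rank1_rep_def m2_simps d k algebra_simps)
    have "null F (M2 l1 Z0 0 l2 * rank1_rep \<delta> d)"
    proof (rule null_kill_J[OF F l eq])
      have "w * tr2 (M2 p1 r1 \<beta>1 \<sigma>1 * ?Y1) + w * tr2 (M2 p2 r2 \<beta>2 \<sigma>2 * ?Y2)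
          = w * (\<beta>1 * y + \<beta>2 * \<eta> + k * \<zeta> * (\<sigma>2 - p1 - \<beta>1 * e))"
        by (simp add: algebra_simps)
      thus "\<psi> (w * tr2 (recip l1 * M2 s q 1 (t1 - s) * l1 * ?Y1) + w * tr2 (recip l2 * M2 (t2 - s) q 1 s * l2 * ?Y2)) \<noteq> \<psi> (tr2 ?X)"
        unfolding K1[unfolded N1_def] K2[unfolded N2_def] using ne by (simp only: tr2.simps distrib_left) simp
    qed
    thus False using not by blast
  qed
  have cancel: "\<psi> (a - b) = 1" if "\<psi> a = \<psi> b" for a b
    using that psi_add[of a "- b"] by (simp add: psi_minus psi_nz)
  \<comment> \<open>each parameter separately gives one condition on the conjugated matrices\<close>
  have "\<psi> (w * ((\<beta>1 - 1) * t)) = 1" for t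
    using cancel[OF test[of t 0 0]] by (simp add: algebra_simps)
  hence b1: "w * \<beta>1 = w" using psi_w_nondegenerate[of "\<beta>1 - 1"] by (simp add: algebra_simps)
  have "\<psi> (w * ((\<beta>2 - 1) * t)) = 1" for t
    using cancel[OF test[of 0 t 0]] by (simp add: algebra_simps)
  hence b2: "w * \<beta>2 = w" using psi_w_nondegenerate[of "\<beta>2 - 1"] by (simp add: algebra_simps)
  have "\<psi> (w * ((k * (\<sigma>2 - p1 - \<beta>1 * e)) * t)) = 1" for t
    using test[of 0 0 t] by (simp add: algebra_simps)
  hence "w * (k * (\<sigma>2 - p1 - \<beta>1 * e)) = 0" by (rule psi_w_nondegenerate)
  moreover have "w * (k * (\<beta>1 * e)) = k * e * (w * \<beta>1)" by (simp only: mult_ac)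
  ultimately have e: "w * (k * (\<sigma>2 - p1 - e)) = 0" unfolding b1 by (simp add: algebra_simps)
  define x1 where "x1 = s - p1"
  define x2 where "x2 = t2 - s - p2"
  note u1 = unipotent_conjugation[OF l(1) K1[unfolded N1_def] b1]
  note u2 = unipotent_conjugation[OF l(2) K2[unfolded N2_def] b2]
  have "k * (w * (\<sigma>2 - s)) = k * (w * x2)" unfolding x2_def u2(2) by simp
  hence dx: "d = \<delta> * (x1 + x2)" using e by (simp add: d k x1_def algebra_simps)
  define h1 where "h1 = l1 * M2 1 (- x1) 0 1"
  define h2 where "h2 = l2 * M2 1 (- x2) 0 1"
  have h: "h1 \<in> I1" "h2 \<in> I2" using u1(1) u2(1) by (simp_all add: h1_def h2_def x1_def x2_def)
  have uu: "M2 1 (- x) 0 1 * M2 1 x 0 1 = (1 :: 'r m2)" for x by (simp add: m2_simps)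
  have hl: "h1 * M2 1 x1 0 1 = l1" "h2 * M2 1 x2 0 1 = l2"
    unfolding h1_def h2_def by (simp_all only: mult.assoc uu mult_1_right)
  define Z1 where "Z1 = Z0 * M2 1 (- x2) 0 1"
  have Z1: "Z1 * M2 1 x2 0 1 = Z0" unfolding Z1_def by (simp only: mult.assoc uu mult_1_right)
  \<comment> \<open>the element that carries the two unipotent blocks across the representative\<close>
  define g :: "'r m2" where "g = M2 1 0 (\<delta> * x2) 1"
  define Y :: "'r m2" where "Y = M2 x1 0 (\<delta> * x2 * (x1 + x2)) x2"
  have gi: "invertible g" by (simp add: g_def invertible_det2)
  have "M2 l1 Z0 0 l2 = M2 h1 Z1 0 h2 * M2 (M2 1 x1 0 1) 0 0 (M2 1 x2 0 1)"
    by (simp only: times_m2.simps[of h1] hl Z1 mult_zero_right mult_zero_left add_0 add_0_right)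
  moreover have "M2 (M2 1 x1 0 1) 0 0 (M2 1 x2 0 1) * rank1_rep \<delta> d = rank1_rep \<delta> 0 * M2 g Y 0 g"
    by (simp add: rank1_rep_def g_def Y_def dx m2_simps k algebra_simps)
  moreover have "M2 g Y 0 g = dg g * uni (recip g * Y)" using gi by (simp add: recip_cancel)
  ultimately have "M2 l1 Z0 0 l2 * rank1_rep \<delta> d = M2 h1 Z1 0 h2 * (rank1_rep \<delta> 0 * dg g * uni (recip g * Y))"
    by (simp only: mult.assoc)
  moreover have "null F (M2 h1 Z1 0 h2 * (rank1_rep \<delta> 0 * dg g * uni (recip g * Y)))"
    by (intro null_left null_right null_dg F h jj gi)
  ultimately show False using not by simp
qed

text \<open>Here the bottom rows are \<open>(0 1 | 0 0)\<close> and \<open>(\<delta> 0 | d e)\<close>. Translating the first row of the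
  unipotent radical by multiples of \<open>(d, e)\<close> that \<open>\<delta>\<close> annihilates acts trivially from the left, so
  \<open>d\<close> must be a multiple of \<open>\<delta>\<close>. Then \<open>e\<close> is a unit and can be scaled to one by a diagonal matrix.\<close>

lemma null_rank_one:
  assumes F: "F \<in> W" and jj: "null F (rank1_rep 0 0)" "null F (rank1_rep w 0)"
    and \<delta>: "\<delta> \<in> {0, w}" and l: "invertible l1" "invertible l2"
    and g: "invertible (M2 A B (M2 0 1 \<delta> 0) (M2 0 0 d e))"
  shows "null F (M2 l1 Z0 0 l2 * M2 A B (M2 0 1 \<delta> 0) (M2 0 0 d e))"
proof (rule ccontr)
  let ?g = "M2 A B (M2 0 1 \<delta> 0) (M2 0 0 d e)"
  assume not: "\<not> null F (M2 l1 Z0 0 l2 * ?g)"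
  obtain k where k: "\<delta> = w * k" using nilpotent_scalar[OF \<delta>] by blast
  have de: "invertible d \<or> invertible e"
  proof (rule ccontr)
    assume "\<not> ?thesis"
    hence "w * d = 0" "w * e = 0" by (simp_all add: not_invertible_iff)
    hence "M2 0 0 0 (M2 0 0 0 w) * ?g = 0" by (cases A; cases B) (simp add: m2_simps k)
    hence "M2 0 0 0 (M2 0 0 0 w) * (?g * recip ?g) = 0" by (simp flip: mult.assoc)
    thus False using g w_nz by (simp add: recip m2_simps)
  qed
  \<comment> \<open>any top rows that complete the bottom ones will do\<close>
  define T :: "'r m2" where "T = (if invertible e then M2 0 0 1 0 else M2 0 0 0 1)"
  let ?A = "M2 1 0 0 0 :: 'r m2"
  define g2 where "g2 = M2 ?A T (M2 0 1 \<delta> 0) (M2 0 0 d e)"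
  have g2i: "invertible g2"
  proof (cases "invertible e")
    case True
    have "g2 * M2 ?A (M2 0 0 1 0) (M2 0 1 (- recip e * \<delta>) (- recip e * d)) (M2 0 0 0 (recip e)) = 1"
      "M2 ?A (M2 0 0 1 0) (M2 0 1 (- recip e * \<delta>) (- recip e * d)) (M2 0 0 0 (recip e)) * g2 = 1"
      using True recip[OF True] by (simp_all add: g2_def T_def m2_simps recip_cancel)
    thus ?thesis by (rule invertibleI)
  next
    case False
    hence d: "invertible d" using de by blast
    have "g2 * M2 ?A (M2 0 0 1 0) (M2 (- recip d * \<delta>) (- recip d * e) 0 1) (M2 0 (recip d) 0 0) = 1"
      "M2 ?A (M2 0 0 1 0) (M2 (- recip d * \<delta>) (- recip d * e) 0 1) (M2 0 (recip d) 0 0) * g2 = 1"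
      using False d recip[OF d] by (simp_all add: g2_def T_def m2_simps recip_cancel)
    thus ?thesis by (rule invertibleI)
  qed
  obtain A' Z where A': "invertible A'" "?g = M2 A' Z 0 1 * g2"
    using equal_bottom_rows[OF g g2i] by (auto simp: g2_def)
  have Lg: "M2 l1 Z0 0 l2 * ?g = M2 (l1 * A') (l1 * Z + Z0) 0 l2 * g2"
    unfolding A'(2) by (simp flip: mult.assoc)
  have l1': "invertible (l1 * A')" using l A' by simp
  \<comment> \<open>the obstruction coming from the annihilator of \<open>\<delta>\<close>\<close>
  have d0: "\<psi> (t * d) = 1" if t: "\<delta> * t = 0" for t
  proof (rule ccontr)
    assume ne: "\<psi> (t * d) \<noteq> 1"
    have t': "t * \<delta> = 0" "\<delta> * (t * x) = 0" for x
      using t by (simp_all add: mult.commute flip: mult.assoc)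
    have eq: "M2 (1 + sc w * 0) (M2 0 t 0 0) 0 (1 + sc w * 0) * g2 = g2 * uni (M2 (t * d) (t * e) 0 0)"
      unfolding g2_def by (cases T) (simp add: m2_simps t')
    have "null F (M2 (l1 * A') (l1 * Z + Z0) 0 l2 * g2)"
      by (rule null_kill_J[OF F l1' l(2) eq]) (use ne in \<open>simp add: tr2_zero\<close>)
    thus False using not Lg by simp
  qed
  have "\<exists>x. d = \<delta> * x"
  proof (cases "\<delta> = 0")
    case True
    thus ?thesis using d0 psi_nondegenerate[of d] by (simp add: mult.commute)
  next
    case False
    hence "\<delta> = w" using \<delta> by simp
    have "\<psi> (w * (d * t)) = 1" for t using d0[of "w * t"] \<open>\<delta> = w\<close> by (simp add: mult_ac)
    hence "w * d = 0" by (rule psi_w_nondegenerate)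
    thus ?thesis using ann_w \<open>\<delta> = w\<close> by (auto simp: dvd_def)
  qed
  then obtain x where x: "d = \<delta> * x" by blast
  have "\<not> invertible d" by (simp add: x k not_invertible_iff mult.assoc)
  hence e: "invertible e" using de by blast
  hence T: "T = M2 0 0 1 0" by (simp add: T_def)
  let ?D = "M2 e 0 0 1"
  have D: "invertible ?D" using e by (simp add: invertible_det2)
  have "g2 * dg ?D = M2 (sc e) 0 0 (M2 1 0 0 e) * rank1_rep \<delta> d"
    by (simp add: g2_def T rank1_rep_def m2_simps mult_ac)
  hence "g2 * (dg ?D * dg (recip ?D)) = M2 (sc e) 0 0 (M2 1 0 0 e) * rank1_rep \<delta> d * dg (recip ?D)"
    by (simp only: mult.assoc[symmetric])
  moreover have "dg ?D * dg (recip ?D) = 1" using D by (simp add: recip one_block)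
  ultimately have g2': "g2 = M2 (sc e) 0 0 (M2 1 0 0 e) * rank1_rep \<delta> d * dg (recip ?D)"
    by simp
  have "M2 l1 Z0 0 l2 * ?g
      = M2 (l1 * A' * sc e) ((l1 * Z + Z0) * M2 1 0 0 e) 0 (l2 * M2 1 0 0 e) * rank1_rep \<delta> d * dg (recip ?D)"
    unfolding Lg by (subst g2', simp only: mult.assoc[symmetric]) simp
  moreover have "null F (M2 (l1 * A' * sc e) ((l1 * Z + Z0) * M2 1 0 0 e) 0 (l2 * M2 1 0 0 e) * rank1_rep \<delta> d * dg (recip ?D))"
  proof (intro null_dg null_rank1_rep F)
    show "invertible (l1 * A' * sc e)" using l1' e sc_invertible by simp
    show "invertible (l2 * M2 1 0 0 e)" using l e by (simp add: invertible_det2 invertible_mult_iff)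
  qed (use x \<delta> jj D in auto)
  ultimately show False using not by simp
qed

text \<open>The case distinction on the lower left block \<open>C\<close>: a unit is cleared to the antidiagonal representative; if \<open>C\<close>
  vanishes modulo \<open>w\<close>, the unipotent elements with entries in \<open>(w)\<close> act trivially from the left
  but not through \<open>\<psi>\<close>; and rank one modulo \<open>w\<close> is the previous lemma.\<close>

lemma W_vanish:
  assumes F: "F \<in> W" and T: "\<And>x y. invertible x \<Longrightarrow> invertible y \<Longrightarrow> F (M2 0 x y 0) = 0"
    and B: "\<And>x. invertible x \<Longrightarrow> F (rank1_rep 0 0 * dg x) = 0"
    and K: "\<And>x. invertible x \<Longrightarrow> F (rank1_rep w 0 * dg x) = 0"
  shows "F g = 0"
proof (cases "invertible g")
  case False
  thus ?thesis using F by (simp add: W_def)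
next
  case g: True
  obtain A B' C D where gg: "g = M2 A B' C D" by (cases g)
  obtain a b c d where gr: "recip g = M2 a b c d" by (cases "recip g")
  have inv: "C * b + D * d = 1" "a * A + b * C = 1"
    using recip[OF g] unfolding gr unfolding gg by (simp_all add: one_block)
  have "null F g"
  proof (cases "invertible C")
    case C: True
    define B2 where "B2 = B' - A * recip C * D"
    have e: "g = uni (A * recip C) * M2 0 B2 C 0 * uni (recip C * D)"
      using C by (simp add: gg B2_def mult.assoc recip recip_cancel)
    have i: "invertible (M2 0 B2 C 0)" using g unfolding e by (simp del: times_m2.simps)
    obtain p q r u where pq: "recip (M2 0 B2 C 0) = M2 p q r u" by (cases "recip (M2 0 B2 C 0)")
    have "B2 * r = 1" using recip(1)[OF i] unfolding pq by (simp add: one_block)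
    hence "invertible B2" by (rule m2_right_inverse)
    hence "null F (M2 0 B2 C 0)" using C T by (simp add: null_def)
    thus ?thesis unfolding e by (intro null_right null_nn F)
  next
    case C: False
    show ?thesis
    proof (cases "sc w * C = 0")
      case True
      have "\<exists>x. \<psi> (w * x) \<noteq> 1" by (rule psi_nontriv)
      then obtain x where x: "\<psi> (w * x) \<noteq> 1" by blast
      have "sc w * (D * d) = sc w * (C * b + D * d)"
        using True by (simp add: distrib_left flip: mult.assoc)
      hence wD: "sc w * (D * d) = sc w" using inv by simp
      have "invertible D"
      proof (rule ccontr)
        assume "\<not> invertible D"
        hence "w * det2 D = 0" by (simp add: invertible_det2 not_invertible_iff)
        hence "w * det2 (D * d) = 0" by simp (metis mult.assoc mult_zero_left)
        moreover obtain p q r u where "D * d = M2 p q r u" by (cases "D * d")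
        moreover from this wD have "w * p = w" "w * q = 0" "w * r = 0" "w * u = w" by simp_all
        hence "w * (p * u - q * r) = w" by (simp add: right_diff_distrib flip: mult.assoc)
        ultimately show False using w_nz by simp
      qed
      \<comment> \<open>a unipotent element that \<open>\<psi>\<close> detects, while its conjugate by \<open>g\<close> stays in the unipotent radical of \<open>P\<close>\<close>
      let ?X = "M2 (w * x) 0 0 0"
      have X: "?X = sc w * M2 x 0 0 0" by simp
      have sw: "C * (sc w * V) = (sc w * C) * V" "A * (sc w * V) * R * C = A * V * R * (sc w * C)" for V R :: "'r m2"
        by (simp_all only: sc_comm mult.assoc)
      have CX: "C * ?X = 0"
        unfolding X sw(1) using True by (simp only: mult_zero_left)
      let ?Z = "A * ?X * recip D"
      have ZC: "?Z * C = 0"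
        unfolding X sw(2) using True by (simp only: mult_zero_right)
      have "M2 1 ?Z 0 1 * g = g * uni ?X"
        using \<open>invertible D\<close> ZC CX by (simp only: gg times_m2.simps mult_1 mult_1_right mult_zero_right mult_zero_left add_0 add_0_right) (simp only: mult.assoc recip mult_1_right add.commute)
      moreover have "\<phi>1 1 * \<phi>2 1 \<noteq> \<psi> (tr2 ?X)"
        using x by (simp add: c1.phi_one c2.phi_one)
      ultimately show ?thesis by (rule null_kill[OF F one_cent one_cent])
    next
      case False
      obtain h a \<delta> where h: "invertible h" "invertible a" "\<delta> \<in> {0, w}" "C = h * M2 0 1 \<delta> 0 * a"
        using rank_one_form[OF C False] by blast
      obtain d1 d2 d3 d4 where D': "recip h * D * recip a = M2 d1 d2 d3 d4" by (cases "recip h * D * recip a")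
      let ?X = "M2 0 0 (- d1) (- d2)"
      define g1 where "g1 = M2 1 0 0 (recip h) * g * dg (recip a) * uni ?X"
      have "recip h * C * recip a = M2 0 1 \<delta> 0" using h by (simp add: mult.assoc recip recip_cancel)
      hence "e21 g1 = M2 0 1 \<delta> 0" "e22 g1 = M2 0 0 d3 d4"
        using D' by (simp_all add: g1_def gg mult.assoc)
      then obtain A1 B1 where g1: "g1 = M2 A1 B1 (M2 0 1 \<delta> 0) (M2 0 0 d3 d4)" by (cases g1) auto
      have "invertible g1" using g h by (simp add: g1_def triangular_invertible)
      hence n: "null F (M2 1 0 0 h * g1)" unfolding g1
        using F B K h by (intro null_rank_one) (simp_all add: null_def)
      have 1: "M2 1 0 0 h * M2 1 0 0 (recip h) = 1" using h by (simp add: recip one_block)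
      have 2: "uni ?X * uni (- ?X) = 1" "dg (recip a) * dg a = 1"
        using h by (simp_all add: recip one_block) (simp add: m2_simps)
      have "M2 1 0 0 h * g1 * uni (- ?X) * dg a
         = (M2 1 0 0 h * M2 1 0 0 (recip h)) * g * (dg (recip a) * ((uni ?X * uni (- ?X)) * dg a))"
        by (simp only: g1_def mult.assoc)
      hence "g = M2 1 0 0 h * g1 * uni (- ?X) * dg a" by (simp only: 1 2 mult_1 mult_1_right)
      thus ?thesis using n h by (metis null_right null_dg F)
    qed
  qed
  hence "F (g * dg 1) = 0" by (simp add: null_def)
  thus ?thesis by (simp add: dg_one)
qed

end

section \<open>Isomorphisms and direct sums of representations\<close>

lemma rep_iso_trans:
  assumes "rep_iso G U V" "rep_iso G V W"
  shows "rep_iso G U W"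
proof -
  obtain S where S: "bij_betw S (rep_space U) (rep_space V)"
    "\<And>f h. f \<in> rep_space U \<Longrightarrow> h \<in> rep_space U \<Longrightarrow> S (\<lambda>i. f i + h i) = (\<lambda>j. S f j + S h j)"
    "\<And>c f. f \<in> rep_space U \<Longrightarrow> S (\<lambda>i. c * f i) = (\<lambda>j. c * S f j)"
    "\<And>g f. g \<in> carrier G \<Longrightarrow> f \<in> rep_space U \<Longrightarrow> S (rep_act U g f) = rep_act V g (S f)"
    using assms(1) unfolding rep_iso_def by blast
  obtain T where T: "bij_betw T (rep_space V) (rep_space W)"
    "\<And>f h. f \<in> rep_space V \<Longrightarrow> h \<in> rep_space V \<Longrightarrow> T (\<lambda>i. f i + h i) = (\<lambda>j. T f j + T h j)"
    "\<And>c f. f \<in> rep_space V \<Longrightarrow> T (\<lambda>i. c * f i) = (\<lambda>j. c * T f j)"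
    "\<And>g f. g \<in> carrier G \<Longrightarrow> f \<in> rep_space V \<Longrightarrow> T (rep_act V g f) = rep_act W g (T f)"
    using assms(2) unfolding rep_iso_def by blast
  have m: "S f \<in> rep_space V" if "f \<in> rep_space U" for f using bij_betwE[OF S(1)] that by blast
  show ?thesis unfolding rep_iso_def
  proof (intro exI[of _ "T \<circ> S"] conjI ballI allI)
    show "bij_betw (T \<circ> S) (rep_space U) (rep_space W)" using S(1) T(1) by (rule bij_betw_trans)
  qed (simp_all add: S T m)
qed

lemma rep_isoI:
  assumes "\<And>f. f \<in> rep_space V \<Longrightarrow> T f \<in> rep_space W"
    and "\<And>f h. f \<in> rep_space V \<Longrightarrow> h \<in> rep_space V \<Longrightarrow> T f = T h \<Longrightarrow> f = h"
    and "\<And>h. h \<in> rep_space W \<Longrightarrow> \<exists>f\<in>rep_space V. T f = h"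
    and "\<And>f h. f \<in> rep_space V \<Longrightarrow> h \<in> rep_space V \<Longrightarrow> T (\<lambda>i. f i + h i) = (\<lambda>j. T f j + T h j)"
    and "\<And>c f. f \<in> rep_space V \<Longrightarrow> T (\<lambda>i. c * f i) = (\<lambda>j. c * T f j)"
    and "\<And>g f. g \<in> carrier G \<Longrightarrow> f \<in> rep_space V \<Longrightarrow> T (rep_act V g f) = rep_act W g (T f)"
  shows "rep_iso G V W"
  unfolding rep_iso_def
proof (intro exI[of _ T] conjI ballI allI)
  show "bij_betw T (rep_space V) (rep_space W)"
  proof (rule bij_betw_imageI)
    show "inj_on T (rep_space V)" using assms(2) by (rule inj_onI)
    show "T ` rep_space V = rep_space W"
    proof
      show "T ` rep_space V \<subseteq> rep_space W" using assms(1) by blast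
      show "rep_space W \<subseteq> T ` rep_space V" using assms(3) by force
    qed
  qed
qed (simp_all add: assms(4-6))

lemma case_sum_o [simp]: "case_sum f g \<circ> Inl = f" "case_sum f g \<circ> Inr = g"
  by (simp_all add: fun_eq_iff)

lemma direct_sum_iso:
  assumes "rep_iso G V V'" "rep_iso G W W'"
  shows "rep_iso G (V \<oplus>\<^sub>R W) (V' \<oplus>\<^sub>R W')"
proof -
  obtain S where S: "bij_betw S (rep_space V) (rep_space V')"
    "\<And>f h. f \<in> rep_space V \<Longrightarrow> h \<in> rep_space V \<Longrightarrow> S (\<lambda>i. f i + h i) = (\<lambda>j. S f j + S h j)"
    "\<And>c f. f \<in> rep_space V \<Longrightarrow> S (\<lambda>i. c * f i) = (\<lambda>j. c * S f j)"
    "\<And>g f. g \<in> carrier G \<Longrightarrow> f \<in> rep_space V \<Longrightarrow> S (rep_act V g f) = rep_act V' g (S f)"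
    using assms(1) unfolding rep_iso_def by blast
  obtain T where T: "bij_betw T (rep_space W) (rep_space W')"
    "\<And>f h. f \<in> rep_space W \<Longrightarrow> h \<in> rep_space W \<Longrightarrow> T (\<lambda>i. f i + h i) = (\<lambda>j. T f j + T h j)"
    "\<And>c f. f \<in> rep_space W \<Longrightarrow> T (\<lambda>i. c * f i) = (\<lambda>j. c * T f j)"
    "\<And>g f. g \<in> carrier G \<Longrightarrow> f \<in> rep_space W \<Longrightarrow> T (rep_act W g f) = rep_act W' g (T f)"
    using assms(2) unfolding rep_iso_def by blast
  have split: "F = case_sum (F \<circ> Inl) (F \<circ> Inr)" for F :: "'x + 'y \<Rightarrow> complex"
    by (auto simp: fun_eq_iff split: sum.split)
  show ?thesis
  proof (rule rep_isoI[where T = "\<lambda>f. case_sum (S (f \<circ> Inl)) (T (f \<circ> Inr))"], goal_cases)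
    case (1 f)
    thus ?case using bij_betwE[OF S(1)] bij_betwE[OF T(1)] by (auto simp: direct_sum_def)
  next
    case (2 f h)
    have "S (f \<circ> Inl) = S (h \<circ> Inl)" "T (f \<circ> Inr) = T (h \<circ> Inr)"
      using arg_cong[OF 2(3), of "\<lambda>x. x \<circ> Inl"] arg_cong[OF 2(3), of "\<lambda>x. x \<circ> Inr"] by simp_all
    hence "f \<circ> Inl = h \<circ> Inl" "f \<circ> Inr = h \<circ> Inr"
      using 2 S(1) T(1) by (auto simp: direct_sum_def bij_betw_def dest: inj_onD)
    thus ?case by (metis split)
  next
    case (3 h)
    then obtain a b where "a \<in> rep_space V" "S a = h \<circ> Inl" "b \<in> rep_space W" "T b = h \<circ> Inr"
      using S(1) T(1) by (auto simp: direct_sum_def bij_betw_def) (metis imageE)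
    thus ?case by (intro bexI[of _ "case_sum a b"]) (auto simp: direct_sum_def simp flip: split)
  next
    case (4 f h)
    thus ?case using S(2)[of "f \<circ> Inl" "h \<circ> Inl"] T(2)[of "f \<circ> Inr" "h \<circ> Inr"]
      by (auto simp: direct_sum_def fun_eq_iff comp_def split: sum.split)
  next
    case (5 c f)
    thus ?case using S(3)[of "f \<circ> Inl" c] T(3)[of "f \<circ> Inr" c]
      by (auto simp: direct_sum_def fun_eq_iff comp_def split: sum.split)
  next
    case (6 g f)
    thus ?case using S(4)[of g "f \<circ> Inl"] T(4)[of g "f \<circ> Inr"]
      by (auto simp: direct_sum_def)
  qed
qed

text \<open>For \<open>2 \<times> 2\<close> matrices this is the representation induced from a character, written on \<open>'r m2\<close> instead of on
  matrices with a unit-valued second argument.\<close>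

definition twisted :: "'a::ring_1 set \<Rightarrow> ('a \<Rightarrow> complex) \<Rightarrow> ('a \<Rightarrow> complex) set" where
  "twisted S c = {h. (\<forall>x. \<not> invertible x \<longrightarrow> h x = 0) \<and> (\<forall>s\<in>S. \<forall>x. h (s * x) = c s * h x)}"

definition twisted_rep :: "'r::comm_ring_1 m2 set \<Rightarrow> ('r m2 \<Rightarrow> complex) \<Rightarrow> ('r mat, 'r m2) rep" where
  "twisted_rep S c = \<lparr>rep_space = twisted S c, rep_act = (\<lambda>g h x. h (x * of_mat2 g))\<rparr>"

lemma Ind_character_space:
  assumes S: "S \<subseteq> Collect invertible" and \<chi>: "\<And>s. s \<in> S \<Longrightarrow> \<chi> (mat2 s) = c s"
  shows "f \<in> rep_space (Ind (GL 2) (mat2 ` S) (character_rep \<chi>)) \<longleftrightarrow>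
    (\<exists>h\<in>twisted S c. f = (\<lambda>(A, _). if A \<in> carrier (GL 2) then h (of_mat2 A) else 0))" (is "?L \<longleftrightarrow> ?R")
proof
  assume L: ?L
  define h where "h x = f (mat2 x, ())" for x
  have z: "f (A, i) = 0" if "A \<notin> carrier (GL 2)" for A i using L that by (simp add: Ind_def)
  have "h (s * x) = c s * h x" if s: "s \<in> S" for s x
  proof (cases "invertible x")
    case True
    hence "(\<lambda>i. f (mat2 s \<otimes>\<^bsub>GL 2\<^esub> mat2 x, i)) = rep_act (character_rep \<chi>) (mat2 s) (\<lambda>i. f (mat2 x, i))"
      using L s by (simp add: Ind_def del: mat2_mult)
    from fun_cong[OF this, of "()"] show ?thesis
      using \<chi>[OF s] by (simp add: character_rep_def h_def)
  next
    case False
    hence "\<not> invertible (s * x)" using s S by (metis invertible_mult_left mem_Collect_eq subsetD)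
    thus ?thesis using False z by (simp add: h_def)
  qed
  moreover have "h x = 0" if "\<not> invertible x" for x using z that by (simp add: h_def)
  ultimately have "h \<in> twisted S c" by (simp add: twisted_def)
  moreover have "f = (\<lambda>(A, _). if A \<in> carrier (GL 2) then h (of_mat2 A) else 0)"
    using z by (auto simp: h_def fun_eq_iff GL2_carrier)
  ultimately show ?R by blast
next
  assume ?R
  then obtain h where h: "h \<in> twisted S c" and f: "f = (\<lambda>(A, _). if A \<in> carrier (GL 2) then h (of_mat2 A) else 0)"
    by blast
  show ?L using h S \<chi> unfolding f Ind_def character_rep_def
    by (auto simp: twisted_def GL2_carrier fun_eq_iff)
qed

lemma twisted_rep_Ind:
  assumes S: "S \<subseteq> Collect invertible" and \<chi>: "\<And>s. s \<in> S \<Longrightarrow> \<chi> (mat2 s) = c s"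
  shows "rep_iso (GL 2) (twisted_rep S c) (Ind (GL 2) (mat2 ` S) (character_rep \<chi>))"
proof (rule rep_isoI[where T = "\<lambda>h. \<lambda>(A, _). if A \<in> carrier (GL 2) then h (of_mat2 A) else 0"], goal_cases)
  case (1 f)
  thus ?case using Ind_character_space[of S \<chi> c, OF S \<chi>] by (auto simp: twisted_rep_def)
next
  case (2 f h)
  have "f x = h x" for x
  proof (cases "invertible x")
    case True
    thus ?thesis using fun_cong[OF 2(3), of "(mat2 x, ())"] by simp
  qed (use 2 in \<open>simp add: twisted_rep_def twisted_def\<close>)
  thus ?case by blast
next
  case (3 h)
  thus ?case using Ind_character_space[of S \<chi> c, OF S \<chi>] by (auto simp: twisted_rep_def)
next
  case (6 g f)
  then obtain x where "g = mat2 x" "invertible x" by (auto simp: GL2_carrier)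
  thus ?case by (auto simp: twisted_rep_def Ind_def fun_eq_iff GL2_carrier)
qed (auto simp: fun_eq_iff)

section \<open>The decomposition into three orbits, and a Fourier transform\<close>

lemma antidiagonal_invertible:
  "invertible (M2 0 x y 0) \<longleftrightarrow> invertible x \<and> invertible (y :: 'r::comm_ring_1 m2)"
proof -
  have "invertible (M2 0 1 1 0 :: 'r m2 m2)"
    by (rule invertibleI[of _ "M2 0 1 1 0"]) (simp_all add: m2_simps)
  hence "invertible (M2 x 0 0 y * M2 0 1 1 0) \<longleftrightarrow> invertible (M2 x 0 0 y)"
    by (rule invertible_mult_right)
  thus ?thesis by (simp add: triangular_invertible)
qed

lemma twistedD:
  fixes h :: "'a::ring_1 \<Rightarrow> complex"
  assumes "h \<in> twisted S c"
  shows "s \<in> S \<Longrightarrow> h (s * x) = c s * h x" "\<not> invertible x \<Longrightarrow> h x = 0"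
  using assms by (simp_all add: twisted_def)

lemma finite_ring_sum_affine:
  fixes f :: "'r::comm_ring_1 \<Rightarrow> complex"
  assumes "invertible a"
  shows "(\<Sum>x\<in>UNIV. f (a * x + b)) = (\<Sum>x\<in>UNIV. f x)"
proof (rule sum.reindex_bij_witness[of _ "\<lambda>y. recip a * (y - b)" "\<lambda>x. a * x + b"])
qed (use assms in \<open>simp_all add: recip_cancel\<close>)

context dual_ring
begin

lemma invertible_iff: "invertible x \<longleftrightarrow> w * x \<noteq> 0"
  using not_invertible_iff by blast

text \<open>Orthogonality: a nontrivial additive character sums to zero.\<close>

lemma character_sum:
  "(\<Sum>y\<in>UNIV. \<psi> (w * (m * y))) = (if w * m = 0 then of_nat (card (UNIV :: 'r set)) else 0)"
proof (cases "w * m = 0")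
  case True
  hence "w * (m * y) = 0" for y by (simp flip: mult.assoc)
  thus ?thesis using True by simp
next
  case False
  then obtain t where t: "\<psi> (w * (m * t)) \<noteq> 1" using psi_w_nondegenerate by blast
  let ?S = "\<Sum>y\<in>UNIV. \<psi> (w * (m * y))"
  have "?S = (\<Sum>y\<in>UNIV. \<psi> (w * (m * (1 * y + t))))"
    using finite_ring_sum_affine[of 1 "\<lambda>y. \<psi> (w * (m * y))" t] by simp
  also have "\<dots> = ?S * \<psi> (w * (m * t))"
    by (simp add: distrib_left psi_add sum_distrib_right)
  finally have "?S = 0" using t by simp
  thus ?thesis using False by simp
qed

end

context mackey
begin

text \<open>On upper triangular matrices this is \<open>\<omega>\<^sub>1 \<otimes> \<omega>\<^sub>2\<close>; on \<open>Z J\<close> it turns out to be \<open>\<omega> \<phi>\<^sub>B\<close>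
  with \<open>B = diag(t1, t2)\<close>.\<close>

definition diag_char :: "'r m2 \<Rightarrow> complex" where "diag_char g = \<phi>1 (sc (e11 g)) * \<phi>2 (sc (e22 g))"

definition Bor where "Bor = {g :: 'r m2. invertible g \<and> e21 g = 0}"
definition Bor_cong where "Bor_cong = {g :: 'r m2. invertible g \<and> e21 g = 0 \<and> w * e11 g = w * e22 g}"
definition ZJ where "ZJ = {g :: 'r m2. invertible g \<and> w * e12 g = 0 \<and> w * e21 g = 0 \<and> w * e11 g = w * e22 g}"

lemma diag_char_near_one:
  "diag_char (M2 (1 + w * x) b c (1 + w * y)) = \<psi> (w * (t1 * x + t2 * y))"
proof -
  have 1: "sc (1 + w * x) = 1 + sc w * sc x" for x by (simp add: m2_simps)
  show ?thesis unfolding diag_char_def m2.sel 1 c1.phi_J c2.phi_J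
    by (simp add: algebra_simps flip: psi_add)
qed

text \<open>The orbit of \<open>rank1_rep w 0\<close> yields a representation induced from the upper triangular matrices with
  congruent diagonal entries, while the theorem mentions induction from \<open>Z J\<close>. These are two
  polarisations of the same group \<open>Z J U\<close>: summing over the lower unipotent elements of the congruence subgroup
  leads from the first to the second, and summing over the upper unipotent elements leads back.\<close>

definition lo :: "'r \<Rightarrow> 'r m2" where "lo y = M2 1 0 (w * y) 1"
definition up :: "'r \<Rightarrow> 'r m2" where "up x = M2 1 x 0 1"

lemma lo_up_invertible [simp]: "invertible (lo y)" "invertible (up x)"
  by (simp_all add: lo_def up_def invertible_det2)

definition to_ZJ :: "('r m2 \<Rightarrow> complex) \<Rightarrow> 'r m2 \<Rightarrow> complex" where
  "to_ZJ h g = (\<Sum>y\<in>UNIV. h (lo y * g))"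
definition to_Bor :: "('r m2 \<Rightarrow> complex) \<Rightarrow> 'r m2 \<Rightarrow> complex" where
  "to_Bor f g = (\<Sum>x\<in>UNIV. f (up x * g))"
text \<open>The first factor comes from orthogonality, and the second counts the elements of \<open>(w)\<close>, over which
  the surviving terms are equal.\<close>

definition fourier_const :: complex where
  "fourier_const = of_nat (card (UNIV :: 'r set)) * of_nat (card {x :: 'r. w * x = 0})"

lemma fourier_const_nz: "fourier_const \<noteq> 0"
proof -
  have "0 \<in> {x :: 'r. w * x = 0}" by simp
  moreover have "finite {x :: 'r. w * x = 0}" by (rule finite_subset[OF subset_UNIV finite_ring])
  ultimately have "card {x :: 'r. w * x = 0} \<noteq> 0" by (simp only: card_eq_0_iff) blast
  moreover have "card (UNIV :: 'r set) \<noteq> 0" using finite_ring by (simp add: card_eq_0_iff)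
  ultimately show ?thesis unfolding fourier_const_def by simp
qed

text \<open>An element of \<open>Z J\<close> is an upper triangular matrix with congruent diagonal entries times a
  lower unipotent one; the former commutes with the lower unipotent elements and the latter shifts the summation variable.\<close>

lemma to_ZJ_twisted:
  assumes h: "h \<in> twisted Bor_cong diag_char"
  shows "to_ZJ h \<in> twisted ZJ diag_char"
  unfolding twisted_def
proof (intro CollectI conjI allI ballI impI)
  fix x :: "'r m2" assume "\<not> invertible x"
  thus "to_ZJ h x = 0" using twistedD(2)[OF h] by (simp add: to_ZJ_def)
next
  fix j g :: "'r m2" assume j: "j \<in> ZJ"
  obtain a b c d where jj: "j = M2 a b c d" by (cases j)
  have j': "invertible j" "w * b = 0" "w * c = 0" "w * a = w * d" using j by (auto simp: ZJ_def jj)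
  then obtain b' c' where bc: "b = w * b'" "c = w * c'" using ann_w by (meson dvd_def)
  have "invertible (a * d)" using j'(1)
    by (simp add: jj bc invertible_det2 invertible_iff algebra_simps)
  hence ad: "invertible a" "invertible d" by (simp_all add: invertible_mult_iff)
  define u where "u = M2 a b 0 d"
  have uK: "u \<in> Bor_cong" using ad j' by (simp add: Bor_cong_def u_def recip_triangular)
  define y0 where "y0 = recip d * c'"
  have wa: "a * (w * x) = d * (w * x)" for x
  proof -
    have "a * (w * x) = (w * a) * x" by (simp only: mult_ac)
    also have "\<dots> = (w * d) * x" by (simp only: j'(4))
    also have "\<dots> = d * (w * x)" by (simp only: mult_ac)
    finally show ?thesis .
  qed
  have "lo y * j = u * lo (y + y0)" for y
  proof -
    have "d * (w * (recip d * c')) = w * (d * (recip d * c'))" by (simp only: mult_ac)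
    also have "\<dots> = w * c'" using ad by (simp add: recip_cancel)
    finally have 1: "d * (w * (recip d * c')) = w * c'" .
    show ?thesis
      by (simp add: lo_def jj u_def y0_def bc 1 distrib_left) (simp add: algebra_simps wa)
  qed
  hence "to_ZJ h (j * g) = (\<Sum>y\<in>UNIV. h (u * (lo (y + y0) * g)))"
    by (simp add: to_ZJ_def flip: mult.assoc)
  also have "\<dots> = diag_char u * (\<Sum>y\<in>UNIV. h (lo (1 * y + y0) * g))"
    by (simp add: twistedD(1)[OF h uK] sum_distrib_left)
  also have "(\<Sum>y\<in>UNIV. h (lo (1 * y + y0) * g)) = to_ZJ h g"
    unfolding to_ZJ_def by (rule finite_ring_sum_affine[of 1 "\<lambda>y. h (lo y * g)"]) simp
  also have "diag_char u = diag_char j" by (simp add: u_def jj diag_char_def)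
  finally show "to_ZJ h (j * g) = diag_char j * to_ZJ h g" .
qed

lemma to_Bor_twisted:
  assumes f: "f \<in> twisted ZJ diag_char"
  shows "to_Bor f \<in> twisted Bor_cong diag_char"
  unfolding twisted_def
proof (intro CollectI conjI allI ballI impI)
  fix x :: "'r m2" assume "\<not> invertible x"
  thus "to_Bor f x = 0" using twistedD(2)[OF f] by (simp add: to_Bor_def)
next
  fix k g :: "'r m2" assume k: "k \<in> Bor_cong"
  then obtain a b d where kk: "k = M2 a b 0 d" by (cases k) (auto simp: Bor_cong_def)
  have k': "invertible k" "w * a = w * d" using k by (auto simp: Bor_cong_def kk)
  have "invertible (a * d)" using k'(1) by (simp add: kk invertible_det2)
  hence ad: "invertible a" "invertible d" by (simp_all add: invertible_mult_iff)
  let ?D = "M2 a 0 0 d"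
  have DJ: "?D \<in> ZJ" using ad k' by (simp add: ZJ_def recip_triangular)
  have "up x * k = ?D * up (recip a * d * x + recip a * b)" for x
    using recip_cancel(1)[OF ad(1)] by (simp add: up_def kk distrib_left mult.assoc)
  hence "to_Bor f (k * g) = (\<Sum>x\<in>UNIV. f (?D * (up (recip a * d * x + recip a * b) * g)))"
    by (simp add: to_Bor_def flip: mult.assoc)
  also have "\<dots> = diag_char ?D * (\<Sum>x\<in>UNIV. f (up (recip a * d * x + recip a * b) * g))"
    by (simp only: twistedD(1)[OF f DJ] sum_distrib_left)
  also have "(\<Sum>x\<in>UNIV. f (up (recip a * d * x + recip a * b) * g)) = to_Bor f g"
    unfolding to_Bor_def using ad by (intro finite_ring_sum_affine[of "recip a * d" "\<lambda>x. f (up x * g)"]) simp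
  also have "diag_char ?D = diag_char k" by (simp add: kk diag_char_def)
  finally show "to_Bor f (k * g) = diag_char k * to_Bor f g" .
qed

lemma sum_support:
  "(\<Sum>x\<in>UNIV. (if w * (x :: 'r) = 0 then of_nat (card (UNIV :: 'r set)) else 0) * (c :: complex)) = fourier_const * c"
proof -
  have "(\<Sum>x\<in>UNIV. (if w * (x :: 'r) = 0 then of_nat (card (UNIV :: 'r set)) else 0) * c)
      = (\<Sum>x\<in>UNIV. if x \<in> {x :: 'r. w * x = 0} then of_nat (card (UNIV :: 'r set)) * c else 0)"
    by (intro sum.cong) auto
  also have "\<dots> = (\<Sum>x\<in>{x :: 'r. w * x = 0}. of_nat (card (UNIV :: 'r set)) * c)"
    by (subst sum.inter_restrict[symmetric]) (simp_all add: finite_ring)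
  finally show ?thesis by (simp add: fourier_const_def)
qed

lemma w_diff_cancel:
  assumes "invertible t" shows "w * (x * t) = 0 \<longleftrightarrow> w * x = 0"
  using assms by (metis invertible_mult_right not_invertible_iff)

end

locale mackey_regular = mackey w \<psi> s q t1 t2 \<phi>1 \<phi>2
  for w :: "'r::comm_ring_1" and \<psi> s q t1 t2 \<phi>1 \<phi>2 +
  assumes t: "invertible (t1 - t2)"
begin

text \<open>The commutator of the two unipotent elements contributes \<open>\<psi> (w x y (t1 - t2))\<close>. As the traces differ modulo \<open>w\<close>,
  orthogonality leaves only the terms with \<open>x\<close> in \<open>(w)\<close>.\<close>

lemma to_ZJ_to_Bor:
  assumes f: "f \<in> twisted ZJ diag_char"
  shows "to_ZJ (to_Bor f) g = fourier_const * f g"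
proof -
  have step: "f (up x * (lo y * g)) = \<psi> (w * ((x * (t1 - t2)) * y)) * f (up x * g)" for x y
  proof -
    let ?j = "M2 (1 + w * (x * y)) (w * - (x * x * y)) (w * y) (1 + w * - (x * y))"
    have j: "?j \<in> ZJ"
      by (simp add: ZJ_def invertible_det2 invertible_iff w_nz algebra_simps)
    have "up x * (lo y * g) = ?j * (up x * g)"
      by (simp only: mult.assoc[symmetric]) (simp add: up_def lo_def algebra_simps)
    thus ?thesis using twistedD(1)[OF f j] unfolding diag_char_near_one by (simp add: algebra_simps)
  qed
  have supp: "f (up x * g) = f g" if "w * x = 0" for x
  proof -
    have j: "up x \<in> ZJ" using that by (simp add: ZJ_def) (simp add: up_def)
    have "diag_char (up x) = 1" using diag_char_near_one[of 0 x 0 0] by (simp add: up_def)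
    thus ?thesis using twistedD(1)[OF f j] by simp
  qed
  have "to_ZJ (to_Bor f) g = (\<Sum>x\<in>UNIV. \<Sum>y\<in>UNIV. f (up x * (lo y * g)))"
    unfolding to_ZJ_def to_Bor_def by (rule sum.swap)
  also have "\<dots> = (\<Sum>x\<in>UNIV. (\<Sum>y\<in>UNIV. \<psi> (w * ((x * (t1 - t2)) * y))) * f (up x * g))"
    by (simp only: step sum_distrib_right)
  also have "\<dots> = (\<Sum>x\<in>UNIV. (if w * x = 0 then of_nat (card (UNIV :: 'r set)) else 0) * f g)"
    unfolding character_sum w_diff_cancel[OF t] by (intro sum.cong) (auto simp: supp)
  also have "\<dots> = fourier_const * f g" by (rule sum_support)
  finally show ?thesis .
qed

lemma to_Bor_to_ZJ:
  assumes h: "h \<in> twisted Bor_cong diag_char"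
  shows "to_Bor (to_ZJ h) g = fourier_const * h g"
proof -
  have step: "h (lo y * (up x * g)) = \<psi> (w * ((y * (t2 - t1)) * x)) * h (lo y * g)" for x y
  proof -
    let ?k = "M2 (1 + w * - (x * y)) (w * - (x * x * y)) 0 (1 + w * (x * y))"
    have k: "?k \<in> Bor_cong"
      by (simp add: Bor_cong_def invertible_det2 invertible_iff w_nz algebra_simps)
    have uk: "up x \<in> Bor_cong" by (simp add: Bor_cong_def) (simp add: up_def)
    have "diag_char (up x) = 1" using diag_char_near_one[of 0 x 0 0] by (simp add: up_def)
    moreover have "lo y * (up x * g) = up x * (?k * (lo y * g))"
      by (simp only: mult.assoc[symmetric]) (simp add: up_def lo_def algebra_simps)
    ultimately have "h (lo y * (up x * g)) = h (?k * (lo y * g))"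
      using twistedD(1)[OF h uk] by simp
    thus ?thesis using twistedD(1)[OF h k] unfolding diag_char_near_one by (simp add: algebra_simps)
  qed
  have t': "invertible (t2 - t1)" using t invertible_mult[of "-1" "t1 - t2"] invertibleI[of "-1::'r" "-1"] by simp
  have supp: "h (lo y * g) = h g" if "w * y = 0" for y
    using that by (simp add: lo_def flip: one_m2_def)
  have "to_Bor (to_ZJ h) g = (\<Sum>y\<in>UNIV. \<Sum>x\<in>UNIV. h (lo y * (up x * g)))"
    unfolding to_ZJ_def to_Bor_def by (rule sum.swap)
  also have "\<dots> = (\<Sum>y\<in>UNIV. (\<Sum>x\<in>UNIV. \<psi> (w * ((y * (t2 - t1)) * x))) * h (lo y * g))"
    by (simp only: step sum_distrib_right)
  also have "\<dots> = (\<Sum>y\<in>UNIV. (if w * y = 0 then of_nat (card (UNIV :: 'r set)) else 0) * h g)"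
    unfolding character_sum w_diff_cancel[OF t'] by (intro sum.cong) (auto simp: supp)
  also have "\<dots> = fourier_const * h g" by (rule sum_support)
  finally show ?thesis .
qed

lemma Bor_cong_iso_ZJ: "rep_iso (GL 2) (twisted_rep Bor_cong diag_char) (twisted_rep ZJ diag_char)"
proof (rule rep_isoI[where T = to_ZJ], goal_cases)
  case (1 f)
  thus ?case using to_ZJ_twisted by (simp add: twisted_rep_def)
next
  case (2 f h)
  have "fourier_const * f g = fourier_const * h g" for g
    using 2 to_Bor_to_ZJ by (metis rep.select_convs(1) twisted_rep_def)
  thus ?case using fourier_const_nz by auto
next
  case (3 h)
  let ?f = "\<lambda>g. to_Bor h g / fourier_const"
  have h: "h \<in> twisted ZJ diag_char" using 3 by (simp add: twisted_rep_def)
  have "?f \<in> twisted Bor_cong diag_char" using to_Bor_twisted[OF h] by (auto simp: twisted_def)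
  moreover have "to_ZJ ?f = h"
    using to_ZJ_to_Bor[OF h] fourier_const_nz
    by (auto simp: fun_eq_iff to_ZJ_def simp flip: sum_divide_distrib)
  ultimately show ?case by (auto simp: twisted_rep_def)
next
  case (4 f h)
  show ?case by (simp add: to_ZJ_def fun_eq_iff sum.distrib)
next
  case (5 c f)
  show ?case by (simp add: to_ZJ_def fun_eq_iff sum_distrib_left)
next
  case (6 g f)
  show ?case by (simp add: twisted_rep_def to_ZJ_def fun_eq_iff mult.assoc)
qed

definition tensor_model :: "('r mat, 'r m2 \<times> 'r m2) rep" where
  "tensor_model = \<lparr>rep_space = {H. (\<forall>x y. \<not> (invertible x \<and> invertible y) \<longrightarrow> H (x, y) = 0) \<and>
       (\<forall>h1\<in>I1. \<forall>h2\<in>I2. \<forall>x y. H (h1 * x, h2 * y) = \<phi>1 h1 * \<phi>2 h2 * H (x, y))},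
     rep_act = (\<lambda>g H (x, y). H (x * of_mat2 g, y * of_mat2 g))\<rparr>"

definition whittaker_model :: "('r mat, 'r m2 m2) rep" where
  "whittaker_model = \<lparr>rep_space = W, rep_act = (\<lambda>g F u. F (u * dg (of_mat2 g)))\<rparr>"

definition to_orbits :: "('r m2 m2 \<Rightarrow> complex) \<Rightarrow> ('r m2 \<times> 'r m2) + 'r m2 + 'r m2 \<Rightarrow> complex" where
  "to_orbits F = case_sum (\<lambda>(x, y). F (M2 0 x y 0))
             (case_sum (\<lambda>g. F (rank1_rep 0 0 * dg g)) (\<lambda>g. F (rank1_rep w 0 * dg g)))"

lemma W_zero: "F \<in> W \<Longrightarrow> \<not> invertible g \<Longrightarrow> F g = 0"
  by (simp add: W_def)

lemma W_rank1_rep: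
  assumes F: "F \<in> W" and \<delta>: "\<delta> \<in> {0, w}" and g: "invertible g" "e21 g = 0" "\<delta> * e11 g = \<delta> * e22 g"
  shows "F (rank1_rep \<delta> 0 * dg (g * x)) = diag_char g * F (rank1_rep \<delta> 0 * dg x)"
proof -
  obtain h1 h2 Z where h: "h1 \<in> I1" "h2 \<in> I2" and e: "M2 h1 Z 0 h2 * rank1_rep \<delta> 0 = rank1_rep \<delta> 0 * dg g"
    "\<phi>1 h1 * \<phi>2 h2 = \<phi>1 (sc (e11 g)) * \<phi>2 (sc (e22 g))"
    using rank1_rep_equivariance[OF \<delta> g] by blast
  have "rank1_rep \<delta> 0 * dg (g * x) = rank1_rep \<delta> 0 * dg g * dg x" by (simp add: mult.assoc)
  also have "\<dots> = M2 h1 Z 0 h2 * (rank1_rep \<delta> 0 * dg x)" by (simp only: e(1)[symmetric] mult.assoc)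
  finally show ?thesis using W_left[OF F h, of Z "rank1_rep \<delta> 0 * dg x"] e(2) by (simp add: diag_char_def)
qed

text \<open>Injectivity and surjectivity of restriction to the three orbits are \<open>W_vanish\<close> and \<open>W_extend\<close>.\<close>

lemma restriction_iso: "rep_iso (GL 2) whittaker_model (tensor_model \<oplus>\<^sub>R twisted_rep Bor diag_char \<oplus>\<^sub>R twisted_rep Bor_cong diag_char)"
proof (rule rep_isoI[where T = to_orbits], goal_cases)
  case (1 F)
  hence F: "F \<in> W" by (simp add: whittaker_model_def)
  have "(\<lambda>(x, y). F (M2 0 x y 0)) \<in> rep_space tensor_model"
  proof -
    have "F (M2 0 (h1 * x) (h2 * y) 0) = \<phi>1 h1 * \<phi>2 h2 * F (M2 0 x y 0)"
      if "h1 \<in> I1" "h2 \<in> I2" for h1 h2 x y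
      using W_left[OF F that, of 0 "M2 0 x y 0"] by simp
    thus ?thesis using W_zero[OF F] by (auto simp: tensor_model_def antidiagonal_invertible)
  qed
  moreover have "(\<lambda>g. F (rank1_rep 0 0 * dg g)) \<in> twisted Bor diag_char"
    using W_zero[OF F] W_rank1_rep[OF F, of 0] by (auto simp: twisted_def Bor_def rank1_rep_invertible)
  moreover have "(\<lambda>g. F (rank1_rep w 0 * dg g)) \<in> twisted Bor_cong diag_char"
    using W_zero[OF F] W_rank1_rep[OF F, of w] by (auto simp: twisted_def Bor_cong_def rank1_rep_invertible)
  ultimately show ?case by (simp add: direct_sum_def twisted_rep_def to_orbits_def)
next
  case (2 F F')
  hence F: "F \<in> W" "F' \<in> W" and eq: "to_orbits F = to_orbits F'" by (simp_all add: whittaker_model_def)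
  let ?D = "\<lambda>g. F g - F' g"
  have D: "?D \<in> W" using F by (simp add: W_def algebra_simps)
  have r: "F (M2 0 x y 0) = F' (M2 0 x y 0)" "F (rank1_rep 0 0 * dg x) = F' (rank1_rep 0 0 * dg x)"
    "F (rank1_rep w 0 * dg x) = F' (rank1_rep w 0 * dg x)" for x y
    using fun_cong[OF eq, of "Inl (x, y)"] fun_cong[OF eq, of "Inr (Inl x)"] fun_cong[OF eq, of "Inr (Inr x)"]
    by (simp_all add: to_orbits_def)
  have "?D g = 0" for g by (rule W_vanish[OF D]) (simp_all only: r diff_self)
  thus ?case by (simp add: fun_eq_iff)
next
  case (3 h)
  define H where "H = h \<circ> Inl"
  define hB where "hB = h \<circ> Inr \<circ> Inl"
  define hK where "hK = h \<circ> Inr \<circ> Inr"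
  have H: "H \<in> rep_space tensor_model" and B: "hB \<in> twisted Bor diag_char" and K: "hK \<in> twisted Bor_cong diag_char"
    using 3 by (simp_all add: direct_sum_def twisted_rep_def H_def hB_def hK_def comp_assoc)
  obtain F where F: "F \<in> W" "\<And>x y. invertible x \<Longrightarrow> invertible y \<Longrightarrow> F (M2 0 x y 0) = H (x, y)"
    "\<And>x. invertible x \<Longrightarrow> F (rank1_rep 0 0 * dg x) = hB x"
    "\<And>x. invertible x \<Longrightarrow> F (rank1_rep w 0 * dg x) = hK x"
  proof (rule W_extend[of "\<lambda>x y. H (x, y)" hB hK])
  qed (use H twistedD(1)[OF B] twistedD(1)[OF K] in \<open>auto simp: tensor_model_def Bor_def Bor_cong_def diag_char_def\<close>)
  have "to_orbits F z = h z" for z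
  proof (cases z)
    case (Inl p)
    obtain x y where p: "p = (x, y)" by (cases p)
    show ?thesis
    proof (cases "invertible x \<and> invertible y")
      case True
      thus ?thesis using F(2) by (simp add: Inl p to_orbits_def H_def)
    next
      case False
      hence "F (M2 0 x y 0) = 0" "H (x, y) = 0"
        using W_zero[OF F(1)] H by (auto simp: antidiagonal_invertible tensor_model_def)
      thus ?thesis by (simp add: Inl p to_orbits_def H_def)
    qed
  next
    case (Inr q)
    show ?thesis
    proof (cases q)
      case q: (Inl x)
      show ?thesis using F(3) W_zero[OF F(1)] twistedD(2)[OF B]
        by (cases "invertible x") (simp_all add: Inr q to_orbits_def hB_def rank1_rep_invertible)
    next
      case q: (Inr x)
      show ?thesis using F(4) W_zero[OF F(1)] twistedD(2)[OF K]
        by (cases "invertible x") (simp_all add: Inr q to_orbits_def hK_def rank1_rep_invertible)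
    qed
  qed
  thus ?case using F(1) by (intro bexI[of _ F]) (simp_all add: fun_eq_iff whittaker_model_def)
next
  case (4 f h)
  show ?case by (simp add: to_orbits_def fun_eq_iff split: sum.split)
next
  case (5 c f)
  show ?case by (simp add: to_orbits_def fun_eq_iff split: sum.split)
next
  case (6 g f)
  show ?case
    by (simp add: to_orbits_def fun_eq_iff direct_sum_def whittaker_model_def tensor_model_def twisted_rep_def mult.assoc split: sum.split)
qed

end

section \<open>Tensor products of induced representations\<close>

definition ext1 :: "('r::comm_ring_1 m2 \<Rightarrow> complex) \<Rightarrow> 'r mat \<times> unit \<Rightarrow> complex" where
  "ext1 h = (\<lambda>(A, _). if A \<in> carrier (GL 2) then h (of_mat2 A) else 0)"

text \<open>The functions on \<open>'r m2\<close> above are functions on all matrices, whereas the representations live on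
  matrices with carrier \<open>GL\<^sub>2\<close>; \<open>ext1\<close> and \<open>ext2\<close> pass from the one to the other.\<close>

definition ext2 :: "('r::comm_ring_1 m2 \<times> 'r m2 \<Rightarrow> complex) \<Rightarrow> ('r mat \<times> unit) \<times> ('r mat \<times> unit) \<Rightarrow> complex" where
  "ext2 H = (\<lambda>((A, _), (B, _)). if A \<in> carrier (GL 2) \<and> B \<in> carrier (GL 2) then H (of_mat2 A, of_mat2 B) else 0)"

definition twisted2 :: "'r::comm_ring_1 m2 set \<Rightarrow> ('r m2 \<Rightarrow> complex) \<Rightarrow> 'r m2 set \<Rightarrow> ('r m2 \<Rightarrow> complex) \<Rightarrow> ('r m2 \<times> 'r m2 \<Rightarrow> complex) set" where
  "twisted2 S1 c1 S2 c2 = {H. (\<forall>x y. \<not> (invertible x \<and> invertible y) \<longrightarrow> H (x, y) = 0) \<and>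
     (\<forall>s1\<in>S1. \<forall>s2\<in>S2. \<forall>x y. H (s1 * x, s2 * y) = c1 s1 * c2 s2 * H (x, y))}"

lemma finite_m2: "finite (UNIV :: 'r set) \<Longrightarrow> finite (UNIV :: 'r m2 set)"
proof -
  assume f: "finite (UNIV :: 'r set)"
  have "(UNIV :: 'r m2 set) \<subseteq> (\<lambda>(a, b, c, d). M2 a b c d) ` UNIV"
  proof
    fix x :: "'r m2"
    obtain a b c d where "x = M2 a b c d" by (cases x)
    thus "x \<in> (\<lambda>(a, b, c, d). M2 a b c d) ` UNIV" by (intro image_eqI[of _ _ "(a, b, c, d)"]) simp_all
  qed
  moreover have "finite (UNIV :: ('r \<times> 'r \<times> 'r \<times> 'r) set)"
    using f by (simp add: finite_prod)
  ultimately show ?thesis using finite_surj by blast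
qed

lemma outer_tensor_act:
  assumes "invertible a" "invertible b"
  shows "rep_act (outer_tensor (Ind (GL 2) S1 V1) (Ind (GL 2) S2 V2)) (mat2 a, mat2 b) (ext2 H)
     = ext2 (\<lambda>(x, y). H (x * a, y * b))"
  using assms by (auto simp: fun_eq_iff outer_tensor_def Ind_def ext2_def GL2_carrier)

locale unit_character =
  fixes S :: "'r::comm_ring_1 m2 set" and c :: "'r m2 \<Rightarrow> complex"
  assumes one: "1 \<in> S" "c 1 = 1"
    and closed: "x \<in> S \<Longrightarrow> y \<in> S \<Longrightarrow> x * y \<in> S" "x \<in> S \<Longrightarrow> invertible x" "x \<in> S \<Longrightarrow> recip x \<in> S"
    and mult: "x \<in> S \<Longrightarrow> y \<in> S \<Longrightarrow> c (x * y) = c x * c y"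
begin

lemma c_recip: "x \<in> S \<Longrightarrow> c (recip x) * c x = 1"
  using mult[of "recip x" x] closed one by (simp add: recip)

text \<open>The delta function at \<open>y0\<close>, averaged over \<open>S\<close> so that it transforms by \<open>c\<close>. These functions play the part of a
  basis: by \<open>bump_expansion\<close> each twisted function is its own combination of them.\<close>

definition bump :: "'r m2 \<Rightarrow> 'r m2 \<Rightarrow> complex" where
  "bump y0 y = (if invertible y then (\<Sum>s\<in>S. if s * y = y0 then c (recip s) else 0) / of_nat (card S) else 0)"

lemma sum_translate:
  fixes f :: "'r m2 \<Rightarrow> complex"
  assumes "s \<in> S" shows "(\<Sum>x\<in>S. f (x * s)) = (\<Sum>x\<in>S. f x)"
  by (rule sum.reindex_bij_witness[of _ "\<lambda>x. x * recip s" "\<lambda>x. x * s"])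
     (use closed assms in \<open>auto simp: mult.assoc recip\<close>)

lemma bump_twisted: "bump y0 \<in> twisted S c"
  unfolding twisted_def
proof (intro CollectI conjI allI ballI impI)
  fix s y assume s: "s \<in> S"
  have si: "invertible s" using closed s by blast
  have "(\<Sum>x\<in>S. if x * (s * y) = y0 then c (recip x) else 0)
      = (\<Sum>x\<in>S. c s * (if (x * s) * y = y0 then c (recip (x * s)) else 0))"
  proof (rule sum.cong)
    fix x assume x: "x \<in> S"
    have "c s * c (recip (x * s)) = c (s * (recip s * recip x))"
      using x s closed mult by (simp add: recip_mult)
    also have "\<dots> = c (recip x)" using si by (simp add: recip_cancel)
    finally show "(if x * (s * y) = y0 then c (recip x) else 0)
        = c s * (if (x * s) * y = y0 then c (recip (x * s)) else 0)" by (simp add: mult.assoc)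
  qed simp
  also have "\<dots> = c s * (\<Sum>x\<in>S. if x * y = y0 then c (recip x) else 0)"
    by (simp only: sum_distrib_left[symmetric] sum_translate[OF s, of "\<lambda>x. if x * y = y0 then c (recip x) else 0"])
  finally show "bump y0 (s * y) = c s * bump y0 y" using si by (simp add: bump_def)
qed (simp add: bump_def)

lemma bump_expansion:
  assumes fin: "finite (UNIV :: 'r m2 set)" and h: "h \<in> twisted S c"
  shows "(\<Sum>y0\<in>UNIV. h y0 * bump y0 y) = h y"
proof (cases "invertible y")
  case True
  have S: "finite S" by (rule finite_subset[OF subset_UNIV fin])
  have "(\<Sum>y0\<in>UNIV. h y0 * bump y0 y)
      = (\<Sum>y0\<in>UNIV. \<Sum>s\<in>S. h y0 * (if s * y = y0 then c (recip s) else 0)) / of_nat (card S)"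
    using True by (simp add: bump_def sum_distrib_left sum_divide_distrib)
  also have "(\<Sum>y0\<in>UNIV. \<Sum>s\<in>S. h y0 * (if s * y = y0 then c (recip s) else 0))
      = (\<Sum>s\<in>S. \<Sum>y0\<in>UNIV. h y0 * (if s * y = y0 then c (recip s) else 0))" by (rule sum.swap)
  also have "\<dots> = (\<Sum>s\<in>S. h (s * y) * c (recip s))"
    using fin by (intro sum.cong) (auto simp: if_distrib[of "\<lambda>x. _ * x"] cong: if_cong)
  also have "\<dots> = (\<Sum>s\<in>S. h y)"
  proof (rule sum.cong)
    fix s assume s: "s \<in> S"
    show "h (s * y) * c (recip s) = h y" using twistedD(1)[OF h s] c_recip[OF s] by (simp add: mult_ac)
  qed simp
  finally show ?thesis using one S by (auto simp: card_eq_0_iff)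
next
  case False
  thus ?thesis using twistedD(2)[OF h] by (simp add: bump_def)
qed

end

text \<open>The span of products of twisted functions is the space of all functions of two variables that are twisted in
  each of them: expand in the second variable along \<open>bump\<close>.\<close>

lemma outer_tensor_space:
  fixes S1 S2 :: "'r::comm_ring_1 m2 set"
  assumes fin: "finite (UNIV :: 'r set)"
    and u: "unit_character S1 c1" "unit_character S2 c2"
    and \<chi>: "\<And>s. s \<in> S1 \<Longrightarrow> \<chi>1 (mat2 s) = c1 s" "\<And>s. s \<in> S2 \<Longrightarrow> \<chi>2 (mat2 s) = c2 s"
  shows "F \<in> rep_space (outer_tensor (Ind (GL 2) (mat2 ` S1) (character_rep \<chi>1)) (Ind (GL 2) (mat2 ` S2) (character_rep \<chi>2)))
    \<longleftrightarrow> (\<exists>H\<in>twisted2 S1 c1 S2 c2. F = ext2 H)" (is "F \<in> rep_space (outer_tensor ?V1 ?V2) \<longleftrightarrow> ?R")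
proof -
  interpret u1: unit_character S1 c1 by fact
  interpret u2: unit_character S2 c2 by fact
  have i: "S1 \<subseteq> Collect invertible" "S2 \<subseteq> Collect invertible" using u1.closed u2.closed by auto
  have V1: "f \<in> rep_space ?V1 \<longleftrightarrow> (\<exists>h\<in>twisted S1 c1. f = ext1 h)" for f
    unfolding ext1_def by (rule Ind_character_space[of S1 \<chi>1 c1, OF i(1) \<chi>(1)])
  have V2: "f \<in> rep_space ?V2 \<longleftrightarrow> (\<exists>h\<in>twisted S2 c2. f = ext1 h)" for f
    unfolding ext1_def by (rule Ind_character_space[of S2 \<chi>2 c2, OF i(2) \<chi>(2)])
  show ?thesis
  proof
    assume "F \<in> rep_space (outer_tensor ?V1 ?V2)"
    then obtain n f h where F: "F = (\<lambda>(i, j). \<Sum>k<(n::nat). f k i * h k j)"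
      and fh: "\<forall>k<n. f k \<in> rep_space ?V1 \<and> h k \<in> rep_space ?V2" unfolding outer_tensor_def by auto
    obtain a where a: "\<And>k. k < n \<Longrightarrow> a k \<in> twisted S1 c1 \<and> f k = ext1 (a k)"
      using fh unfolding V1 by metis
    obtain b where b: "\<And>k. k < n \<Longrightarrow> b k \<in> twisted S2 c2 \<and> h k = ext1 (b k)"
      using fh unfolding V2 by metis
    let ?H = "\<lambda>(x, y). \<Sum>k<n. a k x * b k y"
    have "?H \<in> twisted2 S1 c1 S2 c2"
    proof -
      have "a k x * b k y = 0" if "k < n" "\<not> (invertible x \<and> invertible y)" for k x y
        using twistedD(2)[of "a k" S1 c1 x] twistedD(2)[of "b k" S2 c2 y] a b that by auto
      moreover have "a k (s1 * x) * b k (s2 * y) = c1 s1 * c2 s2 * (a k x * b k y)"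
        if "k < n" "s1 \<in> S1" "s2 \<in> S2" for k s1 s2 x y
        using twistedD(1)[of "a k" S1 c1 s1 x] twistedD(1)[of "b k" S2 c2 s2 y] a b that by auto
      ultimately show ?thesis unfolding twisted2_def
        by (auto simp: sum_distrib_left intro!: sum.neutral sum.cong)
    qed
    moreover have "F = ext2 ?H"
      unfolding F by (auto simp: fun_eq_iff ext2_def a b ext1_def intro!: sum.neutral sum.cong)
    ultimately show ?R by blast
  next
    assume ?R
    then obtain H where H: "H \<in> twisted2 S1 c1 S2 c2" and F: "F = ext2 H" by blast
    have fm: "finite (UNIV :: 'r m2 set)" using fin by (rule finite_m2)
    obtain e :: "nat \<Rightarrow> 'r m2" where e: "bij_betw e {..<card (UNIV :: 'r m2 set)} UNIV"
      using ex_bij_betw_nat_finite[OF fm] by (auto simp: lessThan_atLeast0)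
    let ?n = "card (UNIV :: 'r m2 set)"
    let ?f = "\<lambda>k. ext1 (\<lambda>x. H (x, e k))" and ?h = "\<lambda>k. ext1 (u2.bump (e k))"
    have "(\<lambda>x. H (x, y)) \<in> twisted S1 c1" for y
    proof -
      have "H (s * x, 1 * y) = c1 s * H (x, y)" if "s \<in> S1" for s x
        using H that u2.one unfolding twisted2_def by (simp del: mult_1)
      thus ?thesis using H by (simp add: twisted_def twisted2_def)
    qed
    hence f: "?f k \<in> rep_space ?V1" for k unfolding V1 by blast
    have h: "?h k \<in> rep_space ?V2" for k unfolding V2 using u2.bump_twisted by blast
    have t2: "(\<lambda>y. H (x, y)) \<in> twisted S2 c2" for x
    proof -
      have "H (1 * x, s * y) = c2 s * H (x, y)" if "s \<in> S2" for s y
        using H that u1.one unfolding twisted2_def by (simp del: mult_1)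
      thus ?thesis using H by (simp add: twisted_def twisted2_def)
    qed
    have sum: "(\<Sum>k<?n. H (x, e k) * u2.bump (e k) y) = H (x, y)" for x y
      using sum.reindex_bij_betw[OF e, of "\<lambda>y0. H (x, y0) * u2.bump y0 y"] u2.bump_expansion[OF fm t2]
      by simp
    have "F = (\<lambda>(i, j). \<Sum>k<?n. ?f k i * ?h k j)"
      unfolding F by (auto simp: fun_eq_iff ext2_def ext1_def sum)
    thus "F \<in> rep_space (outer_tensor ?V1 ?V2)"
      unfolding outer_tensor_def rep.select_convs mem_Collect_eq
      by (intro exI[of _ ?n] exI[of _ ?f] exI[of _ ?h]) (use f h in blast)
  qed
qed

definition of_mat4 :: "'r::comm_ring_1 mat \<Rightarrow> 'r m2 m2" where
  "of_mat4 A = (case split_block A 2 2 of (a, b, c, d) \<Rightarrow> M2 (of_mat2 a) (of_mat2 b) (of_mat2 c) (of_mat2 d))"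

lemma of_mat4_mat4 [simp]: "of_mat4 (mat4 x) = x"
  by (simp add: of_mat4_def)

lemma block_parabolic_eq:
  "block_parabolic = mat4 ` {M2 a Z 0 b | a Z b. invertible a \<and> invertible (b :: 'r::comm_ring_1 m2)}"
proof -
  have "p \<in> block_parabolic \<longleftrightarrow> p \<in> mat4 ` {M2 a Z 0 b | a Z b. invertible a \<and> invertible b}" for p :: "'r mat"
  proof
    assume "p \<in> block_parabolic"
    then obtain g1 X g2 where "p = four_block_mat g1 X (0\<^sub>m 2 2) g2"
      "g1 \<in> carrier (GL 2)" "X \<in> carrier_mat 2 2" "g2 \<in> carrier (GL 2)"
      unfolding block_parabolic_def by blast
    moreover then obtain a Z b where "g1 = mat2 a" "invertible a" "X = mat2 Z" "g2 = mat2 b" "invertible b"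
      by (auto simp: GL2_carrier elim: carrier_mat2E)
    ultimately have "p = mat4 (M2 a Z 0 b)" "invertible a" "invertible b" by (simp_all add: mat4_def)
    thus "p \<in> mat4 ` {M2 a Z 0 b | a Z b. invertible a \<and> invertible b}" by blast
  next
    assume "p \<in> mat4 ` {M2 a Z 0 b | a Z b. invertible a \<and> invertible b}"
    then obtain a Z b where "p = mat4 (M2 a Z 0 b)" "invertible a" "invertible b" by blast
    thus "p \<in> block_parabolic" unfolding block_parabolic_def
      by (intro CollectI exI[of _ "mat2 a"] exI[of _ "mat2 Z"] exI[of _ "mat2 b"]) (simp add: mat4_def)
  qed
  thus ?thesis by blast
qed

lemma levi_projection_mat4 [simp]: "levi_projection (mat4 u) = (mat2 (e11 u), mat2 (e22 u))"
  by (simp add: levi_projection_def)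

lemma unipotent_mat2: "unipotent (mat2 X) = mat4 (uni (X :: 'r::comm_ring_1 m2))"
  by (simp add: unipotent_def mat4_def)

lemma block_diagonal_mat2: "four_block_mat (mat2 g) (0\<^sub>m 2 2) (0\<^sub>m 2 2) (mat2 g) = mat4 (dg (g :: 'r::comm_ring_1 m2))"
  by (simp add: mat4_def)

section \<open>The Whittaker space of the parabolically induced representation\<close>

lemma Ind_spaceD:
  assumes "f \<in> rep_space (Ind G H V)"
  shows "x \<in> carrier G \<Longrightarrow> (\<lambda>i. f (x, i)) \<in> rep_space V"
    and "h \<in> H \<Longrightarrow> x \<in> carrier G \<Longrightarrow> (\<lambda>i. f (h \<otimes>\<^bsub>G\<^esub> x, i)) = rep_act V h (\<lambda>i. f (x, i))"
    and "x \<notin> carrier G \<Longrightarrow> f (x, i) = 0"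
  using assms unfolding Ind_def rep.select_convs mem_Collect_eq by blast+

lemma Ind_spaceI:
  assumes "\<And>x. x \<in> carrier G \<Longrightarrow> (\<lambda>i. f (x, i)) \<in> rep_space V"
    and "\<And>h x. h \<in> H \<Longrightarrow> x \<in> carrier G \<Longrightarrow> (\<lambda>i. f (h \<otimes>\<^bsub>G\<^esub> x, i)) = rep_act V h (\<lambda>i. f (x, i))"
    and "\<And>x i. x \<notin> carrier G \<Longrightarrow> f (x, i) = 0"
  shows "f \<in> rep_space (Ind G H V)"
  using assms unfolding Ind_def rep.select_convs mem_Collect_eq by blast

text \<open>The matrices \<open>x1\<close>, \<open>x2\<close> conjugate the normal forms to the given matrices \<open>B\<^sub>1\<close>, \<open>B\<^sub>2\<close>, and \<open>\<Phi>1\<close>, \<open>\<Phi>2\<close> are the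
  given characters. Evaluating at \<open>(x1, x2)\<close> instead of at the identity
  absorbs the conjugation, so that no isomorphism between conjugate data has to be constructed.\<close>

locale realization = mackey_regular w \<psi> s q t1 t2 \<phi>1 \<phi>2
  for w :: "'r::comm_ring_1" and \<psi> s q t1 t2 \<phi>1 \<phi>2 +
  fixes x1 x2 :: "'r m2" and \<Phi>1 \<Phi>2 :: "'r mat \<Rightarrow> complex"
  assumes x: "invertible x1" "invertible x2"
    and \<Phi>: "\<And>h. \<phi>1 h = \<Phi>1 (mat2 (x1 * h * recip x1))" "\<And>h. \<phi>2 h = \<Phi>2 (mat2 (x2 * h * recip x2))"
begin

definition S1 where "S1 = (\<lambda>h. x1 * h * recip x1) ` I1"
definition S2 where "S2 = (\<lambda>h. x2 * h * recip x2) ` I2"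

abbreviation "V1 \<equiv> Ind (GL 2) (mat2 ` S1) (character_rep \<Phi>1)"
abbreviation "V2 \<equiv> Ind (GL 2) (mat2 ` S2) (character_rep \<Phi>2)"
abbreviation "T12 \<equiv> twisted2 S1 (\<lambda>s. \<Phi>1 (mat2 s)) S2 (\<lambda>s. \<Phi>2 (mat2 s))"
abbreviation "parab_ind \<equiv> Ind (GL 4) block_parabolic (rep_pullback levi_projection (outer_tensor V1 V2))"

lemma conj_mult:
  assumes "invertible (x :: 'r m2)"
  shows "(x * a * recip x) * (x * b * recip x) = x * (a * b) * recip x"
    and "(x * a * recip x) * (x * b) = x * (a * b)"
    and "recip x * (x * a * recip x * b) = a * (recip x * b)"
  using assms by (simp_all add: mult.assoc recip_cancel)

lemma conj_recip:
  assumes "invertible (x :: 'r m2)" "invertible a"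
  shows "recip (x * a * recip x) = x * recip a * recip x"
  using assms by (simp add: recip_mult mult.assoc)

lemma unit_character_conj:
  assumes c: "cusp w \<psi> N \<phi>" and x: "invertible x" and \<Phi>: "\<And>h. \<phi> h = \<Phi> (mat2 (x * h * recip x))"
  shows "unit_character ((\<lambda>h. x * h * recip x) ` cent N) (\<lambda>s. \<Phi> (mat2 s))"
proof -
  interpret cusp w \<psi> N \<phi> by fact
  have e1: "x * 1 * recip x = 1" using x by (simp add: recip)
  show ?thesis
  proof
    show "1 \<in> (\<lambda>h. x * h * recip x) ` cent N" using one_cent e1 by (metis image_eqI)
    show "\<Phi> (mat2 1) = 1" using \<Phi>[of 1] e1 phi_one by simp
  next
    fix a b assume "a \<in> (\<lambda>h. x * h * recip x) ` cent N" "b \<in> (\<lambda>h. x * h * recip x) ` cent N"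
    then obtain g h where gh: "g \<in> cent N" "h \<in> cent N" "a = x * g * recip x" "b = x * h * recip x" by blast
    show "a * b \<in> (\<lambda>h. x * h * recip x) ` cent N"
      unfolding gh(3,4) conj_mult(1)[OF x] using cent_mult gh by blast
    show "\<Phi> (mat2 (a * b)) = \<Phi> (mat2 a) * \<Phi> (mat2 b)"
      unfolding gh(3,4) conj_mult(1)[OF x] \<Phi>[symmetric] using phi_mult gh by blast
  next
    fix a assume "a \<in> (\<lambda>h. x * h * recip x) ` cent N"
    then obtain g where g: "g \<in> cent N" "a = x * g * recip x" by blast
    show "invertible a" using g x cent_invertible by simp
    show "recip a \<in> (\<lambda>h. x * h * recip x) ` cent N"
      unfolding g(2) conj_recip[OF x cent_invertible[OF g(1)]] using cent_recip[OF g(1)] by blast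
  qed
qed

lemma S_character:
  "unit_character S1 (\<lambda>s. \<Phi>1 (mat2 s))" "unit_character S2 (\<lambda>s. \<Phi>2 (mat2 s))"
  unfolding S1_def S2_def
  using unit_character_conj[of "M2 s q 1 (t1 - s)" \<phi>1 x1 \<Phi>1, OF c1.cusp_axioms x(1) \<Phi>(1)]
    unit_character_conj[of "M2 (t2 - s) q 1 s" \<phi>2 x2 \<Phi>2, OF c2.cusp_axioms x(2) \<Phi>(2)]
  by simp_all

lemma tensor_space: "F \<in> rep_space (outer_tensor V1 V2) \<longleftrightarrow> (\<exists>H\<in>T12. F = ext2 H)"
  by (rule outer_tensor_space[OF finite_ring S_character]) simp_all

lemma T12_left:
  assumes "H \<in> T12" "h1 \<in> I1" "h2 \<in> I2"
  shows "H (x1 * h1 * recip x1 * a, x2 * h2 * recip x2 * b) = \<phi>1 h1 * \<phi>2 h2 * H (a, b)"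
  using assms unfolding twisted2_def \<Phi> by (simp add: S1_def S2_def)

lemma T12_zero: "H \<in> T12 \<Longrightarrow> \<not> (invertible a \<and> invertible b) \<Longrightarrow> H (a, b) = 0"
  by (simp add: twisted2_def)

lemma T12I:
  assumes "\<And>a b. \<not> (invertible a \<and> invertible b) \<Longrightarrow> H (a, b) = 0"
    and "\<And>h1 h2 a b. h1 \<in> I1 \<Longrightarrow> h2 \<in> I2 \<Longrightarrow>
      H (x1 * h1 * recip x1 * a, x2 * h2 * recip x2 * b) = \<phi>1 h1 * \<phi>2 h2 * H (a, b)"
  shows "H \<in> T12"
  using assms unfolding twisted2_def S1_def S2_def by (auto simp flip: \<Phi>)

lemma ext2_inj:
  assumes "ext2 H = ext2 H'" "\<And>a b. \<not> (invertible a \<and> invertible b) \<Longrightarrow> H (a, b) = H' (a, b)"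
  shows "H = H'"
proof (rule ext, clarify)
  fix a b
  show "H (a, b) = H' (a, b)"
    using assms(2)[of a b] fun_cong[OF assms(1), of "((mat2 a, ()), (mat2 b, ()))"]
    by (cases "invertible a \<and> invertible b") (simp_all add: ext2_def)
qed

lemma tensor_iso: "rep_iso (GL 2) tensor_model (V1 \<otimes>\<^sub>R V2)"
proof (rule rep_isoI[where T = "\<lambda>H. ext2 (\<lambda>(a, b). H (recip x1 * a, recip x2 * b))"], goal_cases)
  case (1 H)
  have "(\<lambda>(a, b). H (recip x1 * a, recip x2 * b)) \<in> T12"
    using 1 x by (intro T12I) (auto simp: tensor_model_def conj_mult(3))
  thus ?case unfolding inner_tensor_def rep_pullback_def rep.select_convs tensor_space by blast
next
  case (2 H H')
  have "(\<lambda>(a, b). H (recip x1 * a, recip x2 * b)) = (\<lambda>(a, b). H' (recip x1 * a, recip x2 * b))"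
    using 2(1,2) x by (intro ext2_inj[OF 2(3)]) (auto simp: tensor_model_def)
  hence "H (recip x1 * (x1 * a), recip x2 * (x2 * b)) = H' (recip x1 * (x1 * a), recip x2 * (x2 * b))" for a b
    by (simp add: fun_eq_iff)
  thus ?case using x by (simp add: recip_cancel fun_eq_iff)
next
  case (3 F)
  then obtain K where K: "K \<in> T12" "F = ext2 K"
    unfolding inner_tensor_def rep_pullback_def rep.select_convs tensor_space by blast
  let ?H = "\<lambda>(a, b). K (x1 * a, x2 * b)"
  have "K (x1 * (h1 * a), x2 * (h2 * b)) = \<phi>1 h1 * \<phi>2 h2 * K (x1 * a, x2 * b)"
    if "h1 \<in> I1" "h2 \<in> I2" for h1 h2 a b
    using T12_left[OF K(1) that, of "x1 * a" "x2 * b"] x by (simp only: conj_mult(2))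
  hence "?H \<in> rep_space tensor_model" using T12_zero[OF K(1)] x by (auto simp: tensor_model_def)
  moreover have "ext2 (\<lambda>(a, b). ?H (recip x1 * a, recip x2 * b)) = F"
    using x by (simp add: K(2) recip_cancel)
  ultimately show ?case by blast
next
  case (4 f h)
  show ?case by (auto simp: ext2_def fun_eq_iff)
next
  case (5 c f)
  show ?case by (auto simp: ext2_def fun_eq_iff)
next
  case (6 g f)
  then obtain a where a: "g = mat2 a" "invertible a" by (auto simp: GL2_carrier)
  show ?case unfolding inner_tensor_def rep_pullback_def rep.select_convs a(1)
    by (subst outer_tensor_act[OF a(2) a(2)]) (simp add: tensor_model_def mult.assoc)
qed

text \<open>The functions of \<open>W\<close> without the condition on the unipotent radical: a scalar model of
  the parabolically induced representation.\<close>

definition Wfull :: "('r m2 m2 \<Rightarrow> complex) set" where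
  "Wfull = {F. (\<forall>g. \<not> invertible g \<longrightarrow> F g = 0) \<and>
     (\<forall>h1\<in>I1. \<forall>h2\<in>I2. \<forall>Z g. F (M2 h1 Z 0 h2 * g) = \<phi>1 h1 * \<phi>2 h2 * F g)}"

text \<open>A vector-valued function on \<open>GL\<^sub>4\<close> is determined by the scalar function \<open>gather\<close> of its values at one point,
  since translation by the Levi subgroup moves this point everywhere.\<close>

definition spread :: "('r m2 m2 \<Rightarrow> complex) \<Rightarrow> 'r mat \<times> ('r mat \<times> unit) \<times> ('r mat \<times> unit) \<Rightarrow> complex" where
  "spread F = (\<lambda>(A, i). if A \<in> carrier (GL 4)
     then ext2 (\<lambda>(a, b). F (M2 (recip x1 * a) 0 0 (recip x2 * b) * of_mat4 A)) i else 0)"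

definition gather :: "('r mat \<times> ('r mat \<times> unit) \<times> ('r mat \<times> unit) \<Rightarrow> complex) \<Rightarrow> 'r m2 m2 \<Rightarrow> complex" where
  "gather f u = f (mat4 u, ((mat2 x1, ()), (mat2 x2, ())))"

lemma gather_spread: 
  assumes "F \<in> Wfull" shows "gather (spread F) = F"
proof
  fix u
  show "gather (spread F) u = F u"
  proof (cases "invertible u")
    case True
    hence "gather (spread F) u = F (M2 1 0 0 1 * u)" using x by (simp add: gather_def spread_def ext2_def recip)
    thus ?thesis by (simp only: one_m2_def[symmetric] mult_1)
  next
    case False
    thus ?thesis using assms by (simp add: gather_def spread_def Wfull_def)
  qed
qed

lemma Wfull_nn: "F \<in> Wfull \<Longrightarrow> F (uni Z * g) = F g"
  using one_cent by (simp add: Wfull_def c1.phi_one c2.phi_one)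

text \<open>The vector space of the iterated induction is the image of the scalar model.\<close>

lemma principal_space:
  "f \<in> rep_space parab_ind \<longleftrightarrow> (\<exists>F\<in>Wfull. f = spread F)"
proof
  assume f: "f \<in> rep_space parab_ind"
  have f0: "f (A, i) = 0" if "A \<notin> carrier (GL 4)" for A i using Ind_spaceD(3)[OF f that] .
  have "\<exists>H\<in>T12. (\<lambda>i. f (mat4 u, i)) = ext2 H" if "invertible u" for u
    using Ind_spaceD(1)[OF f, of "mat4 u"] that
    by (simp only: rep_pullback_def rep.select_convs tensor_space GL4_mem)
  then obtain H where H: "\<And>u. invertible u \<Longrightarrow> H u \<in> T12 \<and> (\<lambda>i. f (mat4 u, i)) = ext2 (H u)" by metis
  have fH: "f (mat4 u, i) = ext2 (H u) i" if "invertible u" for u i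
    using fun_cong[OF conjunct2[OF H[OF that]], of i] .
  have move: "H (M2 a Z 0 b * u) (c, d) = H u (c * a, d * b)"
    if i: "invertible a" "invertible b" "invertible u" "invertible c" "invertible d" for a Z b u c d
  proof -
    have p: "mat4 (M2 a Z 0 b) \<in> block_parabolic" using i unfolding block_parabolic_eq by blast
    have pi: "invertible (M2 a Z 0 b)" using i by (simp add: triangular_invertible)
    have "(\<lambda>i. f (mat4 (M2 a Z 0 b) \<otimes>\<^bsub>GL 4\<^esub> mat4 u, i))
        = rep_act (rep_pullback levi_projection (outer_tensor V1 V2)) (mat4 (M2 a Z 0 b)) (\<lambda>i. f (mat4 u, i))"
      using i by (intro Ind_spaceD(2)[OF f p]) simp
    also have "\<dots> = ext2 (\<lambda>(c, d). H u (c * a, d * b))"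
      using H i by (simp add: rep_pullback_def outer_tensor_act)
    finally have "ext2 (H (M2 a Z 0 b * u)) = ext2 (\<lambda>(c, d). H u (c * a, d * b))"
      using H[of "M2 a Z 0 b * u"] pi i by (simp del: times_m2.simps)
    from fun_cong[OF this, of "((mat2 c, ()), (mat2 d, ()))"] show ?thesis using i by (simp add: ext2_def)
  qed
  have gH: "gather f u = H u (x1, x2)" if "invertible u" for u
    using that x by (simp add: gather_def fH ext2_def)
  have "gather f \<in> Wfull"
    unfolding Wfull_def
  proof (intro CollectI conjI allI impI ballI)
    fix u :: "'r m2 m2" assume "\<not> invertible u" thus "gather f u = 0" by (simp add: gather_def f0)
  next
    fix h1 h2 Z u assume h: "h1 \<in> I1" "h2 \<in> I2"
    note hi = cent_invertible[OF h(1)] cent_invertible[OF h(2)]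
    have pi: "invertible (M2 h1 Z 0 h2)" using hi by (simp add: triangular_invertible)
    show "gather f (M2 h1 Z 0 h2 * u) = \<phi>1 h1 * \<phi>2 h2 * gather f u"
    proof (cases "invertible u")
      case True
      hence "gather f (M2 h1 Z 0 h2 * u) = H u (x1 * h1, x2 * h2)"
        using pi hi x by (simp only: gH invertible_mult move)
      also have "\<dots> = H u (x1 * h1 * recip x1 * x1, x2 * h2 * recip x2 * x2)"
        using x by (simp add: mult.assoc recip)
      also have "\<dots> = \<phi>1 h1 * \<phi>2 h2 * H u (x1, x2)" using H[OF True] T12_left h by blast
      finally show ?thesis using gH[OF True] by simp
    next
      case False
      thus ?thesis using pi by (simp add: gather_def f0 del: times_m2.simps)
    qed
  qed
  moreover have "f = spread (gather f)"
  proof (rule ext, clarify)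
    fix A X Y
    show "f (A, (X, ()), (Y, ())) = spread (gather f) (A, (X, ()), (Y, ()))"
    proof (cases "A \<in> carrier (GL 4)")
      case True
      then obtain u where u: "A = mat4 u" "invertible u" by (auto simp: GL4_carrier)
      show ?thesis
      proof (cases "X \<in> carrier (GL 2) \<and> Y \<in> carrier (GL 2)")
        case True
        then obtain a b where ab: "X = mat2 a" "invertible a" "Y = mat2 b" "invertible b" by (auto simp: GL2_carrier)
        have "spread (gather f) (A, (X, ()), (Y, ())) = gather f (M2 (recip x1 * a) 0 0 (recip x2 * b) * u)"
          using u ab by (simp add: spread_def ext2_def del: times_m2.simps)
        also have "\<dots> = H (M2 (recip x1 * a) 0 0 (recip x2 * b) * u) (x1, x2)"
          using u ab x by (intro gH) (simp add: triangular_invertible del: times_m2.simps)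
        also have "\<dots> = H u (a, b)"
          using u ab x by (subst move) (simp_all add: recip_cancel)
        also have "\<dots> = f (A, (X, ()), (Y, ()))" using u ab by (simp add: fH ext2_def)
        finally show ?thesis by simp
      next
        case False
        thus ?thesis using u by (auto simp: fH spread_def ext2_def)
      qed
    next
      case False
      thus ?thesis by (simp add: f0 spread_def)
    qed
  qed
  ultimately show "\<exists>F\<in>Wfull. f = spread F" by blast
next
  assume "\<exists>F\<in>Wfull. f = spread F"
  then obtain F where F: "F \<in> Wfull" and f: "f = spread F" by blast
  define H where "H u = (\<lambda>(a, b). F (M2 (recip x1 * a) 0 0 (recip x2 * b) * u))" for u
  have fH: "(\<lambda>i. f (mat4 u, i)) = ext2 (H u)" if "invertible u" for u
    using that by (simp add: f spread_def H_def)
  have "H u \<in> T12" if u: "invertible u" for u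
  proof (rule T12I)
    fix a b :: "'r m2" assume "\<not> (invertible a \<and> invertible b)"
    hence "\<not> invertible (M2 (recip x1 * a) 0 0 (recip x2 * b) * u)"
      using u x by (simp add: triangular_invertible del: times_m2.simps)
    thus "H u (a, b) = 0" using F by (simp add: H_def Wfull_def del: times_m2.simps)
  next
    fix h1 h2 a b :: "'r m2" assume h: "h1 \<in> I1" "h2 \<in> I2"
    have "M2 (recip x1 * (x1 * h1 * recip x1 * a)) 0 0 (recip x2 * (x2 * h2 * recip x2 * b)) * u
        = M2 h1 0 0 h2 * (M2 (recip x1 * a) 0 0 (recip x2 * b) * u)"
      unfolding conj_mult(3)[OF x(1)] conj_mult(3)[OF x(2)] by (simp flip: mult.assoc)
    thus "H u (x1 * h1 * recip x1 * a, x2 * h2 * recip x2 * b) = \<phi>1 h1 * \<phi>2 h2 * H u (a, b)"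
      using F h by (simp add: H_def Wfull_def del: times_m2.simps)
  qed
  hence T: "ext2 (H u) \<in> rep_space (outer_tensor V1 V2)" if "invertible u" for u
    unfolding tensor_space using that by blast
  have act: "ext2 (H (p * u)) = rep_act (outer_tensor V1 V2) (levi_projection (mat4 p)) (ext2 (H u))"
    if p: "p \<in> {M2 a Z 0 b | a Z b. invertible a \<and> invertible b}" and u: "invertible u" for p u
  proof -
    obtain a Z b where p: "p = M2 a Z 0 b" and ab: "invertible a" "invertible b" using p by blast
    have "H (p * u) (c, d) = H u (c * a, d * b)" if cd: "invertible c" "invertible d" for c d
    proof -
      let ?b = "recip x2 * d * b"
      have bi: "invertible ?b" using x cd ab by simp
      have "M2 (recip x1 * c) 0 0 (recip x2 * d) * p = uni (recip x1 * c * Z * recip ?b) * M2 (recip x1 * (c * a)) 0 0 (recip x2 * (d * b))"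
        using recip[OF bi] by (simp add: p mult.assoc)
      hence "M2 (recip x1 * c) 0 0 (recip x2 * d) * (p * u)
          = uni (recip x1 * c * Z * recip ?b) * (M2 (recip x1 * (c * a)) 0 0 (recip x2 * (d * b)) * u)"
        by (simp only: mult.assoc[symmetric])
      thus ?thesis using Wfull_nn[OF F] by (simp add: H_def del: times_m2.simps)
    qed
    hence "ext2 (H (p * u)) = ext2 (\<lambda>(c, d). H u (c * a, d * b))"
      by (auto simp: ext2_def fun_eq_iff GL2_carrier)
    thus ?thesis using ab by (simp add: p outer_tensor_act)
  qed
  show "f \<in> rep_space parab_ind"
  proof (rule Ind_spaceI)
    fix A :: "'r mat" assume "A \<in> carrier (GL 4)"
    then obtain u where u: "A = mat4 u" "invertible u" by (auto simp: GL4_carrier)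
    show "(\<lambda>i. f (A, i)) \<in> rep_space (rep_pullback levi_projection (outer_tensor V1 V2))"
      using T[OF u(2)] by (simp only: rep_pullback_def rep.select_convs u(1) fH[OF u(2)])
  next
    fix P A :: "'r mat" assume P: "P \<in> block_parabolic" and A: "A \<in> carrier (GL 4)"
    obtain u where u: "A = mat4 u" "invertible u" using A by (auto simp: GL4_carrier)
    obtain p where p: "P = mat4 p" "p \<in> {M2 a Z 0 b | a Z b. invertible a \<and> invertible b}"
      using P unfolding block_parabolic_eq by blast
    have "invertible (p * u)" using p(2) u(2) by (auto simp: triangular_invertible simp del: times_m2.simps)
    thus "(\<lambda>i. f (P \<otimes>\<^bsub>GL 4\<^esub> A, i)) = rep_act (rep_pullback levi_projection (outer_tensor V1 V2)) P (\<lambda>i. f (A, i))"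
      using act[OF p(2) u(2)] u(2) by (simp only: rep_pullback_def rep.select_convs p(1) u(1) GL_mult mat4_mult fH)
  next
    fix A :: "'r mat" and i assume "A \<notin> carrier (GL 4)"
    thus "f (A, i) = 0" by (simp add: f spread_def split: prod.split)
  qed
qed

lemma principal_act:
  assumes "invertible v"
  shows "rep_act parab_ind (mat4 v) (spread F) = spread (\<lambda>u. F (u * v))"
  using assms by (auto simp: Ind_def spread_def ext2_def fun_eq_iff GL4_carrier mult.assoc simp del: times_m2.simps)

lemma Wfull_translate: "F \<in> Wfull \<Longrightarrow> invertible v \<Longrightarrow> (\<lambda>u. F (u * v)) \<in> Wfull"
  by (simp add: Wfull_def mult.assoc del: times_m2.simps)

lemma spread_scale: "(\<lambda>i. c * spread F i) = spread (\<lambda>u. c * F u)"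
  by (auto simp: spread_def ext2_def fun_eq_iff)

lemma Wfull_scale: "F \<in> Wfull \<Longrightarrow> (\<lambda>u. c * F u) \<in> Wfull"
  by (simp add: Wfull_def)

lemma spread_inj: "F \<in> Wfull \<Longrightarrow> F' \<in> Wfull \<Longrightarrow> spread F = spread F' \<longleftrightarrow> F = F'"
  by (metis gather_spread)

lemma whittaker_space: "f \<in> rep_space (degenerate_Whittaker \<psi> parab_ind) \<longleftrightarrow> (\<exists>F\<in>W. f = spread F)"
proof -
  have "(\<forall>X\<in>carrier_mat 2 2. rep_act parab_ind (unipotent X) (spread F) = (\<lambda>i. \<psi> (mat_trace X) * spread F i)) \<longleftrightarrow> F \<in> W"
    if F: "F \<in> Wfull" for F
  proof -
    have "(\<forall>X\<in>carrier_mat 2 2. rep_act parab_ind (unipotent X) (spread F) = (\<lambda>i. \<psi> (mat_trace X) * spread F i))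
       \<longleftrightarrow> (\<forall>X. rep_act parab_ind (mat4 (uni X)) (spread F) = (\<lambda>i. \<psi> (tr2 X) * spread F i))"
      by (metis carrier_mat2E mat2_carrier mat_trace_mat2 unipotent_mat2)
    also have "\<dots> \<longleftrightarrow> (\<forall>X. (\<lambda>u. F (u * uni X)) = (\<lambda>u. \<psi> (tr2 X) * F u))"
      using F by (simp add: principal_act spread_scale spread_inj Wfull_translate Wfull_scale del: times_m2.simps)
    also have "\<dots> \<longleftrightarrow> F \<in> W" using F by (simp add: W_def Wfull_def fun_eq_iff del: times_m2.simps)
    finally show ?thesis .
  qed
  moreover have "W \<subseteq> Wfull" by (auto simp: W_def Wfull_def)
  ultimately show ?thesis
    unfolding degenerate_Whittaker_def rep.select_convs mem_Collect_eq principal_space by blast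
qed

lemma W_Wfull: "F \<in> W \<Longrightarrow> F \<in> Wfull"
  by (simp add: W_def Wfull_def)

lemma whittaker_iso: "rep_iso (GL 2) (degenerate_Whittaker \<psi> parab_ind) whittaker_model"
proof (rule rep_isoI[where T = gather], goal_cases)
  case (1 f)
  thus ?case unfolding whittaker_space by (auto simp: whittaker_model_def gather_spread W_Wfull)
next
  case (2 f h)
  thus ?case unfolding whittaker_space by (auto simp: gather_spread W_Wfull)
next
  case (3 F)
  hence "F \<in> W" by (simp add: whittaker_model_def)
  thus ?case by (intro bexI[of _ "spread F"]) (auto simp: gather_spread W_Wfull whittaker_space)
next
  case (4 f h)
  show ?case by (simp add: gather_def fun_eq_iff)
next
  case (5 c f)
  show ?case by (simp add: gather_def fun_eq_iff)
next
  case (6 g f)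
  obtain F where F: "F \<in> W" "f = spread F" using 6(2) unfolding whittaker_space by blast
  obtain a where a: "g = mat2 a" "invertible a" using 6(1) by (auto simp: GL2_carrier)
  have "rep_act (degenerate_Whittaker \<psi> parab_ind) g f = spread (\<lambda>u. F (u * dg a))"
    using a by (simp add: degenerate_Whittaker_def block_diagonal_mat2 F(2) principal_act del: times_m2.simps)
  thus ?case using F a
    by (simp add: gather_spread Wfull_translate W_Wfull whittaker_model_def del: times_m2.simps)
qed

end

section \<open>Central characters and the summands\<close>

lemma congruence_subgroup_eq: "congruence_subgroup (w :: 'r::comm_ring_1) = {mat2 (1 + sc w * Y) | Y. True}"
proof -
  have "congruence_subgroup w = {mat2 1 + w \<cdot>\<^sub>m mat2 Y | Y. True}"
    unfolding congruence_subgroup_def mat2_one by (metis carrier_mat2E mat2_carrier)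
  thus ?thesis by (simp only: mat2_add mat2_smult)
qed

text \<open>The scalar is unique as soon as the space contains a nonzero vector.\<close>

lemma central_characterI:
  assumes "\<And>f. f \<in> rep_space V \<Longrightarrow> rep_act V (z \<cdot>\<^sub>m 1\<^sub>m n) f = (\<lambda>i. c * f i)"
    and "f0 \<in> rep_space V" "f0 \<noteq> (\<lambda>_. 0)"
  shows "central_character n V z = c"
  unfolding central_character_def
proof (rule the_equality)
  show "\<forall>f\<in>rep_space V. rep_act V (z \<cdot>\<^sub>m 1\<^sub>m n) f = (\<lambda>i. c * f i)" using assms(1) by blast
next
  fix c' assume "\<forall>f\<in>rep_space V. rep_act V (z \<cdot>\<^sub>m 1\<^sub>m n) f = (\<lambda>i. c' * f i)"
  hence "(\<lambda>i. c' * f0 i) = (\<lambda>i. c * f0 i)" using assms(1)[OF assms(2)] assms(2) by simp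
  moreover obtain i where "f0 i \<noteq> 0" using assms(3) by auto
  ultimately show "c' = c" by (metis mult_cancel_right)
qed

lemma scalar_mat2: "z \<cdot>\<^sub>m 1\<^sub>m 2 = mat2 (sc (z :: 'r::comm_ring_1))"
  using mat2_smult[of z 1] by simp

lemma scalar_mat4: "z \<cdot>\<^sub>m 1\<^sub>m 4 = mat4 (dg (sc (z :: 'r::comm_ring_1)))"
proof -
  have "z \<cdot>\<^sub>m mat4 (dg 1) = four_block_mat (z \<cdot>\<^sub>m mat2 1) (z \<cdot>\<^sub>m mat2 0) (z \<cdot>\<^sub>m mat2 0) (z \<cdot>\<^sub>m mat2 1)"
    unfolding mat4_def m2.sel by (rule smult_four_block_mat) (rule mat2_carrier)+
  also have "\<dots> = mat4 (dg (sc z))"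
    by (simp only: mat2_smult mult_1_right mult_zero_right mat4_def m2.sel)
  finally have "z \<cdot>\<^sub>m mat4 1 = mat4 (dg (sc z))" by (simp only: dg_one)
  thus ?thesis by simp
qed

text \<open>A nonzero vector of the induced representation, needed to identify its central character.\<close>

lemma (in unit_character) delta_twisted: "(\<lambda>x. if x \<in> S then c x else 0) \<in> twisted S c"
proof -
  have "s * x \<in> S \<longleftrightarrow> x \<in> S" if "s \<in> S" for s x
    using closed that by (metis recip_cancel(2))
  thus ?thesis using closed mult by (auto simp: twisted_def)
qed

lemma (in unit_character) central_character_Ind:
  assumes \<chi>: "\<And>s. s \<in> S \<Longrightarrow> \<chi> (mat2 s) = c s" and z: "sc z \<in> S"
  shows "central_character 2 (Ind (GL 2) (mat2 ` S) (character_rep \<chi>)) z = c (sc z)"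
proof (rule central_characterI)
  have i: "S \<subseteq> Collect invertible" using closed by auto
  note sp = Ind_character_space[of S \<chi> c, OF i \<chi>]
  fix f assume "f \<in> rep_space (Ind (GL 2) (mat2 ` S) (character_rep \<chi>))"
  then obtain h where h: "h \<in> twisted S c" "f = ext1 h" using sp[of f] unfolding ext1_def by blast
  have "h (x * sc z) = c (sc z) * h x" for x
    using twistedD(1)[OF h(1) z] by (metis sc_comm)
  thus "rep_act (Ind (GL 2) (mat2 ` S) (character_rep \<chi>)) (z \<cdot>\<^sub>m 1\<^sub>m 2) f = (\<lambda>i. c (sc z) * f i)"
    unfolding scalar_mat2 h(2) using closed(2)[OF z]
    by (auto simp: Ind_def ext1_def fun_eq_iff GL2_carrier)
next
  have i: "S \<subseteq> Collect invertible" using closed by auto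
  let ?h = "\<lambda>x. if x \<in> S then c x else 0"
  show "ext1 ?h \<in> rep_space (Ind (GL 2) (mat2 ` S) (character_rep \<chi>))"
    by (rule iffD2[OF Ind_character_space[of S \<chi> c, OF i \<chi>]])
       (use delta_twisted in \<open>auto simp: ext1_def\<close>)
  have "ext1 ?h (mat2 1, ()) = 1" using one by (simp add: ext1_def del: mat2_one)
  thus "ext1 ?h \<noteq> (\<lambda>_. 0)" by (metis zero_neq_one)
qed

context realization
begin

lemma sc_conj: "invertible (x :: 'r m2) \<Longrightarrow> x * sc z * recip x = sc z"
  by (simp only: sc_comm[symmetric] mult.assoc recip mult_1_right)

lemma central1: "invertible z \<Longrightarrow> central_character 2 V1 z = \<phi>1 (sc z)"
proof -
  assume z: "invertible z"
  have "sc z \<in> S1" unfolding S1_def using c1.sc_cent[OF z] sc_conj[OF x(1)] by (metis image_eqI)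
  thus ?thesis using unit_character.central_character_Ind[OF S_character(1), of \<Phi>1 z]
    by (simp only: \<Phi> sc_conj[OF x(1)])
qed

lemma central2: "invertible z \<Longrightarrow> central_character 2 V2 z = \<phi>2 (sc z)"
proof -
  assume z: "invertible z"
  have "sc z \<in> S2" unfolding S2_def using c2.sc_cent[OF z] sc_conj[OF x(2)] by (metis image_eqI)
  thus ?thesis using unit_character.central_character_Ind[OF S_character(2), of \<Phi>2 z]
    by (simp only: \<Phi> sc_conj[OF x(2)])
qed

lemma central_parab_ind:
  assumes z: "invertible z"
  shows "central_character 4 parab_ind z = \<phi>1 (sc z) * \<phi>2 (sc z)"
proof (rule central_characterI)
  fix f assume "f \<in> rep_space parab_ind"
  then obtain F where F: "F \<in> Wfull" "f = spread F" unfolding principal_space by blast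
  have "F (u * dg (sc z)) = \<phi>1 (sc z) * \<phi>2 (sc z) * F u" for u
  proof -
    have "u * dg (sc z) = dg (sc z) * u" by (cases u) (simp add: sc_comm)
    thus ?thesis using F(1) c1.sc_cent[OF z] c2.sc_cent[OF z] by (simp add: Wfull_def del: times_m2.simps)
  qed
  moreover have "invertible (dg (sc z))" using sc_invertible[OF z] by simp
  ultimately show "rep_act parab_ind (z \<cdot>\<^sub>m 1\<^sub>m 4) f = (\<lambda>i. \<phi>1 (sc z) * \<phi>2 (sc z) * f i)"
    unfolding scalar_mat4 F(2) by (subst principal_act) (simp_all add: spread_scale del: times_m2.simps)
next
  define F0 where "F0 u = (if u \<in> parab then \<phi>1 (e11 u) * \<phi>2 (e22 u) else 0)" for u
  have "p * u \<in> parab \<longleftrightarrow> u \<in> parab" if "p \<in> parab" for p u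
    using parab_recip[OF that] parab_mult(1) that by (metis recip_cancel(2))
  hence r: "F0 (p * u) = \<phi>1 (e11 p) * \<phi>2 (e22 p) * F0 u" if "p \<in> parab" for p u
    using parab_mult(2) that by (simp add: F0_def)
  have "F0 (M2 h1 Z 0 h2 * u) = \<phi>1 h1 * \<phi>2 h2 * F0 u" if "h1 \<in> I1" "h2 \<in> I2" for h1 h2 Z u
  proof -
    have "M2 h1 Z 0 h2 \<in> parab" unfolding parab_def using that by blast
    from r[OF this, of u] show ?thesis by (simp only: m2.sel)
  qed
  moreover have "F0 u = 0" if "\<not> invertible u" for u using parab_recip that by (auto simp: F0_def)
  ultimately have F: "F0 \<in> Wfull" unfolding Wfull_def by blast
  thus "spread F0 \<in> rep_space parab_ind" unfolding principal_space by blast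
  have "F0 1 = 1" using parab_one by (simp add: F0_def one_block c1.phi_one c2.phi_one)
  hence "gather (spread F0) 1 = 1" by (simp only: gather_spread[OF F])
  thus "spread F0 \<noteq> (\<lambda>_. 0)" by (auto simp: gather_def)
qed

lemma borel_summand:
  "rep_iso (GL 2) (twisted_rep Bor diag_char)
     (Ind (GL 2) borel2 (character_rep (borel_character (central_character 2 V1) (central_character 2 V2))))"
proof -
  have ut: "upper_triangular (mat2 x) \<longleftrightarrow> e21 x = 0" for x :: "'r m2"
    by (simp add: upper_triangular_def numeral_2_eq_2 All_less_Suc)
  have b: "borel2 = mat2 ` Bor"
    unfolding borel2_def Bor_def GL2_carrier using ut by blast
  show ?thesis unfolding b
  proof (rule twisted_rep_Ind)
    fix g assume g: "g \<in> Bor"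
    then obtain a b d where gg: "g = M2 a b 0 d" by (cases g) (auto simp: Bor_def)
    have "invertible (a * d)" using g by (simp add: Bor_def gg invertible_det2)
    thus "borel_character (central_character 2 V1) (central_character 2 V2) (mat2 g) = diag_char g"
      by (simp add: borel_character_def diag_char_def gg central1 central2 invertible_mult_iff)
  qed (auto simp: Bor_def)
qed

lemma ZJ_eq: "ZJ = {sc z * (1 + sc w * Y) | z Y. invertible z}"
proof -
  have "j \<in> {sc z * (1 + sc w * Y) | z Y. invertible z}" if "j \<in> ZJ" for j
  proof -
    obtain a b c d where jj: "j = M2 a b c d" by (cases j)
    have j': "invertible j" "w * b = 0" "w * c = 0" "w * a = w * d" using that by (auto simp: ZJ_def jj)
    then obtain b' c' where bc: "b = w * b'" "c = w * c'" using ann_w by (meson dvd_def)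
    obtain d' where d: "d = a + w * d'" using ann_w[of "d - a"] j'(4) by (auto simp: dvd_def algebra_simps)
    have "invertible (a * d)" using j'(1)
      by (simp add: jj bc invertible_det2 invertible_iff algebra_simps)
    hence a: "invertible a" by (simp add: invertible_mult_iff)
    have "j = sc a * (1 + sc w * (sc (recip a) * M2 0 b' c' d'))"
      using recip_cancel(1)[OF a] by (simp add: jj bc d m2_simps distrib_left mult.left_commute[of a w])
    thus ?thesis using a by blast
  qed
  moreover have "sc z * (1 + sc w * Y) \<in> ZJ" if "invertible z" for z Y
  proof -
    have "invertible (sc z * (1 + sc w * Y))" using that one_plus_invertible sc_invertible by simp
    thus ?thesis by (cases Y) (simp add: ZJ_def m2_simps algebra_simps)
  qed
  ultimately show ?thesis by blast
qed

lemma diag_char_ZJ: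
  assumes "invertible z"
  shows "diag_char (sc z * (1 + sc w * Y)) = \<phi>1 (sc z) * \<phi>2 (sc z) * \<psi> (w * (t1 * e11 Y + t2 * e22 Y))"
proof -
  obtain a b c d where Y: "Y = M2 a b c d" by (cases Y)
  have 1: "sc (z * (1 + w * a)) = sc z * (1 + sc w * sc a)" for a by (simp add: m2_simps)
  have e: "sc z * (1 + sc w * Y) = M2 (z * (1 + w * a)) (z * (w * b)) (z * (w * c)) (z * (1 + w * d))"
    by (simp add: Y m2_simps)
  have "diag_char (sc z * (1 + sc w * Y)) = \<phi>1 (sc z) * \<psi> (w * (t1 * a)) * (\<phi>2 (sc z) * \<psi> (w * (t2 * d)))"
    unfolding e diag_char_def m2.sel 1 c1.phi_mult[OF c1.sc_cent[OF assms] c1.J_cent]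
      c2.phi_mult[OF c2.sc_cent[OF assms] c2.J_cent] c1.phi_J c2.phi_J
    by (simp add: algebra_simps)
  thus ?thesis by (simp add: Y distrib_left psi_add)
qed

text \<open>The value of the character at a point of \<open>Z J\<close> is read off from any factorisation \<open>z j\<close>; all of them
  give the value of \<open>diag_char\<close>, hence the description is well defined.\<close>

lemma center_congruence_summand:
  assumes \<phi>D: "\<And>Y. \<phi>D (mat2 (1 + sc w * Y)) = \<psi> (w * (t1 * e11 Y + t2 * e22 Y))"
  shows "rep_iso (GL 2) (twisted_rep ZJ diag_char)
     (Ind (GL 2) (center_congruence w)
        (character_rep (center_congruence_character w (central_character 4 parab_ind) \<phi>D)))"
proof -
  have "center_congruence w = {z \<cdot>\<^sub>m mat2 (1 + sc w * Y) | z Y. invertible z}"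
    unfolding center_congruence_def congruence_subgroup_eq invertible_dvd by blast
  also have "\<dots> = {mat2 (sc z * (1 + sc w * Y)) | z Y. invertible z}" by (simp only: mat2_smult)
  also have "\<dots> = mat2 ` ZJ" unfolding ZJ_eq by blast
  finally have b: "center_congruence w = mat2 ` ZJ" .
  show ?thesis unfolding b
  proof (rule twisted_rep_Ind)
    fix j assume "j \<in> ZJ"
    then obtain z Y where zY: "invertible z" "j = sc z * (1 + sc w * Y)" unfolding ZJ_eq by blast
    show "center_congruence_character w (central_character 4 parab_ind) \<phi>D (mat2 j) = diag_char j"
      unfolding center_congruence_character_def
    proof (rule the_equality)
      show "\<exists>z j'. z dvd 1 \<and> j' \<in> congruence_subgroup w \<and> mat2 j = z \<cdot>\<^sub>m j' \<and>
          diag_char j = central_character 4 parab_ind z * \<phi>D j'"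
        using zY unfolding congruence_subgroup_eq zY(2) diag_char_ZJ[OF zY(1)]
        by (intro exI[of _ z] exI[of _ "mat2 (1 + sc w * Y)"]) (auto simp: invertible_dvd[symmetric] central_parab_ind \<phi>D)
    next
      fix c assume "\<exists>z j'. z dvd 1 \<and> j' \<in> congruence_subgroup w \<and> mat2 j = z \<cdot>\<^sub>m j' \<and>
          c = central_character 4 parab_ind z * \<phi>D j'"
      then obtain z Y where z: "invertible z" and jz: "mat2 j = z \<cdot>\<^sub>m mat2 (1 + sc w * Y)"
        and c: "c = central_character 4 parab_ind z * \<phi>D (mat2 (1 + sc w * Y))"
        unfolding congruence_subgroup_eq invertible_dvd[symmetric] by blast
      have "j = sc z * (1 + sc w * Y)" using jz by (simp only: mat2_smult mat2_inj)
      thus "c = diag_char j" using z by (simp only: c diag_char_ZJ central_parab_ind \<phi>D)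
    qed
  qed (auto simp: ZJ_def)
qed

theorem whittaker_decomposition:
  assumes \<phi>D: "\<And>Y. \<phi>D (mat2 (1 + sc w * Y)) = \<psi> (w * (t1 * e11 Y + t2 * e22 Y))"
  shows "rep_iso (GL 2) (degenerate_Whittaker \<psi> parab_ind)
    ((V1 \<otimes>\<^sub>R V2)
      \<oplus>\<^sub>R Ind (GL 2) borel2 (character_rep (borel_character (central_character 2 V1) (central_character 2 V2)))
      \<oplus>\<^sub>R Ind (GL 2) (center_congruence w)
            (character_rep (center_congruence_character w (central_character 4 parab_ind) \<phi>D)))"
proof -
  have "rep_iso (GL 2) (twisted_rep Bor_cong diag_char) (Ind (GL 2) (center_congruence w)
            (character_rep (center_congruence_character w (central_character 4 parab_ind) \<phi>D)))"
    using Bor_cong_iso_ZJ center_congruence_summand[OF \<phi>D] by (rule rep_iso_trans)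
  hence "rep_iso (GL 2) (tensor_model \<oplus>\<^sub>R twisted_rep Bor diag_char \<oplus>\<^sub>R twisted_rep Bor_cong diag_char) ((V1 \<otimes>\<^sub>R V2)
      \<oplus>\<^sub>R Ind (GL 2) borel2 (character_rep (borel_character (central_character 2 V1) (central_character 2 V2)))
      \<oplus>\<^sub>R Ind (GL 2) (center_congruence w)
            (character_rep (center_congruence_character w (central_character 4 parab_ind) \<phi>D)))"
    by (intro direct_sum_iso tensor_iso borel_summand)
  thus ?thesis using rep_iso_trans[OF whittaker_iso rep_iso_trans[OF restriction_iso]] by blast
qed

end

section \<open>The residue field\<close>

lemma map_mat_mat2: "map_mat f (mat2 x) = mat2 (map_m2 f x)"
  by (cases x) (auto intro!: eq_matI simp: less_2)

text \<open>An upper triangular matrix has a characteristic polynomial that splits.\<close>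

lemma char_poly_irreducible_e21:
  assumes "irreducible (char_poly (mat2 (b :: 'k::field m2)))"
  shows "e21 b \<noteq> 0"
proof
  assume "e21 b = 0"
  hence "upper_triangular (mat2 b)"
    by (simp add: upper_triangular_def numeral_2_eq_2 All_less_Suc)
  hence "char_poly (mat2 b) = (\<Prod>a\<leftarrow>diag_mat (mat2 b). [:- a, 1:])"
    by (rule char_poly_upper_triangular[OF mat2_carrier])
  hence "char_poly (mat2 b) = [:- e11 b, 1:] * [:- e22 b, 1:]"
    by (simp add: diag_mat_def numeral_2_eq_2)
  hence "is_unit [:- e11 b, 1:] \<or> is_unit [:- e22 b, 1:]"
    using assms by (metis irreducible_def)
  thus False by (auto simp: is_unit_poly_iff)
qed

context dual_ring
begin

lemma psi_diff: "\<psi> (x - y) = \<psi> x / \<psi> y"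
  using psi_add[of x "- y"] by (simp add: psi_minus divide_inverse)

lemma cent_conj:
  assumes x: "invertible (x :: 'r m2)"
  shows "cent (x * N * recip x) = (\<lambda>h. x * h * recip x) ` cent N"
proof -
  have sub: "x * h * recip x \<in> cent (x * N * recip x)" if "h \<in> cent N" "invertible x" for x h N :: "'r m2"
  proof -
    have "sc w * ((x * h * recip x) * (x * N * recip x)) = x * (sc w * (h * N)) * recip x"
      using that(2) by (simp add: sc_comm mult.assoc recip_cancel)
    also have "\<dots> = x * (sc w * (N * h)) * recip x" using that(1) by (simp add: cent_def)
    also have "\<dots> = sc w * ((x * N * recip x) * (x * h * recip x))"
      using that(2) by (simp add: sc_comm mult.assoc recip_cancel)
    finally show ?thesis using that by (simp add: cent_def)
  qed
  have "g \<in> (\<lambda>h. x * h * recip x) ` cent N" if "g \<in> cent (x * N * recip x)" for g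
  proof -
    have "recip x * g * recip (recip x) \<in> cent (recip x * (x * N * recip x) * recip (recip x))"
      using sub[OF that, of "recip x"] x by simp
    hence "recip x * g * x \<in> cent N" using x by (simp add: mult.assoc recip recip_cancel)
    moreover have "g = x * (recip x * g * x) * recip x" using x by (simp add: mult.assoc recip recip_cancel)
    ultimately show ?thesis by blast
  qed
  thus ?thesis using sub x by blast
qed

lemma trace_nondegenerate:
  assumes "\<And>Y. \<psi> (w * tr2 (A * Y)) = 1"
  shows "sc w * A = 0"
proof -
  obtain a b c d where A: "A = M2 a b c d" by (cases A)
  have "w * a = 0" using assms[of "M2 _ 0 0 0"] by (intro psi_w_nondegenerate) (simp add: A)
  moreover have "w * b = 0" using assms[of "M2 0 0 _ 0"] by (intro psi_w_nondegenerate) (simp add: A)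
  moreover have "w * c = 0" using assms[of "M2 0 _ 0 0"] by (intro psi_w_nondegenerate) (simp add: A)
  moreover have "w * d = 0" using assms[of "M2 0 0 0 _"] by (intro psi_w_nondegenerate) (simp add: A)
  ultimately show ?thesis by (simp add: A m2_simps)
qed

end

text \<open>The residue field is reintroduced here in order to compare lifts with the matrices \<open>B\<^sub>i\<close> themselves.\<close>

locale residue = dual_ring w \<psi> for w :: "'r::comm_ring_1" and \<psi> +
  fixes red :: "'r \<Rightarrow> 'k::field"
  assumes red_one: "red 1 = 1" and red_add: "red (x + y) = red x + red y"
    and red_mult: "red (x * y) = red x * red y" and red_surj: "surj red"
    and red_ker: "red x = 0 \<longleftrightarrow> w * x = 0"
begin

lemma red_zero: "red 0 = 0" using red_ker[of 0] by simp

lemma red_minus: "red (- x) = - red x"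
  using red_add[of x "- x"] red_zero by (simp add: eq_neg_iff_add_eq_0 add.commute)

lemma red_diff: "red (x - y) = red x - red y"
  using red_add[of x "- y"] red_minus by simp

lemma red_eq_iff: "red x = red y \<longleftrightarrow> w * x = w * y"
  using red_ker[of "x - y"] by (simp add: red_diff algebra_simps)

lemma red_invertible: "invertible x \<longleftrightarrow> red x \<noteq> 0"
  using not_invertible_iff red_ker by blast

lemma map2_mult: "map_m2 red (x * y) = map_m2 red x * map_m2 red y"
  by (cases x; cases y) (simp add: red_add red_mult)

lemma map2_one: "map_m2 red 1 = 1"
  by (simp add: m2_simps red_one red_zero)

lemma tr2_red: "tr2 (map_m2 red x) = red (tr2 x)"
  by (cases x) (simp add: red_add)

lemma residue_character_red: "residue_character w red \<psi> (red x) = \<psi> (w * x)"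
proof -
  have "red (SOME x'. red x' = red x) = red x" by (rule someI[of _ x]) simp
  thus ?thesis unfolding residue_character_def red_eq_iff by simp
qed

lemma phi_mat2: "phi w red \<psi> (mat2 (map_m2 red A)) (mat2 (1 + sc w * Y)) = \<psi> (w * tr2 (A * Y))"
proof -
  let ?P = "\<lambda>X. X \<in> carrier_mat 2 2 \<and> mat2 (1 + sc w * Y) = 1\<^sub>m 2 + w \<cdot>\<^sub>m X"
  have "?P (mat2 Y)" by (simp flip: mat2_one mat2_smult mat2_add)
  hence X: "?P (SOME X. ?P X)" by (rule someI)
  then obtain Y' where Y': "(SOME X. ?P X) = mat2 Y'" by (metis carrier_mat2E)
  have "mat2 (1 + sc w * Y) = mat2 1 + w \<cdot>\<^sub>m mat2 Y'" using X unfolding Y' by (simp only: mat2_one)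
  hence "1 + sc w * Y = 1 + sc w * Y'" by (simp only: mat2_add mat2_smult mat2_inj)
  hence e: "sc w * Y = sc w * Y'" by (simp only: add_left_cancel)
  have "w * tr2 (A * Y') = tr2 (A * (sc w * Y'))" by (simp add: tr2_sc[symmetric] sc_comm mult.assoc)
  also have "\<dots> = w * tr2 (A * Y)" by (simp only: e[symmetric]) (simp add: tr2_sc[symmetric] sc_comm mult.assoc)
  finally have "w * tr2 (A * Y') = w * tr2 (A * Y)" .
  moreover have "phi w red \<psi> (mat2 (map_m2 red A)) (mat2 (1 + sc w * Y)) = \<psi> (w * tr2 (A * Y'))"
    unfolding phi_def Y' by (simp add: map_mat_mat2 tr2_red residue_character_red flip: map2_mult)
  ultimately show ?thesis by simp
qed

text \<open>Conjugation by \<open>g\<close> moves from the argument of \<open>\<phi>\<^sub>B\<close> to \<open>B\<close>, and the trace form followed by the character is nondegenerate modulo \<open>w\<close>.\<close>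

lemma inertia_group_eq: "inertia_group w red \<psi> (mat2 (map_m2 red A)) = mat2 ` cent A"
proof -
  have "mat2 g \<in> inertia_group w red \<psi> (mat2 (map_m2 red A)) \<longleftrightarrow> g \<in> cent A" if g: "invertible g" for g
  proof -
    have c: "recip g * (1 + sc w * Y) * g = 1 + sc w * (recip g * Y * g)" for Y
    proof -
      have "recip g * (1 + sc w * Y) * g = recip g * g + recip g * (sc w * Y) * g"
        by (simp only: distrib_left distrib_right mult_1_right)
      also have "recip g * (sc w * Y) * g = sc w * (recip g * Y * g)" by (simp only: sc_comm mult.assoc)
      finally show ?thesis using g by (simp only: recip)
    qed
    have t: "tr2 (A * (recip g * Y * g)) = tr2 (g * A * recip g * Y)" for Y
      using tr2_comm[of "A * (recip g * Y)" g] by (simp only: mult.assoc)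
    have "mat2 g \<in> inertia_group w red \<psi> (mat2 (map_m2 red A)) \<longleftrightarrow>
        (\<forall>Y. \<psi> (w * tr2 (g * A * recip g * Y)) = \<psi> (w * tr2 (A * Y)))"
    proof -
      have "phi w red \<psi> (mat2 (map_m2 red A)) (inv\<^bsub>GL 2\<^esub> mat2 g \<otimes>\<^bsub>GL 2\<^esub> mat2 (1 + sc w * Y) \<otimes>\<^bsub>GL 2\<^esub> mat2 g)
          = \<psi> (w * tr2 (g * A * recip g * Y))" for Y
        using phi_mat2[of A "recip g * Y * g"] by (simp only: GL2_inv[OF g] GL_mult mat2_mult c t)
      moreover have "mat2 g \<in> inertia_group w red \<psi> (mat2 (map_m2 red A)) \<longleftrightarrow>
          (\<forall>Y. phi w red \<psi> (mat2 (map_m2 red A)) (inv\<^bsub>GL 2\<^esub> mat2 g \<otimes>\<^bsub>GL 2\<^esub> mat2 (1 + sc w * Y) \<otimes>\<^bsub>GL 2\<^esub> mat2 g)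
            = phi w red \<psi> (mat2 (map_m2 red A)) (mat2 (1 + sc w * Y)))"
        using g unfolding inertia_group_def congruence_subgroup_eq mem_Collect_eq GL2_mem by blast
      ultimately show ?thesis by (simp only: phi_mat2)
    qed
    also have "\<dots> \<longleftrightarrow> (\<forall>Y. \<psi> (w * tr2 ((g * A * recip g - A) * Y)) = 1)"
    proof -
      have "\<psi> (w * tr2 ((g * A * recip g - A) * Y)) = \<psi> (w * tr2 (g * A * recip g * Y)) / \<psi> (w * tr2 (A * Y))" for Y
        by (simp only: left_diff_distrib tr2_diff right_diff_distrib psi_diff)
      thus ?thesis using psi_nz by simp
    qed
    also have "\<dots> \<longleftrightarrow> sc w * (g * A * recip g - A) = 0"
    proof
      assume "sc w * (g * A * recip g - A) = 0"
      hence "w * tr2 ((g * A * recip g - A) * Y) = 0" for Y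
        by (simp only: tr2_sc[symmetric] mult.assoc[symmetric] mult_zero_left) (simp add: m2_simps)
      thus "\<forall>Y. \<psi> (w * tr2 ((g * A * recip g - A) * Y)) = 1" by simp
    qed (use trace_nondegenerate in blast)
    also have "\<dots> \<longleftrightarrow> sc w * (g * A * recip g) = sc w * A" by (simp only: right_diff_distrib eq_iff_diff_eq_0[symmetric])
    also have "\<dots> \<longleftrightarrow> sc w * (g * A) = sc w * (A * g)"
    proof
      assume e: "sc w * (g * A * recip g) = sc w * A"
      have "sc w * (g * A) = sc w * (g * A * recip g) * g" using g by (simp add: mult.assoc recip)
      also have "\<dots> = sc w * (A * g)" by (simp only: e) (simp only: mult.assoc)
      finally show "sc w * (g * A) = sc w * (A * g)" .
    next
      assume e: "sc w * (g * A) = sc w * (A * g)"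
      have "sc w * (g * A * recip g) = (sc w * (g * A)) * recip g" by (simp only: mult.assoc)
      also have "\<dots> = sc w * A" using g by (simp only: e) (simp add: mult.assoc recip)
      finally show "sc w * (g * A * recip g) = sc w * A" .
    qed
    finally show ?thesis using g by (simp add: cent_def)
  qed
  moreover have "inertia_group w red \<psi> (mat2 (map_m2 red A)) \<subseteq> mat2 ` Collect invertible"
    unfolding inertia_group_def GL2_carrier by blast
  ultimately show ?thesis using cent_invertible by blast
qed

lemma cuspidal_datum:
  assumes d: "strongly_cuspidal_datum w red \<psi> (mat2 (map_m2 red (x * N * recip x))) \<Phi>" and x: "invertible x"
  shows "cusp w \<psi> N (\<lambda>h. \<Phi> (mat2 (x * h * recip x)))"
    and "cuspidal_rep w red \<psi> (mat2 (map_m2 red (x * N * recip x))) \<Phi>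
      = Ind (GL 2) (mat2 ` (\<lambda>h. x * h * recip x) ` cent N) (character_rep \<Phi>)"
proof -
  have I: "inertia_group w red \<psi> (mat2 (map_m2 red (x * N * recip x))) = mat2 ` (\<lambda>h. x * h * recip x) ` cent N"
    unfolding inertia_group_eq cent_conj[OF x] ..
  show "cuspidal_rep w red \<psi> (mat2 (map_m2 red (x * N * recip x))) \<Phi>
      = Ind (GL 2) (mat2 ` (\<lambda>h. x * h * recip x) ` cent N) (character_rep \<Phi>)"
    unfolding cuspidal_rep_def I ..
  show "cusp w \<psi> N (\<lambda>h. \<Phi> (mat2 (x * h * recip x)))"
  proof
    fix g h assume gh: "g \<in> cent N" "h \<in> cent N"
    have "\<Phi> (mat2 (x * g * recip x) * mat2 (x * h * recip x)) = \<Phi> (mat2 (x * g * recip x)) * \<Phi> (mat2 (x * h * recip x))"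
      using d gh unfolding strongly_cuspidal_datum_def linear_character_def I GL_mult by blast
    moreover have "(x * g * recip x) * (x * h * recip x) = x * (g * h) * recip x"
      using x by (simp add: mult.assoc recip_cancel)
    ultimately show "\<Phi> (mat2 (x * (g * h) * recip x)) = \<Phi> (mat2 (x * g * recip x)) * \<Phi> (mat2 (x * h * recip x))"
      by (simp only: mat2_mult)
  next
    fix Y
    have "x * (1 + sc w * Y) * recip x = x * recip x + x * (sc w * Y) * recip x"
      by (simp only: distrib_left distrib_right mult_1_right)
    also have "x * (sc w * Y) * recip x = sc w * (x * Y * recip x)" by (simp only: sc_comm mult.assoc)
    finally have e: "x * (1 + sc w * Y) * recip x = 1 + sc w * (x * Y * recip x)" using x by (simp only: recip)
    have "\<Phi> (mat2 (1 + sc w * (x * Y * recip x)))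
        = phi w red \<psi> (mat2 (map_m2 red (x * N * recip x))) (mat2 (1 + sc w * (x * Y * recip x)))"
      using d unfolding strongly_cuspidal_datum_def congruence_subgroup_eq by blast
    also have "\<dots> = \<psi> (w * tr2 (x * N * recip x * (x * Y * recip x)))" by (rule phi_mat2)
    also have "x * N * recip x * (x * Y * recip x) = recip (recip x) * (N * Y) * recip x"
      using x by (simp add: mult.assoc recip_cancel)
    also have "tr2 (recip (recip x) * (N * Y) * recip x) = tr2 (N * Y)" using x by (intro tr2_conj) simp
    finally show "\<Phi> (mat2 (x * (1 + sc w * Y) * recip x)) = \<psi> (w * tr2 (N * Y))" by (simp only: e)
  qed
qed

text \<open>With the first basis vector kept, the second one of the new basis is forced: it is
  \<open>b - a\<close> applied to the first. The two vectors are independent because the lower left entry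
  of \<open>b\<close> is nonzero, and the Cayley-Hamilton theorem gives the second column.\<close>

lemma conjugate_to_normal_form:
  assumes b: "e21 b \<noteq> 0" and tr: "red a + red d = tr2 b" and det: "red a * red d - red q = det2 b"
  obtains x where "invertible x" "map_m2 red (x * M2 a q 1 d * recip x) = b"
proof -
  obtain p r \<beta> \<sigma> where bb: "b = M2 p r \<beta> \<sigma>" by (cases b)
  obtain y \<beta>' where y: "red y = p - red a" "red \<beta>' = \<beta>" using red_surj by (metis surjD)
  let ?x = "M2 1 y 0 \<beta>'" and ?N = "M2 a q 1 d"
  have x: "invertible ?x" using b by (simp add: invertible_det2 red_invertible y bb)
  have d: "red d = p + \<sigma> - red a" using tr by (simp add: bb algebra_simps)
  have q: "red q = red a * (p + \<sigma> - red a) - (p * \<sigma> - r * \<beta>)" using det by (simp add: bb d algebra_simps)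
  have "map_m2 red (?x * ?N) = b * map_m2 red ?x"
    by (simp add: red_add red_mult red_one red_zero bb y d q algebra_simps)
  hence e: "map_m2 red (?x * ?N * recip ?x) = b * map_m2 red ?x * map_m2 red (recip ?x)"
    by (simp only: map2_mult)
  have "map_m2 red (?x * ?N * recip ?x) = b * (map_m2 red ?x * map_m2 red (recip ?x))"
    by (simp only: e) (simp only: mult.assoc)
  also have "\<dots> = b" using x by (simp only: map2_mult[symmetric] recip map2_one mult_1_right)
  finally show thesis using that x by blast
qed

theorem whittaker_decomposition:
  assumes D1: "strongly_cuspidal_datum w red \<psi> B1 \<Phi>1" and D2: "strongly_cuspidal_datum w red \<psi> B2 \<Phi>2"
    and tr: "mat_trace B1 \<noteq> mat_trace B2"
  defines "\<pi>1 \<equiv> cuspidal_rep w red \<psi> B1 \<Phi>1" and "\<pi>2 \<equiv> cuspidal_rep w red \<psi> B2 \<Phi>2"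
  defines "\<pi> \<equiv> Ind (GL 4) block_parabolic (rep_pullback levi_projection (outer_tensor \<pi>1 \<pi>2))"
  shows "rep_iso (GL 2) (degenerate_Whittaker \<psi> \<pi>)
    ((\<pi>1 \<otimes>\<^sub>R \<pi>2)
      \<oplus>\<^sub>R Ind (GL 2) borel2 (character_rep (borel_character (central_character 2 \<pi>1) (central_character 2 \<pi>2)))
      \<oplus>\<^sub>R Ind (GL 2) (center_congruence w)
            (character_rep (center_congruence_character w (central_character 4 \<pi>)
               (phi w red \<psi> (mat_diag 2 (\<lambda>i. if i = 0 then mat_trace B1 else mat_trace B2))))))"
proof -
  obtain b1 b2 where b: "B1 = mat2 b1" "B2 = mat2 b2"
    using D1 D2 unfolding strongly_cuspidal_datum_def by (metis carrier_mat2E)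
  have e21: "e21 b1 \<noteq> 0" "e21 b2 \<noteq> 0"
    using D1 D2 unfolding strongly_cuspidal_datum_def b by (auto dest: char_poly_irreducible_e21)
  have tr': "tr2 b1 - tr2 b2 \<noteq> 0" using tr by (simp add: b)
  \<comment> \<open>this \<open>s\<close> makes \<open>s (t1 - s) - det b1\<close> and \<open>s (t2 - s) - det b2\<close> equal, so that one \<open>q\<close> serves both normal forms\<close>
  obtain t1 t2 s where t: "red t1 = tr2 b1" "red t2 = tr2 b2" "red s = (det2 b1 - det2 b2) / (tr2 b1 - tr2 b2)"
    using red_surj by (metis surjD)
  obtain q where q: "red q = red s * (red t1 - red s) - det2 b1" using red_surj by (metis surjD)
  have sd: "red s * (tr2 b1 - tr2 b2) = det2 b1 - det2 b2" using tr' by (simp add: t(3))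
  obtain x1 where x1: "invertible x1" "map_m2 red (x1 * M2 s q 1 (t1 - s) * recip x1) = b1"
    by (rule conjugate_to_normal_form[OF e21(1), of s "t1 - s" q]) (simp_all add: red_diff t(1) q algebra_simps)
  obtain x2 where x2: "invertible x2" "map_m2 red (x2 * M2 (t2 - s) q 1 s * recip x2) = b2"
    by (rule conjugate_to_normal_form[OF e21(2), of "t2 - s" s q])
       (use sd in \<open>simp_all add: red_diff t(1,2) q algebra_simps\<close>)
  note d1 = cuspidal_datum[OF D1[unfolded b x1(2)[symmetric]] x1(1)]
  note d2 = cuspidal_datum[OF D2[unfolded b x2(2)[symmetric]] x2(1)]
  interpret c1: cusp w \<psi> "M2 s q 1 (t1 - s)" "\<lambda>h. \<Phi>1 (mat2 (x1 * h * recip x1))" by (rule d1(1))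
  interpret c2: cusp w \<psi> "M2 (t2 - s) q 1 s" "\<lambda>h. \<Phi>2 (mat2 (x2 * h * recip x2))" by (rule d2(1))
  interpret R: realization w \<psi> s q t1 t2 "\<lambda>h. \<Phi>1 (mat2 (x1 * h * recip x1))" "\<lambda>h. \<Phi>2 (mat2 (x2 * h * recip x2))"
    x1 x2 \<Phi>1 \<Phi>2
    by unfold_locales (use x1 x2 tr' in \<open>simp_all add: red_invertible red_diff t\<close>)
  have p: "\<pi>1 = R.V1" "\<pi>2 = R.V2"
    using d1(2) d2(2) by (simp_all add: \<pi>1_def \<pi>2_def b x1(2) x2(2) R.S1_def R.S2_def)
  have B: "mat_diag 2 (\<lambda>i. if i = 0 then mat_trace B1 else mat_trace B2) = mat2 (map_m2 red (M2 t1 0 0 t2))"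
    by (rule eq_mat2I) (simp_all add: b t red_zero mat_diag_def)
  have D: "tr2 (M2 t1 0 0 t2 * Y) = t1 * e11 Y + t2 * e22 Y" for Y by (cases Y) simp
  show ?thesis unfolding \<pi>_def p B
    by (rule R.whittaker_decomposition) (simp only: phi_mat2 D)
qed

end

section \<open>Finiteness of the residue field\<close>

locale discrete_valuation =
  fixes v :: "'f::field \<Rightarrow> int"
  assumes normalized: "normalized_valuation v"
begin

lemma val_mult: "x \<noteq> 0 \<Longrightarrow> y \<noteq> 0 \<Longrightarrow> v (x * y) = v x + v y"
  using normalized unfolding normalized_valuation_def by blast

lemma val_one: "v 1 = 0" using val_mult[of 1 1] by simp

lemma val_inverse: "x \<noteq> 0 \<Longrightarrow> v (inverse x) = - v x"
  using val_mult[of x "inverse x"] val_one by simp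

lemma val_minus:
  assumes "y \<noteq> 0" shows "v (- y) = v y"
proof -
  have "v (- 1) + v (- 1) = 0" using val_mult[of "-1" "-1"] val_one by simp
  thus ?thesis using val_mult[of "-1" y] assms by simp
qed

lemma o_mult: "x \<in> valuation_ring v \<Longrightarrow> y \<in> valuation_ring v \<Longrightarrow> x * y \<in> valuation_ring v"
  using val_mult[of x y] by (cases "x = 0 \<or> y = 0") (auto simp: valuation_ring_def)

lemma o_add:
  assumes "x \<in> valuation_ring v" "y \<in> valuation_ring v"
  shows "x + y \<in> valuation_ring v"
proof (cases "x = 0 \<or> y = 0 \<or> x + y = 0")
  case False
  hence "min (v x) (v y) \<le> v (x + y)"
    using normalized unfolding normalized_valuation_def by blast
  thus ?thesis using assms False by (auto simp: valuation_ring_def)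
qed (use assms in \<open>auto simp: valuation_ring_def\<close>)

lemma o_neg: "y \<in> valuation_ring v \<Longrightarrow> - y \<in> valuation_ring v"
  using val_minus[of y] by (cases "y = 0") (auto simp: valuation_ring_def)

lemma o_zero: "0 \<in> valuation_ring v" and o_one: "1 \<in> valuation_ring v"
  by (simp_all add: valuation_ring_def val_one)

lemma divide_uniformizer:
  assumes "uniformizer v uf" "x \<noteq> 0" "0 < v x"
  shows "\<exists>y\<in>valuation_ring v. x = uf * y"
proof (rule bexI[of _ "inverse uf * x"])
  have u: "uf \<noteq> 0" "v uf = 1" using assms(1) by (auto simp: uniformizer_def)
  show "x = uf * (inverse uf * x)" using u by (simp flip: mult.assoc)
  show "inverse uf * x \<in> valuation_ring v"
    using val_mult[of "inverse uf" x] val_inverse[of uf] u assms by (simp add: valuation_ring_def)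
qed

end

lemma (in vector_space) independent_card_bound:
  assumes "finite S" "span S = UNIV" "independent E"
  shows "finite E \<and> card E \<le> card S"
  using independent_span_bound[OF assms(1,3)] assms(2) by simp

text \<open>Elements of the valuation ring whose reductions are independent over the residue field of the base are independent
  over the base field: divide a linear relation by a coefficient of least valuation. So a
  residually independent set has at most as many elements as a spanning set of the extension,
  and by maximality the reductions of a largest one span the residue field over the
  finite residue field of the base. The latter enters through a finite set \<open>T\<close> of representatives
  modulo a nonunit \<open>c\<close>.\<close>

lemma unramified_residue_finite:
  fixes \<iota> :: "'b::field \<Rightarrow> 'f::field" and \<O> :: "'b set" and v :: "'f \<Rightarrow> int" and \<rho> :: "'f \<Rightarrow> 'k::field"
  assumes ext: "finite_unramified_extension \<iota> \<O> v"
    and c: "c \<in> \<O>" "c \<noteq> 0" "inverse c \<notin> \<O>"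
    and T: "finite T" "T \<subseteq> \<O>" "\<And>x. x \<in> \<O> \<Longrightarrow> \<exists>t\<in>T. \<exists>y\<in>\<O>. x = t + c * y"
    and \<rho>: "quotient_by (valuation_ring v) uf \<rho>" and uf: "uniformizer v uf"
  shows "finite (UNIV :: 'k set)"
proof -
  let ?o = "valuation_ring v"
  have \<iota>: "\<iota> 1 = 1" "\<And>x y. \<iota> (x + y) = \<iota> x + \<iota> y" "\<And>x y. \<iota> (x * y) = \<iota> x * \<iota> y"
    and nv: "normalized_valuation v" and O: "\<And>a. a \<in> \<O> \<longleftrightarrow> \<iota> a \<in> ?o"
    using ext unfolding finite_unramified_extension_def by blast+
  obtain S where S: "finite S" "\<And>x. \<exists>c. x = (\<Sum>s\<in>S. \<iota> (c s) * s)"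
    using ext unfolding finite_unramified_extension_def by blast
  interpret discrete_valuation v by unfold_locales (rule nv)
  have o_sum: "sum f A \<in> ?o" if "\<And>a. a \<in> A \<Longrightarrow> f a \<in> ?o" for f and A :: "'f set"
    using that by (induction A rule: infinite_finite_induct) (auto simp: o_zero o_add)
  have \<iota>0: "\<iota> 0 = 0" using \<iota>(2)[of 0 0] by (metis add.right_neutral add_left_cancel)
  have \<iota>nz: "\<iota> x \<noteq> 0" if "x \<noteq> 0" for x
    using \<iota>(3)[of x "inverse x"] \<iota>(1) that by auto
  have \<iota>inv: "\<iota> (inverse x) = inverse (\<iota> x)" if "x \<noteq> 0" for x
    using \<iota>(3)[of x "inverse x"] \<iota>(1) that by (simp add: inverse_unique)
  have \<rho>q: "\<rho> 1 = 1" "\<And>x y. x \<in> ?o \<Longrightarrow> y \<in> ?o \<Longrightarrow> \<rho> (x + y) = \<rho> x + \<rho> y"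
    "\<And>x y. x \<in> ?o \<Longrightarrow> y \<in> ?o \<Longrightarrow> \<rho> (x * y) = \<rho> x * \<rho> y" "\<rho> ` ?o = UNIV"
    "\<And>x. x \<in> ?o \<Longrightarrow> \<rho> x = 0 \<longleftrightarrow> (\<exists>y\<in>?o. x = uf * y)"
    using \<rho> unfolding quotient_by_def by blast+
  have \<rho>0: "\<rho> 0 = 0" using \<rho>q(2)[OF o_zero o_zero] by (metis add.right_neutral add_left_cancel)
  have \<rho>sum: "\<rho> (sum f A) = (\<Sum>a\<in>A. \<rho> (f a))" if "\<And>a. a \<in> A \<Longrightarrow> f a \<in> ?o" for f and A :: "'f set"
    using that
  proof (induction A rule: infinite_finite_induct)
    case (insert a A)
    thus ?case using \<rho>q(2)[of "f a" "sum f A"] o_sum[of A f] by simp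
  qed (simp_all add: \<rho>0)
  have pos: "\<rho> x = 0" if "x \<noteq> 0" "0 < v x" for x
  proof -
    have "\<exists>y\<in>?o. x = uf * y" using divide_uniformizer[OF uf that] .
    moreover have "x \<in> ?o" using that by (simp add: valuation_ring_def)
    ultimately show ?thesis using \<rho>q(5) by blast
  qed
  have c0: "\<rho> (\<iota> c) = 0"
  proof (rule pos)
    show "\<iota> c \<noteq> 0" using \<iota>nz c by blast
    show "0 < v (\<iota> c)"
      using c(3) \<iota>nz[OF c(2)] unfolding O \<iota>inv[OF c(2)] by (auto simp: valuation_ring_def val_inverse)
  qed
  have red_T: "\<exists>t\<in>T. \<rho> (\<iota> x) = \<rho> (\<iota> t)" if x: "x \<in> \<O>" for x
  proof -
    obtain t y where ty: "t \<in> T" "y \<in> \<O>" "x = t + c * y" using T(3)[OF x] by blast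
    have "\<iota> t \<in> ?o" "\<iota> c \<in> ?o" "\<iota> y \<in> ?o" using ty T(2) c O by blast+
    hence "\<rho> (\<iota> x) = \<rho> (\<iota> t) + \<rho> (\<iota> c) * \<rho> (\<iota> y)"
      by (simp add: ty(3) \<iota> \<rho>q o_mult)
    thus ?thesis using ty(1) c0 by auto
  qed
  interpret vs: vector_space "\<lambda>c x. \<iota> c * x"
    by unfold_locales (simp_all add: \<iota> algebra_simps)
  have "vs.span S = UNIV"
  proof -
    have "x \<in> vs.span S" for x
    proof -
      obtain c where "x = (\<Sum>s\<in>S. \<iota> (c s) * s)" using S(2) by blast
      moreover have "\<iota> (c s) * s \<in> vs.span S" if "s \<in> S" for s
        using vs.span_scale[OF vs.span_base[OF that], of "c s"] .
      ultimately show ?thesis using vs.span_sum[of S "\<lambda>s. \<iota> (c s) * s" S] by simp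
    qed
    thus ?thesis by blast
  qed
  note bound = vs.independent_card_bound[OF S(1) this]
  \<comment> \<open>residually independent sets\<close>
  define RI where "RI E \<longleftrightarrow> finite E \<and> E \<subseteq> ?o \<and>
    (\<forall>d. (\<forall>e\<in>E. d e \<in> \<O>) \<longrightarrow> \<rho> (\<Sum>e\<in>E. \<iota> (d e) * e) = 0 \<longrightarrow> (\<forall>e\<in>E. \<rho> (\<iota> (d e)) = 0))" for E
  have unit: "inverse x \<in> \<O>" if "x \<in> \<O>" "\<rho> (\<iota> x) \<noteq> 0" for x
  proof -
    have x0: "x \<noteq> 0" using that \<iota>0 \<rho>0 by auto
    have "\<not> 0 < v (\<iota> x)" using pos[OF \<iota>nz[OF x0]] that by blast
    hence "v (inverse (\<iota> x)) \<ge> 0" using val_inverse[OF \<iota>nz[OF x0]] by simp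
    thus ?thesis unfolding O \<iota>inv[OF x0] by (simp add: valuation_ring_def)
  qed
  have card: "card E \<le> card S" if E: "RI E" for E
  proof -
    have fin: "finite E" using E by (simp add: RI_def)
    have "vs.independent E"
    proof
      assume "vs.dependent E"
      then obtain u where u: "(\<Sum>e\<in>E. \<iota> (u e) * e) = 0" "\<exists>e\<in>E. u e \<noteq> 0"
        unfolding vs.dependent_finite[OF fin] by blast
      let ?N = "{e \<in> E. u e \<noteq> 0}"
      have N: "finite ?N" "?N \<noteq> {}" using u fin by auto
      \<comment> \<open>a coefficient of least valuation\<close>
      obtain e0 where e0: "e0 \<in> ?N" "\<And>e. e \<in> ?N \<Longrightarrow> v (\<iota> (u e0)) \<le> v (\<iota> (u e))"
        using ex_is_arg_min_if_finite[OF N, of "\<lambda>e. v (\<iota> (u e))"] unfolding is_arg_min_linorder by blast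
      define d where "d e = inverse (u e0) * u e" for e
      have "d e \<in> \<O>" if "e \<in> E" for e
      proof (cases "u e = 0")
        case True
        thus ?thesis unfolding O by (simp add: d_def \<iota>0 o_zero)
      next
        case False
        have "v (\<iota> (d e)) = v (\<iota> (u e)) - v (\<iota> (u e0))"
          using False e0(1) by (simp add: d_def \<iota>(3) \<iota>inv val_mult \<iota>nz val_inverse)
        thus ?thesis unfolding O using e0(2)[of e] False that by (simp add: valuation_ring_def)
      qed
      moreover have "(\<Sum>e\<in>E. \<iota> (d e) * e) = \<iota> (inverse (u e0)) * (\<Sum>e\<in>E. \<iota> (u e) * e)"
        by (simp only: d_def \<iota>(3) sum_distrib_left mult.assoc)
      hence "\<rho> (\<Sum>e\<in>E. \<iota> (d e) * e) = 0" using u \<rho>0 by simp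
      ultimately have "\<rho> (\<iota> (d e0)) = 0" using E e0(1) unfolding RI_def by blast
      moreover have "d e0 = 1" using e0(1) by (simp add: d_def)
      ultimately show False using \<iota>(1) \<rho>q(1) by simp
    qed
    thus ?thesis using bound by blast
  qed
  have "RI {}" by (simp add: RI_def)
  moreover have "\<forall>E. RI E \<longrightarrow> card E < Suc (card S)" using card by (simp add: less_Suc_eq_le)
  ultimately have "\<exists>E. RI E \<and> (\<forall>E'. RI E' \<longrightarrow> card E' \<le> card E)" by (rule ex_has_greatest_nat)
  then obtain E where E: "RI E" and max: "\<And>E'. RI E' \<Longrightarrow> card E' \<le> card E" by blast
  have fin: "finite E" and Eo: "E \<subseteq> ?o" using E by (simp_all add: RI_def)
  have "(UNIV :: 'k set) \<subseteq> (\<lambda>d. \<Sum>e\<in>E. \<rho> (\<iota> (d e)) * \<rho> e) ` (E \<rightarrow>\<^sub>E T)"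
  proof
    fix z :: 'k
    obtain x where x: "x \<in> ?o" "\<rho> x = z" using \<rho>q(4) by (metis UNIV_I imageE)
    have "\<exists>d. (\<forall>e\<in>E. d e \<in> \<O>) \<and> z = (\<Sum>e\<in>E. \<rho> (\<iota> (d e)) * \<rho> e)"
    proof (cases "x \<in> E")
      case True
      have "1 \<in> \<O>" "0 \<in> \<O>" unfolding O \<iota>0 \<iota>(1) using o_zero o_one by simp_all
      moreover have "(\<Sum>e\<in>E. \<rho> (\<iota> (if e = x then 1 else 0)) * \<rho> e) = (\<Sum>e\<in>E. if e = x then \<rho> e else 0)"
        by (intro sum.cong) (auto simp: \<iota>0 \<iota>(1) \<rho>0 \<rho>q(1))
      hence "(\<Sum>e\<in>E. \<rho> (\<iota> (if e = x then 1 else 0)) * \<rho> e) = z" using True fin x by simp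
      ultimately show ?thesis by (intro exI[of _ "\<lambda>e. if e = x then 1 else 0"]) auto
    next
      case False
      have "\<not> RI (insert x E)" using max[of "insert x E"] False fin by auto
      then obtain d where d: "\<forall>e\<in>insert x E. d e \<in> \<O>" "\<rho> (\<Sum>e\<in>insert x E. \<iota> (d e) * e) = 0"
        "\<not> (\<forall>e\<in>insert x E. \<rho> (\<iota> (d e)) = 0)"
        unfolding RI_def using fin Eo x by blast
      have m: "\<iota> (d e) * e \<in> ?o" if "e \<in> insert x E" for e
        using that d(1) Eo x O o_mult by blast
      have "\<rho> (\<Sum>e\<in>insert x E. \<iota> (d e) * e) = \<rho> (\<iota> (d x) * x) + \<rho> (\<Sum>e\<in>E. \<iota> (d e) * e)"
        using False fin m o_sum[of E "\<lambda>e. \<iota> (d e) * e"] by (simp add: \<rho>q(2))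
      hence rel: "\<rho> (\<iota> (d x)) * z + \<rho> (\<Sum>e\<in>E. \<iota> (d e) * e) = 0"
        using d(1,2) x O by (simp add: \<rho>q(3))
      have dx: "\<rho> (\<iota> (d x)) \<noteq> 0"
      proof
        assume "\<rho> (\<iota> (d x)) = 0"
        moreover from this have "\<forall>e\<in>E. \<rho> (\<iota> (d e)) = 0" using rel E d(1) unfolding RI_def by simp
        ultimately show False using d(3) by blast
      qed
      have S': "\<rho> (\<Sum>e\<in>E. \<iota> (d e) * e) = (\<Sum>e\<in>E. \<rho> (\<iota> (d e)) * \<rho> e)"
        using m d(1) Eo O by (subst \<rho>sum) (auto intro!: sum.cong \<rho>q(3))
      let ?d = "\<lambda>e. - (inverse (d x) * d e)"
      have iO: "inverse (d x) \<in> \<O>" using unit d(1) dx by blast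
      have \<iota>m: "\<iota> (- y) = - \<iota> y" for y using \<iota>(2)[of y "- y"] \<iota>0 by (simp add: eq_neg_iff_add_eq_0 add.commute)
      have \<rho>m: "\<rho> (- y) = - \<rho> y" if "y \<in> ?o" for y
        using \<rho>q(2)[OF that o_neg[OF that]] \<rho>0 by (simp add: eq_neg_iff_add_eq_0 add.commute)
      have mem: "\<iota> (inverse (d x)) * \<iota> (d e) \<in> ?o" if "e \<in> E" for e
        using iO d(1) that O o_mult by blast
      have dO: "?d e \<in> \<O>" if "e \<in> E" for e
        unfolding O \<iota>m \<iota>(3) using o_neg mem that by blast
      have r: "\<rho> (\<iota> (inverse (d x))) * \<rho> (\<iota> (d x)) = 1"
      proof -
        have "d x \<noteq> 0" using dx \<iota>0 \<rho>0 by auto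
        hence "\<iota> (inverse (d x)) * \<iota> (d x) = 1" by (simp flip: \<iota>)
        thus ?thesis using \<rho>q(3)[of "\<iota> (inverse (d x))" "\<iota> (d x)"] \<rho>q(1) iO d(1) O by simp
      qed
      have "(\<Sum>e\<in>E. \<rho> (\<iota> (?d e)) * \<rho> e) = (\<Sum>e\<in>E. - (\<rho> (\<iota> (inverse (d x))) * (\<rho> (\<iota> (d e)) * \<rho> e)))"
      proof (rule sum.cong)
        fix e assume e: "e \<in> E"
        have "\<rho> (\<iota> (?d e)) = - (\<rho> (\<iota> (inverse (d x))) * \<rho> (\<iota> (d e)))"
          using e mem iO d(1) O by (simp add: \<iota>m \<iota>(3) \<rho>m \<rho>q(3))
        thus "\<rho> (\<iota> (?d e)) * \<rho> e = - (\<rho> (\<iota> (inverse (d x))) * (\<rho> (\<iota> (d e)) * \<rho> e))" by simp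
      qed simp
      also have "\<dots> = - (\<rho> (\<iota> (inverse (d x))) * \<rho> (\<Sum>e\<in>E. \<iota> (d e) * e))"
        by (simp add: S' sum_distrib_left sum_negf)
      also have "\<dots> = \<rho> (\<iota> (inverse (d x))) * (\<rho> (\<iota> (d x)) * z)"
        using rel by (simp add: add_eq_0_iff)
      also have "\<dots> = z" using r by (simp flip: mult.assoc)
      finally have "(\<Sum>e\<in>E. \<rho> (\<iota> (?d e)) * \<rho> e) = z" .
      hence zE: "z = (\<Sum>e\<in>E. \<rho> (\<iota> (?d e)) * \<rho> e)" by (rule sym)
      have dOE: "\<forall>e\<in>E. ?d e \<in> \<O>" by (rule ballI, rule dO)
      show ?thesis by (rule exI[of _ ?d], rule conjI[OF dOE zE])
    qed
    then obtain d where d: "\<forall>e\<in>E. d e \<in> \<O>" "z = (\<Sum>e\<in>E. \<rho> (\<iota> (d e)) * \<rho> e)" by blast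
    have "\<forall>e\<in>E. \<exists>t. t \<in> T \<and> \<rho> (\<iota> (d e)) = \<rho> (\<iota> t)"
      using d(1) red_T by blast
    from bchoice[OF this] obtain f where f: "\<forall>e\<in>E. f e \<in> T \<and> \<rho> (\<iota> (d e)) = \<rho> (\<iota> (f e))" by blast
    have "z = (\<Sum>e\<in>E. \<rho> (\<iota> (restrict f E e)) * \<rho> e)"
      unfolding d(2) using f by (intro sum.cong) auto
    moreover have "restrict f E \<in> E \<rightarrow>\<^sub>E T" using f by auto
    ultimately show "z \<in> (\<lambda>d. \<Sum>e\<in>E. \<rho> (\<iota> (d e)) * \<rho> e) ` (E \<rightarrow>\<^sub>E T)" by blast
  qed
  moreover have "finite (E \<rightarrow>\<^sub>E T)" using fin T(1) by (rule finite_PiE) 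
  ultimately show ?thesis using finite_surj by blast
qed

section \<open>The two kinds of local fields\<close>

lemma Rep_padic_of_nat: "Rep_padic_int (of_nat k :: 'p::prime_card padic_int) n = int k mod int CARD('p) ^ n"
  by (induction k) (simp_all add: zero_padic_int.rep_eq plus_padic_int.rep_eq one_padic_int.rep_eq mod_simps)

lemma Rep_padic_mod:
  "Rep_padic_int (a :: 'p::prime_card padic_int) (m + k) mod int CARD('p) ^ m = Rep_padic_int a m"
  using Rep_padic_int[of a] by (intro padic_mod_le) simp

lemma Rep_padic_range: "Rep_padic_int (a :: 'p::prime_card padic_int) n \<in> {0..<int CARD('p) ^ n}"
  using Rep_padic_int[of a] by simp

text \<open>The quotient has the components \<open>b (n + 1) / p\<close>.\<close>

lemma padic_div_p:
  fixes b :: "'p::prime_card padic_int"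
  assumes "Rep_padic_int b 1 = 0"
  shows "\<exists>y. b = of_nat CARD('p) * y"
proof -
  let ?p = "int CARD('p)"
  have p: "?p > 1" by (rule padic_p_gt_1)
  define f where "f n = Rep_padic_int b (Suc n) div ?p" for n
  have "f n \<in> {0..<?p ^ n} \<and> f (Suc n) mod ?p ^ n = f n" for n
  proof
    show "f n \<in> {0..<?p ^ n}"
    proof -
      let ?b = "Rep_padic_int b (Suc n)"
      have r: "0 \<le> ?b" "?b < ?p * ?p ^ n" using Rep_padic_range[of b "Suc n"] by simp_all
      have "?p * (?b div ?p) + ?b mod ?p = ?b" by (rule mult_div_mod_eq)
      moreover have "0 \<le> ?b mod ?p" using p by simp
      ultimately have "?p * (?b div ?p) \<le> ?b" by linarith
      hence "?p * (?b div ?p) < ?p * ?p ^ n" using r(2) by (rule order.strict_trans1)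
      moreover have "0 < ?p" using p by linarith
      ultimately have "?b div ?p < ?p ^ n" by (simp only: mult_less_cancel_left_pos)
      moreover have "0 \<le> ?b div ?p" using r(1) p by (simp add: pos_imp_zdiv_nonneg_iff)
      ultimately show ?thesis by (simp add: f_def)
    qed
    have "f (Suc n) mod ?p ^ n = (Rep_padic_int b (Suc (Suc n)) mod (?p * ?p ^ n)) div ?p"
      using p by (simp add: f_def zmod_zmult2_eq)
    also have "Rep_padic_int b (Suc (Suc n)) mod (?p * ?p ^ n) = Rep_padic_int b (Suc n)"
      using Rep_padic_mod[of b "Suc n" 1] by simp
    finally show "f (Suc n) mod ?p ^ n = f n" by (simp add: f_def)
  qed
  moreover define y :: "'p padic_int" where "y = Abs_padic_int f"
  ultimately have R: "Rep_padic_int y = f"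
    unfolding y_def by (intro Abs_padic_int_inverse) simp
  have "Rep_padic_int (of_nat CARD('p) * y) n = Rep_padic_int b n" for n
  proof -
    have "?p dvd Rep_padic_int b (Suc n)"
      using Rep_padic_mod[of b 1 n] assms by (simp add: dvd_eq_mod_eq_0)
    hence "?p * f n = Rep_padic_int b (Suc n)" by (simp add: f_def)
    thus ?thesis using Rep_padic_mod[of b n 1]
      by (simp add: times_padic_int.rep_eq Rep_padic_of_nat R mod_simps)
  qed
  hence "b = of_nat CARD('p) * y" by (metis Rep_padic_int_inject ext)
  thus ?thesis by blast
qed

lemma padic_residues:
  fixes a :: "'p::prime_card padic_int"
  shows "\<exists>k<CARD('p). \<exists>y. a = of_nat k + of_nat CARD('p) * y"
proof -
  have r: "0 \<le> Rep_padic_int a 1" "Rep_padic_int a 1 < int CARD('p)"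
    using Rep_padic_range[of a 1] by simp_all
  define k where "k = nat (Rep_padic_int a 1)"
  have ik: "int k = Rep_padic_int a 1" using r(1) by (simp add: k_def)
  have "Rep_padic_int (a - of_nat k) 1 = 0"
    unfolding minus_padic_int.rep_eq Rep_padic_of_nat using ik by (simp add: mod_simps)
  then obtain y where "a - of_nat k = of_nat CARD('p) * y" using padic_div_p by blast
  hence "a = of_nat k + of_nat CARD('p) * y" by (simp add: algebra_simps)
  moreover have "k < CARD('p)" using r by (simp add: k_def)
  ultimately show ?thesis by blast
qed

lemma residue_finite_padic:
  fixes \<iota> :: "'p::prime_card padic \<Rightarrow> 'f::field" and \<rho> :: "'f \<Rightarrow> 'k::field"
  assumes ext: "finite_unramified_extension \<iota> padic_integers v"
    and \<rho>: "quotient_by (valuation_ring v) uf \<rho>" and uf: "uniformizer v uf"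
  shows "finite (UNIV :: 'k set)"
proof (rule unramified_residue_finite[OF ext _ _ _ _ _ _ \<rho> uf])
  let ?P = "of_nat CARD('p) :: 'p padic_int"
  let ?c = "Fract ?P 1"
  let ?T = "(\<lambda>k. Fract (of_nat k :: 'p padic_int) 1) ` {..<CARD('p)}"
  have p: "int CARD('p) > 1" by (rule padic_p_gt_1)
  have P0: "?P \<noteq> 0"
  proof
    assume "?P = 0"
    hence "int CARD('p) mod int CARD('p) ^ 2 = 0"
      using Rep_padic_of_nat[where 'p = 'p, of "CARD('p)" 2] by (simp add: zero_padic_int.rep_eq)
    moreover have "int CARD('p) < int CARD('p) ^ 2" using p by (simp add: power2_eq_square)
    ultimately show False using p by simp
  qed
  show "?c \<in> padic_integers" by (simp add: padic_integers_def)
  show "?c \<noteq> 0" using P0 by (simp add: Zero_fract_def eq_fract)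
  show "inverse ?c \<notin> padic_integers"
  proof
    assume "inverse ?c \<in> padic_integers"
    then obtain a where "Fract 1 ?P = Fract a 1" by (auto simp: padic_integers_def)
    hence "1 = a * ?P" using P0 by (simp add: eq_fract)
    hence "Rep_padic_int (1 :: 'p padic_int) 1 = Rep_padic_int (a * ?P) 1" by (rule arg_cong)
    thus False using p by (simp add: times_padic_int.rep_eq Rep_padic_of_nat one_padic_int.rep_eq)
  qed
  show "finite ?T" by simp
  show "?T \<subseteq> padic_integers" by (auto simp: padic_integers_def)
  fix x :: "'p padic" assume "x \<in> padic_integers"
  then obtain a where a: "x = Fract a 1" by (auto simp: padic_integers_def)
  obtain k y where "k < CARD('p)" "a = of_nat k + ?P * y" using padic_residues by blast
  thus "\<exists>t\<in>?T. \<exists>y\<in>padic_integers. x = t + ?c * y"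
    unfolding a by (intro bexI[of _ "Fract (of_nat k) 1"] bexI[of _ "Fract y 1"]) (auto simp: padic_integers_def)
qed

lemma residue_finite_laurent:
  fixes \<iota> :: "'p::prime_card mod_ring fls \<Rightarrow> 'f::field" and \<rho> :: "'f \<Rightarrow> 'k::field"
  assumes ext: "finite_unramified_extension \<iota> (range fps_to_fls) v"
    and \<rho>: "quotient_by (valuation_ring v) uf \<rho>" and uf: "uniformizer v uf"
  shows "finite (UNIV :: 'k set)"
proof (rule unramified_residue_finite[OF ext _ _ _ _ _ _ \<rho> uf])
  let ?X = "fps_to_fls fps_X :: 'p mod_ring fls"
  let ?T = "range (\<lambda>a :: 'p mod_ring. fps_to_fls (fps_const a))"
  show "?X \<in> range fps_to_fls" by (rule rangeI)
  show "?X \<noteq> 0" by simp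
  show "inverse ?X \<notin> range fps_to_fls"
  proof
    assume "inverse ?X \<in> range fps_to_fls"
    then obtain f where f: "inverse ?X = fps_to_fls f" by blast
    have nz: "?X \<noteq> 0" by simp
    have "fps_to_fls (fps_X * f) = ?X * inverse ?X" unfolding f by (rule fls_times_fps_to_fls)
    also have "\<dots> = 1" by (rule right_inverse[OF nz])
    finally have "fps_X * f = 1" by (metis fps_one_to_fls fps_to_fls_eq_iff)
    hence "fps_nth (fps_X * f) 0 = fps_nth 1 0" by simp
    thus False by simp
  qed
  show "finite ?T" by simp
  show "?T \<subseteq> range fps_to_fls" by blast
  fix x :: "'p mod_ring fls" assume "x \<in> range fps_to_fls"
  then obtain f where f: "x = fps_to_fls f" by blast
  have "f = fps_const (fps_nth f 0) + fps_X * fps_shift 1 f"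
    by (rule fps_ext) (simp add: fps_X_mult_nth)
  hence "x = fps_to_fls (fps_const (fps_nth f 0)) + ?X * fps_to_fls (fps_shift 1 f)"
    unfolding f by (metis fps_to_fls_plus fls_times_fps_to_fls)
  thus "\<exists>t\<in>?T. \<exists>y\<in>range fps_to_fls. x = t + ?X * y" by blast
qed

lemma residue_field_finite:
  fixes \<rho> :: "'f::field \<Rightarrow> 'k::field"
  assumes "unramified_local_field TYPE('p::prime_card) v"
    and "quotient_by (valuation_ring v) uf \<rho>" "uniformizer v uf"
  shows "finite (UNIV :: 'k set)"
  using assms residue_finite_padic residue_finite_laurent unfolding unramified_local_field_def by blast

text \<open>Units of the valuation ring are the elements of valuation zero, and every element has a two-digit expansion
  \<open>\<sigma> a + uf * \<sigma> b\<close> modulo the square of the uniformizer, which bounds the quotient by the square of the residue field.\<close>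

lemma residueI:
  fixes v :: "'f::field \<Rightarrow> int" and red2 :: "'f \<Rightarrow> 'r::comm_ring_1" and red :: "'r \<Rightarrow> 'k::field"
  assumes nv: "normalized_valuation v" and uf: "uniformizer v uf"
    and q2: "quotient_by (valuation_ring v) (uf ^ 2) red2"
    and q1: "quotient_by (valuation_ring v) uf (red \<circ> red2)"
    and \<psi>: "additive_character (red2 uf) \<psi>"
    and fin: "finite (UNIV :: 'k set)"
  shows "residue (red2 uf) \<psi> red"
proof -
  let ?o = "valuation_ring v"
  let ?w = "red2 uf"
  interpret discrete_valuation v by unfold_locales (rule nv)
  have u: "uf \<noteq> 0" "v uf = 1" using uf by (auto simp: uniformizer_def)
  have o_mem: "0 \<in> ?o" "1 \<in> ?o" "uf \<in> ?o" by (simp_all add: valuation_ring_def val_one u)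
  have r2: "red2 1 = 1" "\<And>x y. x \<in> ?o \<Longrightarrow> y \<in> ?o \<Longrightarrow> red2 (x + y) = red2 x + red2 y"
    "\<And>x y. x \<in> ?o \<Longrightarrow> y \<in> ?o \<Longrightarrow> red2 (x * y) = red2 x * red2 y" "red2 ` ?o = UNIV"
    "\<And>x. x \<in> ?o \<Longrightarrow> red2 x = 0 \<longleftrightarrow> (\<exists>y\<in>?o. x = uf ^ 2 * y)"
    using q2 unfolding quotient_by_def by blast+
  have r1: "red (red2 1) = 1" "\<And>x y. x \<in> ?o \<Longrightarrow> y \<in> ?o \<Longrightarrow> red (red2 (x + y)) = red (red2 x) + red (red2 y)"
    "\<And>x y. x \<in> ?o \<Longrightarrow> y \<in> ?o \<Longrightarrow> red (red2 (x * y)) = red (red2 x) * red (red2 y)" "(red \<circ> red2) ` ?o = UNIV"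
    "\<And>x. x \<in> ?o \<Longrightarrow> red (red2 x) = 0 \<longleftrightarrow> (\<exists>y\<in>?o. x = uf * y)"
    using q1 unfolding quotient_by_def comp_def by blast+
  have lift: "\<exists>x\<in>?o. r = red2 x" for r using r2(4) by blast
  have ker: "red (red2 x) = 0 \<longleftrightarrow> ?w * red2 x = 0" if x: "x \<in> ?o" for x
  proof -
    have "?w * red2 x = 0 \<longleftrightarrow> (\<exists>y\<in>?o. uf * x = uf ^ 2 * y)"
      using r2(3)[OF o_mem(3) x] r2(5)[of "uf * x"] o_mult[OF o_mem(3) x] by simp
    also have "\<dots> \<longleftrightarrow> (\<exists>y\<in>?o. x = uf * y)" using u by (simp add: power2_eq_square mult.assoc)
    finally show ?thesis using r1(5)[OF x] by simp
  qed
  have "\<exists>x\<in>?o. (red \<circ> red2) x = z" for z using r1(4) by (metis UNIV_I imageE)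
  then obtain \<sigma> where \<sigma>: "\<And>z. \<sigma> z \<in> ?o" "\<And>z. red (red2 (\<sigma> z)) = z" unfolding comp_def by metis
  have digit: "\<exists>y\<in>?o. x = \<sigma> (red (red2 x)) + uf * y" if x: "x \<in> ?o" for x
  proof -
    let ?s = "\<sigma> (red (red2 x))"
    have "red (red2 (?s + (x - ?s))) = red (red2 ?s) + red (red2 (x - ?s))"
      using \<sigma>(1) o_add[OF x o_neg[OF \<sigma>(1)]] by (intro r1(2)) simp_all
    hence "red (red2 (x - ?s)) = 0" using \<sigma>(2) by simp
    moreover have "x - ?s \<in> ?o" using o_add[OF x o_neg[OF \<sigma>(1)]] by simp
    ultimately obtain y where "y \<in> ?o" "x - ?s = uf * y" using r1(5) by blast
    thus ?thesis by (intro bexI[of _ y]) (simp_all add: algebra_simps)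
  qed
  have "UNIV \<subseteq> (\<lambda>(a, b). red2 (\<sigma> a) + ?w * red2 (\<sigma> b)) ` (UNIV :: ('k \<times> 'k) set)"
  proof
    fix r :: 'r
    obtain x where x: "x \<in> ?o" "r = red2 x" using lift by blast
    obtain y where y: "y \<in> ?o" "x = \<sigma> (red (red2 x)) + uf * y" using digit[OF x(1)] by blast
    obtain z where z: "z \<in> ?o" "y = \<sigma> (red (red2 y)) + uf * z" using digit[OF y(1)] by blast
    have w0: "?w * (?w * red2 z) = 0"
      using r2(3)[of "uf ^ 2" z] r2(3)[OF o_mem(3,3)] r2(5)[of "uf ^ 2 * z"] z(1) o_mem o_mult
      by (metis mult.assoc power2_eq_square)
    have "red2 y = red2 (\<sigma> (red (red2 y))) + ?w * red2 z"
      by (subst z(2)) (simp add: r2 o_mult o_mem z(1) \<sigma>(1))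
    hence "?w * red2 y = ?w * (red2 (\<sigma> (red (red2 y))) + ?w * red2 z)" by (rule arg_cong)
    also have "\<dots> = ?w * red2 (\<sigma> (red (red2 y)))" by (simp only: distrib_left w0 add_0_right)
    finally have wy: "?w * red2 y = ?w * red2 (\<sigma> (red (red2 y)))" .
    have "red2 x = red2 (\<sigma> (red (red2 x))) + ?w * red2 y"
      by (subst y(2)) (simp add: r2 o_mult o_mem y(1) \<sigma>(1))
    hence "r = red2 (\<sigma> (red (red2 x))) + ?w * red2 (\<sigma> (red (red2 y)))" by (simp only: x(2) wy[symmetric])
    thus "r \<in> (\<lambda>(a, b). red2 (\<sigma> a) + ?w * red2 (\<sigma> b)) ` (UNIV :: ('k \<times> 'k) set)"
      by (intro image_eqI[of _ _ "(red (red2 x), red (red2 y))"]) simp_all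
  qed
  hence finR: "finite (UNIV :: 'r set)" using fin by (meson finite_Prod_UNIV finite_surj)
  have ann: "?w dvd r" if wr: "?w * r = 0" for r
  proof -
    obtain x where x: "x \<in> ?o" "r = red2 x" using lift by blast
    obtain y where "y \<in> ?o" "x = uf * y" using wr ker[OF x(1)] r1(5)[OF x(1)] x(2) by blast
    thus ?thesis using x r2(3)[OF o_mem(3)] by simp
  qed
  show ?thesis
  proof
    show "finite (UNIV :: 'r set)" by (rule finR)
    show "?w * ?w = 0" using ker[OF o_mem(3)] r1(5)[OF o_mem(3)] o_mem by (metis mult.right_neutral)
    show "invertible r \<or> ?w dvd r" for r
    proof (cases "?w * r = 0")
      case False
      obtain x where x: "x \<in> ?o" "r = red2 x" using lift by blast
      have x0: "x \<noteq> 0"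
      proof
        assume "x = 0"
        hence "red2 x = 0" using r2(5)[OF x(1)] o_mem(1) by force
        thus False using False x by simp
      qed
      have "\<not> 0 < v x"
      proof
        assume "0 < v x"
        hence "\<exists>y\<in>?o. x = uf * y" using divide_uniformizer[OF uf x0] by blast
        thus False using r1(5)[OF x(1)] ker[OF x(1)] False x(2) by blast
      qed
      hence "inverse x \<in> ?o" using val_inverse[OF x0] by (simp add: valuation_ring_def)
      hence "red2 x * red2 (inverse x) = 1" using r2(3)[OF x(1)] r2(1) x0 by (metis right_inverse)
      thus ?thesis using x(2) by (auto intro: invertibleI simp: mult.commute)
    qed (use ann in blast)
    show "?w dvd r" if "?w * r = 0" for r by (rule ann[OF that])
    show "\<psi> x \<noteq> 0" "\<psi> (x + y) = \<psi> x * \<psi> y" for x y using \<psi> unfolding additive_character_def by blast+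
    show "\<exists>x. \<psi> (?w * x) \<noteq> 1" using \<psi> unfolding additive_character_def by blast
    show "red 1 = 1" using r1(1) r2(1) by simp
    fix x y :: 'r
    obtain a b where a: "a \<in> ?o" "x = red2 a" and b: "b \<in> ?o" "y = red2 b" using lift by blast
    show "red (x + y) = red x + red y"
      using r1(2)[OF a(1) b(1)] unfolding a(2) b(2) r2(2)[OF a(1) b(1)] .
    show "red (x * y) = red x * red y"
      using r1(3)[OF a(1) b(1)] unfolding a(2) b(2) r2(3)[OF a(1) b(1)] .
  next
    show "surj red" by (rule surjI[of red "\<lambda>z. red2 (\<sigma> z)"]) (rule \<sigma>(2))
    fix x :: 'r
    obtain a where a: "a \<in> ?o" "x = red2 a" using lift by blast
    show "red x = 0 \<longleftrightarrow> ?w * x = 0" unfolding a(2) by (rule ker[OF a(1)])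
  qed
qed

lemma unramified_normalized: "unramified_local_field TYPE('p::prime_card) v \<Longrightarrow> normalized_valuation v"
  unfolding unramified_local_field_def finite_unramified_extension_def by blast

theorem theorem1p3:
  fixes v :: "'f::field \<Rightarrow> int"
    and uf :: 'f
    and red2 :: "'f \<Rightarrow> 'r::comm_ring_1"
    and red :: "'r \<Rightarrow> 'k::field"
    and \<psi>\<^sub>0 :: "'r \<Rightarrow> complex"
    and B1 B2 :: "'k mat"
    and \<phi>1 \<phi>2 :: "'r mat \<Rightarrow> complex"
  defines "\<oo> \<equiv> valuation_ring v"
    and "w \<equiv> red2 uf"
  defines "\<pi>1 \<equiv> cuspidal_rep w red \<psi>\<^sub>0 B1 \<phi>1"
    and "\<pi>2 \<equiv> cuspidal_rep w red \<psi>\<^sub>0 B2 \<phi>2"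
  defines "\<pi> \<equiv> Ind (GL 4) block_parabolic (rep_pullback levi_projection (outer_tensor \<pi>1 \<pi>2))"
  defines "\<omega>1 \<equiv> central_character 2 \<pi>1"
    and "\<omega>2 \<equiv> central_character 2 \<pi>2"
    and "\<omega> \<equiv> central_character 4 \<pi>"
    and "B \<equiv> mat_diag 2 (\<lambda>i. if i = 0 then mat_trace B1 else mat_trace B2)"
  assumes "odd CARD('p::prime_card)"
    and "unramified_local_field TYPE('p) v"
    and "uniformizer v uf"
    and "quotient_by \<oo> (uf ^ 2) red2"
    and "quotient_by \<oo> uf (red \<circ> red2)"
    and "additive_character w \<psi>\<^sub>0"
    and "strongly_cuspidal_datum w red \<psi>\<^sub>0 B1 \<phi>1"
    and "strongly_cuspidal_datum w red \<psi>\<^sub>0 B2 \<phi>2"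
    and "mat_trace B1 \<noteq> mat_trace B2"
  shows "rep_iso (GL 2)
    (degenerate_Whittaker \<psi>\<^sub>0 \<pi>)
    ((\<pi>1 \<otimes>\<^sub>R \<pi>2)
      \<oplus>\<^sub>R Ind (GL 2) borel2 (character_rep (borel_character \<omega>1 \<omega>2))
      \<oplus>\<^sub>R Ind (GL 2) (center_congruence w)
            (character_rep (center_congruence_character w \<omega> (phi w red \<psi>\<^sub>0 B))))"
proof -
  have "residue w \<psi>\<^sub>0 red"
    using assms(11-15) unfolding \<oo>_def w_def
    by (intro residueI[of v]) (auto intro: unramified_normalized residue_field_finite)
  then interpret residue w \<psi>\<^sub>0 red .
  show ?thesis
    using whittaker_decomposition[OF assms(16-18)]
    by (simp only: \<pi>_def \<pi>1_def \<pi>2_def \<omega>1_def \<omega>2_def \<omega>_def B_def)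
qed

end
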